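(* There exists a Lipschitz continuous, measure-preserving (invertible) map $T:\mathbb{T}^3\to\mathbb{T}^3$, isotopic to the identity, such that the operator $\mathcal{L}$ defined by $\mathcal{L}B=(DT\,B)\circ T^{-1}$ satisfies $$\liminf_{\varepsilon\to0}\ \lim_{n\to\infty}\ \big\|(e^{\varepsilon\Delta}\mathcal{L})^n\big\|^{1/n}>1 .$$
   Context: $\mathbb{T}^3=\mathbb{R}^3/\mathbb{Z}^3$; $e^{\varepsilon\Delta}$ is the heat semigroup at time $\varepsilon$ acting componentwise on vector fields; $DT$ is the (almost everywhere defined) Jacobian matrix of $T$. The norm $\|\cdot\|$ is the operator norm on $L^2(\mathbb{T}^3;\mathbb{C}^3)$, so that the inner limit is the spectral radius of $e^{\varepsilon\Delta}\mathcal{L}$. Such a $T$ is called a fast dynamo in the sense of maps. *)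

theory Defs
  imports "HOL-Analysis.Analysis"
begin

definition lattice_rel :: "real^3 \<Rightarrow> real^3 \<Rightarrow> bool" where
  "lattice_rel x y \<longleftrightarrow> (\<forall>i. x $ i - y $ i \<in> \<int>)"

lemma equivp_lattice_rel: "equivp lattice_rel"
proof (rule equivpI)
  show "reflp lattice_rel"
    by (simp add: reflp_def lattice_rel_def)
  show "symp lattice_rel"
    unfolding symp_def lattice_rel_def
    by (metis Ints_minus minus_diff_eq)
  show "transp lattice_rel"
    unfolding transp_def lattice_rel_def
    by (metis Ints_add diff_add_cancel add_diff_eq)
qed

quotient_type torus3 = "real^3" / lattice_rel
  morphisms rep_torus3 proj
  by (rule equivp_lattice_rel)

lemma proj_eq_iff: "proj x = proj y \<longleftrightarrow> (\<forall>i. x $ i - y $ i \<in> \<int>)"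
  using torus3.abs_eq_iff[of x y] by (simp add: lattice_rel_def)

lemma proj_surj: "\<exists>x. p = proj x"
  by (metis Quotient3_abs_rep Quotient3_torus3)

lift_definition torus_shift :: "real^3 \<Rightarrow> torus3 \<Rightarrow> torus3" is "\<lambda>v x. x + v"
  by (simp add: lattice_rel_def)

instantiation torus3 :: metric_space
begin

definition dist_torus3 :: "torus3 \<Rightarrow> torus3 \<Rightarrow> real" where
  "dist_torus3 p q = Inf {dist x y | x y. proj x = p \<and> proj y = q}"

definition uniformity_torus3 :: "(torus3 \<times> torus3) filter" where
  "uniformity_torus3 = (INF e\<in>{0 <..}. principal {(p, q). dist p q < e})"

definition open_torus3 :: "torus3 set \<Rightarrow> bool" where
  "open_torus3 U \<longleftrightarrow> (\<forall>p\<in>U. eventually (\<lambda>(p', q). p' = p \<longrightarrow> q \<in> U) uniformity)"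

lemma dist_torus3_le: "dist (proj x) (proj y) \<le> dist x y"
  unfolding dist_torus3_def
  by (rule cInf_lower) (auto intro!: bdd_belowI[of _ 0])

lemma dist_torus3_attained: "\<exists>y'. proj y' = proj y \<and> dist (proj x) (proj y) = dist x y'"
proof -
  define y' where "y' = (\<chi> i. y $ i + of_int (round (x $ i - y $ i)))"
  have p: "proj y' = proj y"
    by (simp add: proj_eq_iff y'_def)
  have min: "dist x y' \<le> dist u v" if u: "proj u = proj x" and v: "proj v = proj y" for u v
  proof -
    have "\<bar>(x - y') $ i\<bar> \<le> \<bar>(u - v) $ i\<bar>" for i
    proof -
      have "u $ i - x $ i \<in> \<int>" "v $ i - y $ i \<in> \<int>"
        using u v by (auto simp: proj_eq_iff)
      then obtain k l where k: "u $ i - x $ i = of_int k" and l: "v $ i - y $ i = of_int l"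
        by (auto elim!: Ints_cases)
      have "(x - y') $ i = (x $ i - y $ i) - of_int (round (x $ i - y $ i))"
        by (simp add: y'_def)
      moreover have "(u - v) $ i = (x $ i - y $ i) - of_int (l - k)"
        using k l by (simp add: algebra_simps)
      ultimately show ?thesis
        using round_diff_minimal[of "x $ i - y $ i" "l - k"] by simp
    qed
    then show ?thesis
      unfolding dist_norm by (intro norm_le_componentwise_cart) simp
  qed
  have "dist (proj x) (proj y) = dist x y'"
    unfolding dist_torus3_def
  proof (rule cInf_eq_minimum)
    show "dist x y' \<in> {dist u v |u v. proj u = proj x \<and> proj v = proj y}"
      using p by blast
  qed (use min in auto)
  with p show ?thesis by blast
qed

instance
proof
  show "uniformity = (INF e\<in>{0 <..}. principal {(p::torus3, q). dist p q < e})"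
    by (rule uniformity_torus3_def)
  show "open U \<longleftrightarrow> (\<forall>p\<in>U. eventually (\<lambda>(p', q). p' = p \<longrightarrow> q \<in> U) uniformity)"
    for U :: "torus3 set"
    by (rule open_torus3_def)
  fix p q r :: torus3
  obtain x y z where xyz: "p = proj x" "q = proj y" "r = proj z"
    using proj_surj by meson
  show "dist p q = 0 \<longleftrightarrow> p = q"
  proof
    assume "dist p q = 0"
    then show "p = q"
      using dist_torus3_attained[of y x] xyz by auto
  next
    assume "p = q"
    then show "dist p q = 0"
      using dist_torus3_attained[of x x] dist_torus3_le[of x x] xyz
      by (metis dist_self order_antisym zero_le_dist)
  qed
  obtain x' where x': "proj x' = proj x" "dist (proj z) (proj x) = dist z x'"
    using dist_torus3_attained[of x z] by blast
  obtain y' where y': "proj y' = proj y" "dist (proj z) (proj y) = dist z y'"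
    using dist_torus3_attained[of y z] by blast
  have comm: "dist a b = dist b a" for a b :: torus3
    unfolding dist_torus3_def by (rule arg_cong[of _ _ Inf]) (metis dist_commute)
  have "dist p q \<le> dist x' y'"
    using dist_torus3_le[of x' y'] x' y' xyz by simp
  also have "\<dots> \<le> dist z x' + dist z y'"
    by (metis dist_triangle2 dist_commute)
  finally show "dist p q \<le> dist p r + dist q r"
    using x' y' xyz comm by metis
qed

end

lemma continuous_on_proj: "continuous_on S proj"
  unfolding continuous_on_iff by (meson dist_torus3_le le_less_trans)

definition torus_measure :: "torus3 measure" where
  "torus_measure = distr (restrict_space lborel {x. \<forall>i. 0 \<le> x $ i \<and> x $ i < 1}) borel proj"

text \<open>
  Two lifts of \<open>T\<close> that are differentiable at lifts of the same point differ near it by a lattice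
  translation, so there is at most one such matrix. Where there is none, \<open>torus_jacobian\<close> is a
  meaningless constant; for a Lipschitz map this happens only on a null set.
\<close>

definition has_torus_jacobian :: "(torus3 \<Rightarrow> torus3) \<Rightarrow> real^3^3 \<Rightarrow> torus3 \<Rightarrow> bool" where
  "has_torus_jacobian T A p \<longleftrightarrow>
    (\<exists>F x. proj x = p \<and> (\<forall>z. proj (F z) = T (proj z)) \<and> (F has_derivative (\<lambda>h. A *v h)) (at x))"

definition torus_jacobian :: "(torus3 \<Rightarrow> torus3) \<Rightarrow> torus3 \<Rightarrow> real^3^3" where
  "torus_jacobian T p = (THE A. has_torus_jacobian T A p)"

definition push_forward :: "(torus3 \<Rightarrow> torus3) \<Rightarrow> (torus3 \<Rightarrow> complex^3) \<Rightarrow> (torus3 \<Rightarrow> complex^3)" where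
  "push_forward T B =
    (\<lambda>p. \<chi> i. \<Sum>j\<in>UNIV. of_real (torus_jacobian T p $ i $ j) * B p $ j) \<circ> inv T"

text \<open>
  The Gaussian kernel of \<open>exp (t \<Delta>)\<close> on Euclidean space. Integrating a function on the torus against
  it amounts to convolving with the periodised kernel, and multiplies the Fourier mode
  \<open>exp (2 \<pi> \<i> k \<bullet> x)\<close> by \<open>exp (- 4 \<pi>\<^sup>2 \<bar>k\<bar>\<^sup>2 t)\<close>.
\<close>

definition heat_kernel :: "real \<Rightarrow> real^3 \<Rightarrow> real" where
  "heat_kernel t y = (4 * pi * t) powr (- 3 / 2) * exp (- (norm y)\<^sup>2 / (4 * t))"

definition heat :: "real \<Rightarrow> (torus3 \<Rightarrow> complex^3) \<Rightarrow> (torus3 \<Rightarrow> complex^3)" where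
  "heat t B p = (LINT y|lborel. heat_kernel t y *\<^sub>R B (torus_shift (- y) p))"

text \<open>
  Square-integrable fields are functions rather than classes modulo null sets; \<open>l2_norm\<close> is then a
  seminorm, and the supremum below is the operator norm on the quotient for operators that respect
  equality almost everywhere. As a real supremum, it is meaningful for bounded operators only.
\<close>

definition l2_fields :: "(torus3 \<Rightarrow> complex^3) set" where
  "l2_fields = {B \<in> borel_measurable torus_measure. integrable torus_measure (\<lambda>p. (norm (B p))\<^sup>2)}"

definition l2_norm :: "(torus3 \<Rightarrow> complex^3) \<Rightarrow> real" where
  "l2_norm B = sqrt (LINT p|torus_measure. (norm (B p))\<^sup>2)"

definition l2_op_norm :: "((torus3 \<Rightarrow> complex^3) \<Rightarrow> (torus3 \<Rightarrow> complex^3)) \<Rightarrow> real" where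
  "l2_op_norm A = (SUP B\<in>{B \<in> l2_fields. l2_norm B \<le> 1}. l2_norm (A B))"

definition torus_measure_preserving :: "(torus3 \<Rightarrow> torus3) \<Rightarrow> bool" where
  "torus_measure_preserving T \<longleftrightarrow>
    T \<in> measurable torus_measure torus_measure \<and> distr torus_measure torus_measure T = torus_measure"

definition isotopic_to_id :: "(torus3 \<Rightarrow> torus3) \<Rightarrow> bool" where
  "isotopic_to_id T \<longleftrightarrow>
    homotopic_with (homeomorphic_map euclidean euclidean) euclidean euclidean id T"

end

(* The map is T = H o V with V (x, y, z) = (x, y + N tent x, z + rho x) and
   H (x, y, z) = (x + N tent y, y, z + rho y): two strong folding shears, each accompanied by a small
   shear in z. On fields exp (- 2 pi i z) b (x, y) the z-shears act as multiplication by phases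
   that correlate with the sign of the slope of tent, so that the stretched field does not cancel.

   The growth is seen on the dual side, where 1-forms exp (2 pi i z) (p dx + q dy) are pulled back.
   Integrals of such a form along segments that are close to horizontal are controlled relative to its
   integral Phi over a horizontal circle: they are Hoelder continuous of exponent 1/2 in the length of
   the segment and under displacement of the segment. A shear maps a segment to about N unit
   segments, the mean of the phases times signs is bounded away from 0, and the displacement shrinks by
   a factor N, so these bounds reproduce themselves while Phi grows by a factor comparable to N.
   They are invariant under translations and convex combinations, hence under heat flow, up to
   a loss that is small once the mode z is only slightly damped. This gives exponential growth of
   one matrix element of the powers of the operator, uniformly in small diffusivity. *)

theory Submission
  imports Defs "HOL-Probability.Distributions"
begin

section \<open>Line integrals of bounded measurable functions\<close>

text \<open>The Hoelder exponent 1/2 has to lie strictly between 0 and 1. Below 1: a short segment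
  of length l becomes one of length about N l and costs sqrt (N l), while \<open>Phi\<close> gains a
  factor of order N, so the length bound contracts. Above 0: a displacement \<delta> becomes at most
  about \<delta> / N along roughly N unit pieces, and the unmatched ends have length at most
  \<delta>; relative to the gain there remain factors 1 / sqrt N and 1 / N. They have to beat the
  absolute losses of a step, which come from cutting at the creases and from integrating by parts
  against the phase; hence the size of N. Pointwise bounds would not do: they can grow by the full
  factor N at each shear, whereas \<open>Phi\<close> is only known to gain N / 4. A separate
  obstacle is that square-integrable fields are Borel functions here, not classes, and that the
  Jacobian is given by a description operator. Its value has to be known on the creases as well, so
  the absence of a derivative there is proved and not merely discarded as a null set.\<close>

definition bmeas :: "(real \<Rightarrow> complex) \<Rightarrow> bool" where
  "bmeas f \<longleftrightarrow> f \<in> borel_measurable borel \<and> (\<exists>C. \<forall>x. norm (f x) \<le> C)"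

lemma bmeas_set_integrable:
  assumes "bmeas f"
  shows "set_integrable lborel {a..b} f"
proof -
  obtain C where C: "\<And>x. norm (f x) \<le> C" and m: "f \<in> borel_measurable borel"
    using assms by (auto simp: bmeas_def)
  show ?thesis
    unfolding set_integrable_def
    using C m by (intro integrableI_bounded_set_indicator[of _ _ _ C]) (auto simp: emeasure_lborel_Icc_eq)
qed

lemma bmeas_integrable_on:
  assumes "bmeas f"
  shows "f integrable_on {a..b}"
  using bmeas_set_integrable[OF assms] set_borel_integral_eq_integral(1) by blast

lemma bmeas_diff:
  assumes "bmeas f" "bmeas g" shows "bmeas (\<lambda>x. f x - g x)"
proof -
  obtain C D where "\<And>x. norm (f x) \<le> C" "\<And>x. norm (g x) \<le> D"
    using assms by (auto simp: bmeas_def)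
  then have "norm (f x - g x) \<le> C + D" for x
    by (meson add_mono norm_triangle_le_diff)
  then show ?thesis using assms unfolding bmeas_def by (auto intro!: exI[of _ "C + D"])
qed

lemma bmeas_mult:
  assumes "bmeas f" "bmeas g" shows "bmeas (\<lambda>x. f x * g x)"
proof -
  obtain C D where "\<And>x. norm (f x) \<le> C" "\<And>x. norm (g x) \<le> D"
    using assms by (auto simp: bmeas_def)
  then have "norm (f x * g x) \<le> C * D" for x
    by (simp add: norm_mult) (meson mult_mono' norm_ge_zero)
  then show ?thesis using assms unfolding bmeas_def by (auto intro!: exI[of _ "C * D"])
qed

lemma bmeas_const [simp]: "bmeas (\<lambda>x. k)"
  by (auto simp: bmeas_def)

lemma bmeas_affine:
  assumes "bmeas f" shows "bmeas (\<lambda>x. f (b + m * x))"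
proof -
  obtain C where C: "\<And>x. norm (f x) \<le> C" and [measurable]: "f \<in> borel_measurable borel"
    using assms by (auto simp: bmeas_def)
  have "(\<lambda>x. f (b + m * x)) \<in> borel_measurable borel"
    by measurable
  then show ?thesis unfolding bmeas_def using C by (intro conjI exI[of _ C]) auto
qed

lemma bmeas_mult_affine: "bmeas f \<Longrightarrow> bmeas (\<lambda>x. k * f (b + m * x))"
  by (rule bmeas_mult[OF bmeas_const bmeas_affine])

text \<open>Oriented integral: a branch of the fold with negative slope traverses its image segment
  backwards, and comparing two such images leaves end pieces whose order is not known in
  advance.\<close>

definition sint :: "(real \<Rightarrow> complex) \<Rightarrow> real \<Rightarrow> real \<Rightarrow> complex" where
  "sint f a b = (if a \<le> b then integral {a..b} f else - integral {b..a} f)"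

lemma sint_le: "a \<le> b \<Longrightarrow> sint f a b = integral {a..b} f"
  by (simp add: sint_def)

lemma sint_add:
  assumes "bmeas f"
  shows "sint f a b + sint f b c = sint f a c"
proof -
  have *: "integral {x..y} f + integral {y..z} f = integral {x..z} f" if "x \<le> y" "y \<le> z" for x y z
    using that bmeas_integrable_on[OF assms] Henstock_Kurzweil_Integration.integral_combine by blast
  consider "a \<le> b" "b \<le> c" | "a \<le> c" "c < b" | "b < a" "a \<le> c" | "b \<le> c" "c < a" | "c < a" "a \<le> b" | "c < b" "b < a"
    by linarith
  then show ?thesis
    by cases (simp_all add: sint_def *[of a b c, symmetric] *[of a c b, symmetric] *[of b a c, symmetric]
      *[of b c a, symmetric] *[of c a b, symmetric] *[of c b a, symmetric])
qed

text \<open>Both signs of m occur, one for each branch of the fold. With an oriented integral on the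
  right no absolute value of m appears, so the sign of the branch survives; it is what
  \<open>gain\<close> later weighs against the phase.\<close>

lemma integral_affine:
  fixes f :: "real \<Rightarrow> complex"
  assumes f: "bmeas f" and ab: "\<alpha> \<le> \<beta>" and m: "m \<noteq> 0"
  shows "integral {\<alpha>..\<beta>} (\<lambda>s. of_real m * f (b + m * s)) = sint f (b + m * \<alpha>) (b + m * \<beta>)"
proof (cases "m > 0")
  case True
  have "(f has_integral integral {b + m * \<alpha>..b + m * \<beta>} f) {b + m * \<alpha>..b + m * \<beta>}"
    using bmeas_integrable_on[OF f] by blast
  from has_integral_affinity[OF this[unfolded box_real(2)[symmetric]] m, of b]
  have "((\<lambda>x. f (m * x + b)) has_integral (1 / \<bar>m\<bar>) *\<^sub>R integral {b + m * \<alpha>..b + m * \<beta>} f)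
     ((\<lambda>x. (1 / m) *\<^sub>R x + - ((1 / m) *\<^sub>R b)) ` {b + m * \<alpha>..b + m * \<beta>})"
    by simp
  moreover have "(\<lambda>x. (1 / m) *\<^sub>R x + - ((1 / m) *\<^sub>R b)) ` {b + m * \<alpha>..b + m * \<beta>} = {\<alpha>..\<beta>}"
    using True ab image_affinity_atLeastAtMost[of "1/m" "- ((1/m) * b)" "b + m * \<alpha>" "b + m * \<beta>"]
    by (auto simp: field_simps)
  ultimately have "((\<lambda>x. f (b + m * x)) has_integral (1 / m) *\<^sub>R integral {b + m * \<alpha>..b + m * \<beta>} f) {\<alpha>..\<beta>}"
    using True by (simp add: add.commute)
  from has_integral_mult_right[OF this, of "of_real m"]
  show ?thesis using True ab by (subst integral_unique) (auto simp: sint_def scaleR_conv_of_real)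
next
  case False
  then have mn: "m < 0" using m by simp
  have le: "b + m * \<beta> \<le> b + m * \<alpha>" using mn ab by simp
  have "(f has_integral integral {b + m * \<beta>..b + m * \<alpha>} f) {b + m * \<beta>..b + m * \<alpha>}"
    using bmeas_integrable_on[OF f] by blast
  from has_integral_affinity[OF this[unfolded box_real(2)[symmetric]] m, of b]
  have "((\<lambda>x. f (m * x + b)) has_integral (1 / \<bar>m\<bar>) *\<^sub>R integral {b + m * \<beta>..b + m * \<alpha>} f)
     ((\<lambda>x. (1 / m) *\<^sub>R x + - ((1 / m) *\<^sub>R b)) ` {b + m * \<beta>..b + m * \<alpha>})"
    by simp
  moreover have "(\<lambda>x. (1 / m) *\<^sub>R x + - ((1 / m) *\<^sub>R b)) ` {b + m * \<beta>..b + m * \<alpha>} = {\<alpha>..\<beta>}"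
    using mn ab le image_affinity_atLeastAtMost[of "1/m" "- ((1/m) * b)" "b + m * \<beta>" "b + m * \<alpha>"]
    by (auto simp: field_simps)
  ultimately have "((\<lambda>x. f (b + m * x)) has_integral (1 / \<bar>m\<bar>) *\<^sub>R integral {b + m * \<beta>..b + m * \<alpha>} f) {\<alpha>..\<beta>}"
    by (simp add: add.commute)
  from has_integral_mult_right[OF this, of "of_real m"]
  have "integral {\<alpha>..\<beta>} (\<lambda>s. of_real m * f (b + m * s)) = - integral {b + m * \<beta>..b + m * \<alpha>} f"
    using mn by (subst integral_unique) (auto simp: scaleR_conv_of_real)
  also have "\<dots> = sint f (b + m * \<alpha>) (b + m * \<beta>)"
    using le by (auto simp: sint_def)
  finally show ?thesis .
qed

text \<open>Integration by parts for a merely measurable f, whose primitive need not be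
  differentiable everywhere: G \<beta> - G s is written as the integral of G' over {s..\<beta>} and
  the order of integration over the triangle s \<le> r is exchanged. Only running integrals of f
  enter, so cancellation in f is kept; G is going to be \<open>phase\<close>.\<close>

lemma integral_by_parts_bound:
  fixes f G G' :: "real \<Rightarrow> complex"
  assumes f: "bmeas f" and ab: "\<alpha> \<le> \<beta>"
    and G: "\<And>x. (G has_vector_derivative G' x) (at x)" and G': "continuous_on UNIV G'"
    and L: "\<And>x. norm (G' x) \<le> L" and one: "\<And>x. norm (G x) \<le> 1"
    and M: "\<And>r. \<alpha> \<le> r \<Longrightarrow> r \<le> \<beta> \<Longrightarrow> norm (integral {\<alpha>..r} f) \<le> M"
  shows "norm (integral {\<alpha>..\<beta>} (\<lambda>s. G s * f s)) \<le> M * (1 + L * (\<beta> - \<alpha>))"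
proof -
  obtain C where C: "\<And>x. norm (f x) \<le> C" and fm: "f \<in> borel_measurable borel"
    using f by (auto simp: bmeas_def)
  have G'm: "G' \<in> borel_measurable borel"
    using G' by (rule borel_measurable_continuous_onI)
  have bG': "bmeas G'" using G'm L by (auto simp: bmeas_def)
  have Gc: "continuous_on UNIV G"
    using G by (auto simp: continuous_on_eq_continuous_at intro: has_vector_derivative_continuous)
  have bG: "bmeas G"
    using borel_measurable_continuous_onI[OF Gc] one by (auto simp: bmeas_def)
  have L0: "0 \<le> L" using L[of 0] norm_ge_zero order_trans by blast
  have C0: "0 \<le> C" using C[of 0] norm_ge_zero order_trans by blast
  define K where "K = (\<lambda>(s,r). indicat_real {\<alpha>..\<beta>} s *\<^sub>R (indicat_real {\<alpha>..\<beta>} r *\<^sub>R (of_bool (s \<le> r) * (G' r * f s))))"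
  have Kint: "integrable (lborel \<Otimes>\<^sub>M lborel) K"
  proof -
    have "integrable (lborel \<Otimes>\<^sub>M lborel) (\<lambda>z. indicator ({\<alpha>..\<beta>} \<times> {\<alpha>..\<beta>}) z *\<^sub>R (of_bool (fst z \<le> snd z) * (G' (snd z) * f (fst z))))"
    proof (rule integrableI_bounded_set_indicator[of _ _ _ "L * C"])
      show "(\<lambda>z. of_bool (fst z \<le> snd z) * (G' (snd z) * f (fst z))) \<in> borel_measurable (lborel \<Otimes>\<^sub>M lborel)"
        using fm G'm unfolding of_bool_def by measurable
      have "emeasure (lborel \<Otimes>\<^sub>M lborel) ({\<alpha>..\<beta>} \<times> {\<alpha>..\<beta>}) = emeasure lborel {\<alpha>..\<beta>} * emeasure lborel {\<alpha>..\<beta>}"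
        by (rule lborel.emeasure_pair_measure_Times) auto
      then show "emeasure (lborel \<Otimes>\<^sub>M lborel) ({\<alpha>..\<beta>} \<times> {\<alpha>..\<beta>}) < \<infinity>"
        by (simp add: emeasure_lborel_Icc_eq ennreal_mult_less_top)
      show "AE z \<in> {\<alpha>..\<beta>} \<times> {\<alpha>..\<beta>} in lborel \<Otimes>\<^sub>M lborel. norm (of_bool (fst z \<le> snd z) * (G' (snd z) * f (fst z))) \<le> L * C"
        using L C L0 C0 by (auto simp: norm_mult intro!: AE_I2 mult_mono)
    qed auto
    moreover have "(\<lambda>z. indicator ({\<alpha>..\<beta>} \<times> {\<alpha>..\<beta>}) z *\<^sub>R (of_bool (fst z \<le> snd z) * (G' (snd z) * f (fst z)))) = K"
      by (auto simp: K_def indicator_def fun_eq_iff)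
    ultimately show ?thesis by simp
  qed
  have fub: "(\<integral>s. (\<integral>r. K (s, r) \<partial>lborel) \<partial>lborel) = (\<integral>r. (\<integral>s. K (s, r) \<partial>lborel) \<partial>lborel)"
    using lborel_pair.Fubini_integral[of "\<lambda>s r. K (s, r)"] Kint by simp
  have FTC: "integral {s..\<beta>} G' = G \<beta> - G s" if "s \<le> \<beta>" for s
    using fundamental_theorem_of_calculus[OF that, of G G'] G
    by (meson has_vector_derivative_at_within integral_unique)
  have set_eq: "(\<integral>x. indicat_real {a..b} x *\<^sub>R h x \<partial>lborel) = integral {a..b} h" if "bmeas h" for h a b
    using set_borel_integral_eq_integral(2)[OF bmeas_set_integrable[OF that]]
    by (simp add: set_lebesgue_integral_def)
  have in1: "(\<integral>r. K (s, r) \<partial>lborel) = indicat_real {\<alpha>..\<beta>} s *\<^sub>R ((G \<beta> - G s) * f s)" for s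
  proof (cases "s \<in> {\<alpha>..\<beta>}")
    case True
    have "(\<integral>r. K (s, r) \<partial>lborel) = (\<integral>r. indicat_real {s..\<beta>} r *\<^sub>R (G' r * f s) \<partial>lborel)"
      by (rule Bochner_Integration.integral_cong) (use True in \<open>auto simp: K_def indicator_def\<close>)
    also have "\<dots> = integral {s..\<beta>} (\<lambda>r. G' r * f s)"
      by (rule set_eq) (intro bmeas_mult bG' bmeas_const)
    also have "\<dots> = (G \<beta> - G s) * f s"
      using FTC[of s] True bmeas_integrable_on[OF bG'] by simp
    finally show ?thesis using True by simp
  qed (simp add: K_def)
  have in2: "(\<integral>s. K (s, r) \<partial>lborel) = indicat_real {\<alpha>..\<beta>} r *\<^sub>R (G' r * integral {\<alpha>..r} f)" for r
  proof (cases "r \<in> {\<alpha>..\<beta>}")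
    case True
    have "(\<integral>s. K (s, r) \<partial>lborel) = (\<integral>s. indicat_real {\<alpha>..r} s *\<^sub>R (G' r * f s) \<partial>lborel)"
      by (rule Bochner_Integration.integral_cong) (use True in \<open>auto simp: K_def indicator_def\<close>)
    also have "\<dots> = integral {\<alpha>..r} (\<lambda>s. G' r * f s)"
      by (rule set_eq) (intro bmeas_mult f bmeas_const)
    finally show ?thesis using True bmeas_integrable_on[OF f] by simp
  qed (simp add: K_def)
  have i1: "(\<integral>s. (\<integral>r. K (s, r) \<partial>lborel) \<partial>lborel) = integral {\<alpha>..\<beta>} (\<lambda>s. (G \<beta> - G s) * f s)"
    unfolding in1 by (rule set_eq) (intro bmeas_mult bmeas_diff bG f bmeas_const)
  have "integrable lborel (\<lambda>r. \<integral>s. K (s, r) \<partial>lborel)"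
    using lborel_pair.integrable_snd[of "\<lambda>s r. K (s, r)"] Kint by simp
  then have si: "set_integrable lborel {\<alpha>..\<beta>} (\<lambda>r. G' r * integral {\<alpha>..r} f)"
    unfolding in2 set_integrable_def .
  have i2: "(\<integral>r. (\<integral>s. K (s, r) \<partial>lborel) \<partial>lborel) = integral {\<alpha>..\<beta>} (\<lambda>r. G' r * integral {\<alpha>..r} f)"
    unfolding in2 using set_borel_integral_eq_integral(2)[OF si] by (simp add: set_lebesgue_integral_def)
  have "integral {\<alpha>..\<beta>} (\<lambda>s. (G \<beta> - G s) * f s) = G \<beta> * integral {\<alpha>..\<beta>} f - integral {\<alpha>..\<beta>} (\<lambda>s. G s * f s)"
    using bmeas_integrable_on[OF f] bmeas_integrable_on[OF bmeas_mult[OF bG f]]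
    by (simp add: left_diff_distrib Henstock_Kurzweil_Integration.integral_diff integrable_on_mult_right)
  \<comment> \<open>There is no boundary term at \<alpha> because the primitive of f starts
    there.\<close>
  then have eq: "integral {\<alpha>..\<beta>} (\<lambda>s. G s * f s) = G \<beta> * integral {\<alpha>..\<beta>} f - integral {\<alpha>..\<beta>} (\<lambda>r. G' r * integral {\<alpha>..r} f)"
    using fub i1 i2 by (simp add: algebra_simps)
  have M0: "0 \<le> M" using M[of \<alpha>] ab by simp
  have "norm (integral {\<alpha>..\<beta>} (\<lambda>r. G' r * integral {\<alpha>..r} f)) \<le> (L * M) * (\<beta> - \<alpha>)"
  proof -
    have "norm (integral {\<alpha>..\<beta>} (\<lambda>r. G' r * integral {\<alpha>..r} f)) \<le> integral {\<alpha>..\<beta>} (\<lambda>r. L * M)"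
    proof (rule integral_norm_bound_integral)
      show "(\<lambda>r. G' r * integral {\<alpha>..r} f) integrable_on {\<alpha>..\<beta>}"
        using set_borel_integral_eq_integral(1)[OF si] .
      show "norm (G' r * integral {\<alpha>..r} f) \<le> L * M" if "r \<in> {\<alpha>..\<beta>}" for r
        using that L M L0 by (auto simp: norm_mult intro!: mult_mono)
    qed auto
    then show ?thesis using ab by (simp add: algebra_simps)
  qed
  moreover have "norm (G \<beta> * integral {\<alpha>..\<beta>} f) \<le> 1 * M"
    unfolding norm_mult using one M[of \<beta>] ab by (intro mult_mono) auto
  moreover have "norm (integral {\<alpha>..\<beta>} (\<lambda>s. G s * f s)) \<le> norm (G \<beta> * integral {\<alpha>..\<beta>} f)
      + norm (integral {\<alpha>..\<beta>} (\<lambda>r. G' r * integral {\<alpha>..r} f))"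
    unfolding eq by (rule norm_triangle_ineq4)
  moreover have "M * (1 + L * (\<beta> - \<alpha>)) = 1 * M + (L * M) * (\<beta> - \<alpha>)"
    by (simp add: algebra_simps)
  ultimately show ?thesis by linarith
qed

section \<open>Folding shear and line integrals of planar forms\<close>

definition tent :: "real \<Rightarrow> real" where
  "tent x = min (frac x) (1 - frac x)"

text \<open>The derivative of \<open>tent\<close> away from the creases. At a crease it is the
  right-hand derivative, so that it is constant on half-open cells.\<close>

definition slope :: "real \<Rightarrow> real" where
  "slope x = (if frac x < 1 / 2 then 1 else - 1)"

text \<open>The factor N of the shears. The binding condition on it is the displacement estimate in
  \<open>good_step\<close>, roughly 27 * (sqrt N / 100 + 1800) \<le> N / 4000; an even power of ten
  also makes sqrt N easy to bound.\<close>

definition stretch :: real where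
  "stretch = 10 ^ 10"

text \<open>This is exp (2 \<pi> \<i> r) for the displacement r = \<open>rho x\<close> in z, with
  \<open>rho\<close> defined later. The point of the formula is that its imaginary part sin (\<pi> /
  2 * sin (2 \<pi> x)) nowhere has the sign opposite to \<open>slope x\<close>.\<close>

definition phase :: "real \<Rightarrow> complex" where
  "phase x = cis (pi / 2 * sin (2 * pi * x))"

lemma frac_unique: "of_int j \<le> x \<Longrightarrow> x < of_int j + 1 \<Longrightarrow> frac x = x - of_int j" for x :: real
  by (metis add_diff_cancel_left' diff_add_cancel floor_unique frac_def)

text \<open>On an interval between consecutive creases the fold is affine. Continuity extends the
  value to the closed cell, but the slope is \<eta> only on the half-open one; the right end is
  later discarded as a null set.\<close>

lemma tent_cell:
  fixes k :: int
  obtains \<eta> b where "\<eta> = 1 \<or> \<eta> = - 1"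
    "\<And>s. k / 2 \<le> s \<Longrightarrow> s \<le> (k + 1) / 2 \<Longrightarrow> tent s = \<eta> * s + b"
    "\<And>s. k / 2 \<le> s \<Longrightarrow> s < (k + 1) / 2 \<Longrightarrow> slope s = \<eta>"
proof (cases "even k")
  case True
  then obtain j where j: "k = 2 * j" by blast
  have fr: "frac s = s - j" if "k / 2 \<le> s" "s \<le> (k + 1) / 2" for s :: real
    using that j by (intro frac_unique) (auto simp: field_simps)
  show ?thesis
  proof (rule that[of 1 "- of_int j"])
    fix s :: real
    show "tent s = 1 * s + - of_int j" if "k / 2 \<le> s" "s \<le> (k + 1) / 2"
      using fr[OF that] that j by (auto simp: tent_def)
    show "slope s = 1" if "k / 2 \<le> s" "s < (k + 1) / 2"
      using fr[of s] that j by (auto simp: slope_def)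
  qed simp
next
  case False
  then obtain j where j: "k = 2 * j + 1" by (metis oddE)
  have fr: "frac s = s - j" if "k / 2 \<le> s" "s < (k + 1) / 2" for s :: real
    using that j by (intro frac_unique) (auto simp: field_simps)
  have t: "tent s = - 1 * s + (j + 1)" if "k / 2 \<le> s" "s \<le> (k + 1) / 2" for s :: real
  proof (cases "s = (k + 1) / 2")
    case True
    \<comment> \<open>At this end the floor has already jumped and \<open>frac\<close> is 0, so the
      affine formula needs a check of its own.\<close>
    then have "s = of_int (j + 1)" using j by simp
    then show ?thesis unfolding tent_def by (simp only: frac_of_int) simp
  next
    case False
    then show ?thesis using fr[of s] that j by (auto simp: tent_def min_def field_simps)
  qed
  show ?thesis
  proof (rule that[of "-1" "of_int (j + 1)"])
    fix s :: real
    show "tent s = - 1 * s + of_int (j + 1)" if "k / 2 \<le> s" "s \<le> (k + 1) / 2"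
      using t[OF that] by simp
    show "slope s = - 1" if "k / 2 \<le> s" "s < (k + 1) / 2"
      using fr[OF that] that j by (auto simp: slope_def)
  qed simp
qed

lemma frac_add_1 [simp]: "frac (x + 1) = frac x" for x :: real
  using frac_add_of_int_right[of x 1] by simp

lemma tent_periodic [simp]: "tent (x + 1) = tent x"
  by (simp add: tent_def)

lemma slope_periodic [simp]: "slope (x + 1) = slope x"
  by (simp add: slope_def)

lemma tent_bound: "0 \<le> tent x" "tent x \<le> 1 / 2"
  using frac_lt_1[of x] frac_ge_0[of x] by (auto simp: tent_def min_def)

lemma phase_periodic [simp]: "phase (x + 1) = phase x"
  by (simp add: phase_def distrib_left)

lemma norm_phase [simp]: "norm (phase x) = 1"
  by (simp add: phase_def)

lemma borel_frac [measurable]: "(frac :: real \<Rightarrow> real) \<in> borel_measurable borel"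
  unfolding frac_def by measurable

lemma borel_tent [measurable]: "tent \<in> borel_measurable borel"
  unfolding tent_def by measurable

lemma borel_slope [measurable]: "slope \<in> borel_measurable borel"
  unfolding slope_def by measurable

lemma continuous_phase: "continuous_on S phase"
  unfolding phase_def by (intro continuous_intros)

lemma borel_phase [measurable]: "phase \<in> borel_measurable borel"
  using continuous_phase by (rule borel_measurable_continuous_onI)

section \<open>Derivative of the phase\<close>

definition phase' :: "real \<Rightarrow> complex" where
  "phase' x = of_real (pi\<^sup>2 * cos (2 * pi * x)) * \<i> * phase x"

lemma phase_deriv: "(phase has_vector_derivative phase' x) (at x)"
proof -
  have d: "((\<lambda>x. pi / 2 * sin (2 * pi * x)) has_real_derivative pi\<^sup>2 * cos (2 * pi * x)) (at x)"
    by (auto intro!: derivative_eq_intros simp: power2_eq_square)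
  have "(cis has_vector_derivative \<i> * cis (pi / 2 * sin (2 * pi * x))) (at (pi / 2 * sin (2 * pi * x)))"
    by (auto simp: has_vector_derivative_def scaleR_conv_of_real cis_conv_exp fun_eq_iff
        intro!: derivative_eq_intros ext)
  from vector_diff_chain_at[OF d[THEN has_real_derivative_iff_has_vector_derivative[THEN iffD1]] this]
  show ?thesis
    by (simp add: o_def phase_def[abs_def] phase'_def scaleR_conv_of_real mult.assoc)
qed

text \<open>The 16 comes from \<pi> < 4. On a cell of length 1/2 it makes the loss in integration by
  parts 1 + 16 / 2 = 9, the factor that recurs in all estimates on cells.\<close>

lemma norm_phase': "norm (phase' x) \<le> 16"
proof -
  have "norm (phase' x) = pi\<^sup>2 * \<bar>cos (2 * pi * x)\<bar>"
    by (simp add: phase'_def norm_mult abs_mult del: of_real_mult)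
  also have "\<dots> \<le> 4\<^sup>2 * 1"
    using pi_less_4 pi_gt_zero by (intro mult_mono power_mono) auto
  finally show ?thesis by simp
qed

lemma continuous_phase': "continuous_on S phase'"
  unfolding phase'_def by (intro continuous_intros continuous_phase)

text \<open>Coefficients live on the 2-torus but are kept as doubly periodic functions on the plane,
  so that segments of any position and length are parametrised without wrapping around.\<close>

definition planar :: "(real \<Rightarrow> real \<Rightarrow> complex) \<Rightarrow> bool" where
  "planar p \<longleftrightarrow> (\<lambda>z. p (fst z) (snd z)) \<in> borel_measurable borel \<and> (\<exists>C. \<forall>x y. norm (p x y) \<le> C)
     \<and> (\<forall>x y. p (x + 1) y = p x y) \<and> (\<forall>x y. p x (y + 1) = p x y)"

text \<open>The integrand of \<open>p dx + q dy\<close> along \<open>s \<mapsto> (s, a + e s)\<close>.\<close>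

definition line :: "(real \<Rightarrow> real \<Rightarrow> complex) \<Rightarrow> (real \<Rightarrow> real \<Rightarrow> complex) \<Rightarrow> real \<Rightarrow> real \<Rightarrow> real \<Rightarrow> complex" where
  "line p q a e s = p s (a + e * s) + of_real e * q s (a + e * s)"

definition Phi :: "(real \<Rightarrow> real \<Rightarrow> complex) \<Rightarrow> complex" where
  "Phi p = integral {0..1} (\<lambda>s. p s 0)"

lemma planar_compose:
  assumes "planar p" and [measurable]: "f \<in> borel_measurable M" "g \<in> borel_measurable M"
  shows "(\<lambda>x. p (f x) (g x)) \<in> borel_measurable M"
proof -
  have [measurable]: "(\<lambda>z. p (fst z) (snd z)) \<in> borel_measurable (borel \<Otimes>\<^sub>M borel)"
    using assms(1) by (simp add: planar_def borel_prod)
  have "(\<lambda>x. (\<lambda>z. p (fst z) (snd z)) (f x, g x)) \<in> borel_measurable M"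
    by measurable
  then show ?thesis by simp
qed

lemma bmeas_planar:
  assumes "planar p" "f \<in> borel_measurable borel" "g \<in> borel_measurable borel"
  shows "bmeas (\<lambda>x. p (f x) (g x))"
  using planar_compose[OF assms] assms(1) by (auto simp: bmeas_def planar_def)

lemma bmeas_add:
  assumes "bmeas f" "bmeas g" shows "bmeas (\<lambda>x. f x + g x)"
  using bmeas_diff[OF assms(1) bmeas_mult[OF bmeas_const[of "-1"] assms(2)]] by simp

lemma bmeas_line:
  assumes "planar p" "planar q"
  shows "bmeas (line p q a e)"
proof -
  have "bmeas (\<lambda>s. p s (a + e * s) + of_real e * q s (a + e * s))"
    by (intro bmeas_add bmeas_mult bmeas_const bmeas_planar assms) auto
  then show ?thesis by (simp add: line_def[abs_def])
qed

text \<open>In the last clause two segments over the same interval are compared through the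
  distances of their ends, which control the distance in between. The case \<delta> = 1 matters as
  much as small \<delta>: it relates an arbitrary unit segment to a horizontal circle. All bounds
  are relative to \<open>Phi p\<close>, so multiples of a form share the constants A and D.\<close>

definition good :: "(real \<Rightarrow> real \<Rightarrow> complex) \<Rightarrow> (real \<Rightarrow> real \<Rightarrow> complex) \<Rightarrow> real \<Rightarrow> real \<Rightarrow> bool" where
  "good p q A D \<longleftrightarrow> planar p \<and> planar q \<and> Phi p \<noteq> 0 \<and>
    (\<forall>a e \<alpha> \<beta>. \<bar>e\<bar> \<le> 1 \<longrightarrow> \<alpha> \<le> \<beta> \<longrightarrow> \<beta> \<le> \<alpha> + 1 \<longrightarrow>
      norm (integral {\<alpha>..\<beta>} (line p q a e)) \<le> A * sqrt (\<beta> - \<alpha>) * norm (Phi p)) \<and>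
    (\<forall>a1 e1 a2 e2 \<alpha> \<beta> \<delta>. \<bar>e1\<bar> \<le> 1 \<longrightarrow> \<bar>e2\<bar> \<le> 1 \<longrightarrow> \<alpha> \<le> \<beta> \<longrightarrow> \<beta> \<le> \<alpha> + 1 \<longrightarrow> 0 \<le> \<delta> \<longrightarrow> \<delta> \<le> 1 \<longrightarrow>
      \<bar>(a1 + e1 * \<alpha>) - (a2 + e2 * \<alpha>)\<bar> \<le> \<delta> \<longrightarrow> \<bar>(a1 + e1 * \<beta>) - (a2 + e2 * \<beta>)\<bar> \<le> \<delta> \<longrightarrow>
      norm (integral {\<alpha>..\<beta>} (line p q a1 e1) - integral {\<alpha>..\<beta>} (line p q a2 e2))
        \<le> D * sqrt \<delta> * norm (Phi p))"

lemma good_planar: "good p q A D \<Longrightarrow> planar p" "good p q A D \<Longrightarrow> planar q" "good p q A D \<Longrightarrow> Phi p \<noteq> 0"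
  by (auto simp: good_def)

lemma good_line:
  assumes "good p q A D" "\<bar>e\<bar> \<le> 1" "\<alpha> \<le> \<beta>" "\<beta> \<le> \<alpha> + 1"
  shows "norm (integral {\<alpha>..\<beta>} (line p q a e)) \<le> A * sqrt (\<beta> - \<alpha>) * norm (Phi p)"
  using assms(1)[unfolded good_def] assms(2-) by blast

lemma good_lines:
  assumes "good p q A D" "\<bar>e1\<bar> \<le> 1" "\<bar>e2\<bar> \<le> 1" "\<alpha> \<le> \<beta>" "\<beta> \<le> \<alpha> + 1" "0 \<le> \<delta>" "\<delta> \<le> 1"
    "\<bar>(a1 + e1 * \<alpha>) - (a2 + e2 * \<alpha>)\<bar> \<le> \<delta>" "\<bar>(a1 + e1 * \<beta>) - (a2 + e2 * \<beta>)\<bar> \<le> \<delta>"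
  shows "norm (integral {\<alpha>..\<beta>} (line p q a1 e1) - integral {\<alpha>..\<beta>} (line p q a2 e2))
        \<le> D * sqrt \<delta> * norm (Phi p)"
  using assms(1)[unfolded good_def] assms(2-) by blast

section \<open>Consequences for segments of arbitrary length\<close>

lemma periodic_int:
  assumes "\<And>x. f (x + 1) = (f x :: 'a)" shows "f (x + of_int k) = f (x :: real)"
proof (induction k rule: int_induct[where k = 0])
  case (step1 i)
  have "f (x + of_int (i + 1)) = f ((x + of_int i) + 1)" by (simp add: add.assoc)
  then show ?case using assms step1 by metis
next
  case (step2 i)
  have "f (x + of_int (i - 1)) = f ((x + of_int (i - 1)) + 1)" using assms by metis
  then show ?case using step2 by (simp add: add.assoc)
qed simp

lemma integral_period:
  assumes f: "bmeas f" and per: "\<And>x. f (x + 1) = f x"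
  shows "integral {u..u + 1} f = integral {0..1} f"
proof -
  have shift: "integral {a..b} f = sint f (a + of_int k) (b + of_int k)" if "a \<le> b" for a b and k :: int
    using integral_affine[OF f that, of 1 "of_int k"] periodic_int[of f, OF per]
    by (simp add: add.commute)
  define \<theta> where "\<theta> = frac u"
  have th: "0 \<le> \<theta>" "\<theta> \<le> 1" using frac_lt_1[of u] by (auto simp: \<theta>_def less_imp_le)
  have "integral {u..u + 1} f = sint f (u + of_int (- \<lfloor>u\<rfloor>)) (u + 1 + of_int (- \<lfloor>u\<rfloor>))"
    by (rule shift) simp
  also have "\<dots> = sint f \<theta> (\<theta> + 1)"
    by (simp add: \<theta>_def frac_def algebra_simps)
  also have "\<dots> = sint f \<theta> 1 + sint f 1 (\<theta> + 1)"
    using sint_add[OF f] by simp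
  also have "sint f 1 (\<theta> + 1) = sint f 0 \<theta>"
    using shift[of 0 \<theta> 1] th by (simp add: sint_le add.commute)
  also have "sint f \<theta> 1 + sint f 0 \<theta> = sint f 0 1"
    using sint_add[OF f] by (metis add.commute)
  finally show ?thesis by (simp add: sint_le)
qed

lemma Phi_flat:
  assumes "planar p" shows "integral {u..u + 1} (line p q (of_int n) 0) = Phi p"
proof -
  have "line p q (of_int n) 0 = (\<lambda>s. p s 0)"
    using periodic_int[of "p s" 0 n for s] assms by (auto simp: line_def planar_def fun_eq_iff)
  then show ?thesis
    unfolding Phi_def using assms
    by (simp, intro integral_period bmeas_planar) (auto simp: planar_def)
qed

text \<open>A displacement of at most 1 moves the segment to a horizontal line of integer height,
  where periodicity makes the integral exactly \<open>Phi p\<close>.\<close>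

lemma good_unit:
  assumes g: "good p q A D" and e: "\<bar>e\<bar> \<le> 1"
  shows "norm (integral {u..u + 1} (line p q a e) - Phi p) \<le> D * norm (Phi p)"
proof -
  \<comment> \<open>Rounding the height at the midpoint keeps both ends within 1: rounding costs 1/2
    and the slope, over half a unit, another 1/2.\<close>
  define n where "n = round (a + e * (u + 1 / 2))"
  have n: "\<bar>of_int n - (a + e * (u + 1 / 2))\<bar> \<le> 1 / 2"
    unfolding n_def by (rule of_int_round_abs_le)
  have "\<bar>(a + e * u) - (of_int n + 0 * u)\<bar> \<le> 1" "\<bar>(a + e * (u + 1)) - (of_int n + 0 * (u + 1))\<bar> \<le> 1"
    using n e unfolding distrib_left by linarith+
  then have "norm (integral {u..u + 1} (line p q a e) - integral {u..u + 1} (line p q (of_int n) 0))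
        \<le> D * sqrt 1 * norm (Phi p)"
    using g e by (intro good_lines) auto
  then show ?thesis using Phi_flat[OF good_planar(1)[OF g], of u q n] by simp
qed

text \<open>Unit segments are split off one at a time, each contributing \<open>Phi p\<close> up to
  a relative error D. The remainder, shorter than 1, is paid for by A for its own integral and by 1
  for its share of \<open>Phi p\<close>.\<close>

lemma good_long:
  assumes g: "good p q A D" and e: "\<bar>e\<bar> \<le> 1" and AD: "0 \<le> A" "0 \<le> D" and ab: "\<alpha> \<le> \<beta>"
  shows "norm (integral {\<alpha>..\<beta>} (line p q a e) - of_real (\<beta> - \<alpha>) * Phi p)
    \<le> ((\<beta> - \<alpha>) * D + A + 1) * norm (Phi p)"
proof -
  have bl: "bmeas (line p q a e)" using g by (intro bmeas_line) (auto simp: good_def)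
  define F where "F = norm (Phi p)"
  have F0: "0 \<le> F" by (simp add: F_def)
  have "norm (integral {\<alpha>..\<beta>} (line p q a e) - of_real (\<beta> - \<alpha>) * Phi p) \<le> ((\<beta> - \<alpha>) * D + A + 1) * F"
    if "\<alpha> \<le> \<beta>" "\<beta> - \<alpha> \<le> real n" for n \<alpha>
    using that
  proof (induction n arbitrary: \<alpha>)
    case 0
    then have "\<alpha> = \<beta>" by simp
    then show ?case using AD F0 by simp
  next
    case (Suc n)
    show ?case
    proof (cases "\<beta> \<le> \<alpha> + 1")
      case True
      have sq: "sqrt (\<beta> - \<alpha>) \<le> 1" using True Suc by simp
      have "norm (integral {\<alpha>..\<beta>} (line p q a e)) \<le> A * sqrt (\<beta> - \<alpha>) * F"
        unfolding F_def using True Suc.prems by (intro good_line[OF g e])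
      also have "\<dots> \<le> A * 1 * F"
        using sq AD F0 by (intro mult_right_mono mult_left_mono) auto
      finally have 1: "norm (integral {\<alpha>..\<beta>} (line p q a e)) \<le> A * F" by simp
      have 2: "norm (of_real (\<beta> - \<alpha>) * Phi p) \<le> 1 * F"
        unfolding norm_mult F_def norm_of_real using True Suc.prems(1) by (intro mult_right_mono) auto
      have 3: "0 \<le> (\<beta> - \<alpha>) * D * F" using AD F0 Suc.prems(1) by (intro mult_nonneg_nonneg) linarith+
      have "norm (integral {\<alpha>..\<beta>} (line p q a e) - of_real (\<beta> - \<alpha>) * Phi p) \<le> A * F + 1 * F"
        using 1 2 by (rule norm_triangle_le_diff[OF add_mono])
      also have "\<dots> \<le> ((\<beta> - \<alpha>) * D + A + 1) * F" using 3 by (simp add: algebra_simps)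
      finally show ?thesis .
    next
      case False
      have ih: "norm (integral {\<alpha> + 1..\<beta>} (line p q a e) - of_real (\<beta> - (\<alpha> + 1)) * Phi p)
         \<le> ((\<beta> - (\<alpha> + 1)) * D + A + 1) * F"
        using Suc False by (intro Suc.IH) auto
      have un: "norm (integral {\<alpha>..\<alpha> + 1} (line p q a e) - Phi p) \<le> D * F"
        unfolding F_def by (rule good_unit[OF g e])
      have "integral {\<alpha>..\<beta>} (line p q a e)
          = integral {\<alpha>..\<alpha> + 1} (line p q a e) + integral {\<alpha> + 1..\<beta>} (line p q a e)"
        using False bmeas_integrable_on[OF bl] by (intro Henstock_Kurzweil_Integration.integral_combine[symmetric]) auto
      then have "integral {\<alpha>..\<beta>} (line p q a e) - of_real (\<beta> - \<alpha>) * Phi p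
          = (integral {\<alpha>..\<alpha> + 1} (line p q a e) - Phi p) + (integral {\<alpha> + 1..\<beta>} (line p q a e) - of_real (\<beta> - (\<alpha> + 1)) * Phi p)"
        by (simp add: algebra_simps)
      also have "norm \<dots> \<le> D * F + ((\<beta> - (\<alpha> + 1)) * D + A + 1) * F"
        using un ih by (rule norm_triangle_mono)
      finally show ?thesis by (simp add: algebra_simps)
    qed
  qed
  from this[of \<alpha> "nat \<lceil>\<beta> - \<alpha>\<rceil>"] show ?thesis using ab unfolding F_def by (simp add: real_nat_ceiling_ge)
qed

lemma good_long_signed:
  assumes g: "good p q A D" and e: "\<bar>e\<bar> \<le> 1" and AD: "0 \<le> A" "0 \<le> D"
  shows "norm (sint (line p q a e) x y - of_real (y - x) * Phi p) \<le> (\<bar>x - y\<bar> * D + A + 1) * norm (Phi p)"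
proof (cases "x \<le> y")
  case True
  then have "\<bar>x - y\<bar> = y - x" by simp
  then show ?thesis using good_long[OF g e AD True, of a] True by (simp add: sint_def)
next
  case False
  then have "y \<le> x" and xy: "\<bar>x - y\<bar> = x - y" by simp_all
  have "sint (line p q a e) x y - of_real (y - x) * Phi p
      = - (integral {y..x} (line p q a e) - of_real (x - y) * Phi p)"
    using False by (simp add: sint_def algebra_simps)
  then have "norm (sint (line p q a e) x y - of_real (y - x) * Phi p)
      = norm (integral {y..x} (line p q a e) - of_real (x - y) * Phi p)"
    by (simp only: norm_minus_cancel)
  then show ?thesis using good_long[OF g e AD \<open>y \<le> x\<close>, of a] xy by simp
qed

text \<open>The sum covers two regimes. Up to length 1 the square-root bound alone suffices; beyond
  that the linear term counts unit segments, with D \<le> 1, and the square root, now at least 1,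
  absorbs the remainder A + 1.\<close>

lemma good_signed:
  assumes g: "good p q A D" and e: "\<bar>e\<bar> \<le> 1" and AD: "0 \<le> A" "0 \<le> D" "D \<le> 1"
  shows "norm (sint (line p q a e) x y) \<le> (2 * \<bar>x - y\<bar> + (A + 1) * sqrt \<bar>x - y\<bar>) * norm (Phi p)"
proof -
  define F where "F = norm (Phi p)"
  have F0: "0 \<le> F" by (simp add: F_def)
  have *: "norm (integral {x..y} (line p q a e)) \<le> (2 * (y - x) + (A + 1) * sqrt (y - x)) * F" if xy: "x \<le> y" for x y
  proof (cases "y \<le> x + 1")
    case True
    have "norm (integral {x..y} (line p q a e)) \<le> A * sqrt (y - x) * F"
      unfolding F_def using True xy by (intro good_line[OF g e])
    also have "\<dots> \<le> (2 * (y - x) + (A + 1) * sqrt (y - x)) * F"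
    proof (rule mult_right_mono[OF _ F0])
      have "0 \<le> 2 * (y - x)" "0 \<le> sqrt (y - x)" using xy by auto
      then show "A * sqrt (y - x) \<le> 2 * (y - x) + (A + 1) * sqrt (y - x)"
        unfolding distrib_right by linarith
    qed
    finally show ?thesis .
  next
    case False
    have sq: "1 \<le> sqrt (y - x)" using False by simp
    have "norm (integral {x..y} (line p q a e)) \<le> norm (integral {x..y} (line p q a e) - of_real (y - x) * Phi p) + norm (of_real (y - x) * Phi p)"
      by (metis diff_add_cancel norm_triangle_ineq)
    also have "\<dots> \<le> ((y - x) * D + A + 1) * F + (y - x) * F"
      using good_long[OF g e AD(1,2) xy, of a] xy by (simp add: norm_mult F_def del: of_real_diff)
    also have "\<dots> = ((y - x) * D + (y - x) + (A + 1) * 1) * F" by (simp add: algebra_simps)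
    also have "\<dots> \<le> ((y - x) * 1 + (y - x) + (A + 1) * sqrt (y - x)) * F"
      using AD F0 sq xy by (intro mult_right_mono add_mono mult_left_mono) auto
    finally show ?thesis by simp
  qed
  show ?thesis
  proof (cases "x \<le> y")
    case True
    then show ?thesis using *[of x y] by (simp add: sint_def F_def abs_if)
  next
    case False
    then show ?thesis using *[of y x] by (simp add: sint_def F_def abs_if)
  qed
qed

lemma convex_abs_bound:
  fixes b c :: real
  assumes "\<bar>b + c * \<alpha>\<bar> \<le> \<delta>" "\<bar>b + c * \<beta>\<bar> \<le> \<delta>" "\<alpha> \<le> s" "s \<le> \<beta>"
  shows "\<bar>b + c * s\<bar> \<le> \<delta>"
proof (cases "c \<ge> 0")
  case True
  then have "c * \<alpha> \<le> c * s" "c * s \<le> c * \<beta>" using assms by (auto intro: mult_left_mono)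
  then show ?thesis using assms by linarith
next
  case False
  then have "c * \<beta> \<le> c * s" "c * s \<le> c * \<alpha>" using assms by (auto intro: mult_left_mono_neg)
  then show ?thesis using assms by linarith
qed

text \<open>Cutting into unit pieces is harmless because the vertical distance of two lines is
  convex in the parameter: the bound \<delta> at both ends persists at every cut. At most length
  plus one pieces arise.\<close>

lemma good_long_diff:
  assumes g: "good p q A D" and e: "\<bar>e1\<bar> \<le> 1" "\<bar>e2\<bar> \<le> 1" and AD: "0 \<le> D" and ab: "\<alpha> \<le> \<beta>"
    and \<delta>: "0 \<le> \<delta>" "\<delta> \<le> 1"
    and d: "\<bar>(a1 + e1 * \<alpha>) - (a2 + e2 * \<alpha>)\<bar> \<le> \<delta>" "\<bar>(a1 + e1 * \<beta>) - (a2 + e2 * \<beta>)\<bar> \<le> \<delta>"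
  shows "norm (integral {\<alpha>..\<beta>} (line p q a1 e1) - integral {\<alpha>..\<beta>} (line p q a2 e2))
        \<le> (\<beta> - \<alpha> + 1) * (D * sqrt \<delta> * norm (Phi p))"
proof -
  have bl: "bmeas (line p q a e)" for a e using g by (intro bmeas_line) (auto simp: good_def)
  define E where "E = D * sqrt \<delta> * norm (Phi p)"
  have E0: "0 \<le> E" using AD \<delta> by (simp add: E_def)
  have "norm (integral {\<alpha>..\<beta>} (line p q a1 e1) - integral {\<alpha>..\<beta>} (line p q a2 e2)) \<le> (\<beta> - \<alpha> + 1) * E"
    if "\<alpha> \<le> \<beta>" "\<beta> - \<alpha> \<le> real n" "\<bar>(a1 + e1 * \<alpha>) - (a2 + e2 * \<alpha>)\<bar> \<le> \<delta>" for n \<alpha>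
    using that
  proof (induction n arbitrary: \<alpha>)
    case 0
    then have "\<alpha> = \<beta>" by simp
    then show ?case using E0 by simp
  next
    case (Suc n)
    show ?case
    proof (cases "\<beta> \<le> \<alpha> + 1")
      case True
      have "norm (integral {\<alpha>..\<beta>} (line p q a1 e1) - integral {\<alpha>..\<beta>} (line p q a2 e2)) \<le> E"
        unfolding E_def using True Suc.prems d \<delta> by (intro good_lines[OF g e])
      also have "\<dots> \<le> (\<beta> - \<alpha> + 1) * E" using Suc.prems mult_nonneg_nonneg[of "\<beta> - \<alpha>" E] E0 by (simp add: distrib_right)
      finally show ?thesis .
    next
      case False
      have d1: "\<bar>(a1 + e1 * (\<alpha> + 1)) - (a2 + e2 * (\<alpha> + 1))\<bar> \<le> \<delta>"
        using convex_abs_bound[of "a1 - a2" "e1 - e2" \<alpha> \<delta> \<beta> "\<alpha> + 1"] Suc.prems d False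
        by (simp add: algebra_simps)
      have ih: "norm (integral {\<alpha> + 1..\<beta>} (line p q a1 e1) - integral {\<alpha> + 1..\<beta>} (line p q a2 e2)) \<le> (\<beta> - (\<alpha> + 1) + 1) * E"
        using Suc.prems False d1 by (intro Suc.IH) auto
      have un: "norm (integral {\<alpha>..\<alpha> + 1} (line p q a1 e1) - integral {\<alpha>..\<alpha> + 1} (line p q a2 e2)) \<le> E"
      proof -
        show ?thesis unfolding E_def using Suc.prems(3) d1 \<delta> by (intro good_lines[OF g e]) auto
      qed
      have "integral {\<alpha>..\<beta>} (line p q a e) = integral {\<alpha>..\<alpha> + 1} (line p q a e) + integral {\<alpha> + 1..\<beta>} (line p q a e)" for a e
        using False bmeas_integrable_on[OF bl] by (intro Henstock_Kurzweil_Integration.integral_combine[symmetric]) auto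
      then have "integral {\<alpha>..\<beta>} (line p q a1 e1) - integral {\<alpha>..\<beta>} (line p q a2 e2)
         = (integral {\<alpha>..\<alpha> + 1} (line p q a1 e1) - integral {\<alpha>..\<alpha> + 1} (line p q a2 e2))
          + (integral {\<alpha> + 1..\<beta>} (line p q a1 e1) - integral {\<alpha> + 1..\<beta>} (line p q a2 e2))"
        by (simp add: algebra_simps)
      also have "norm \<dots> \<le> E + (\<beta> - (\<alpha> + 1) + 1) * E"
        using un ih by (rule norm_triangle_mono)
      finally show ?thesis by (simp add: algebra_simps)
    qed
  qed
  from this[of \<alpha> "nat \<lceil>\<beta> - \<alpha>\<rceil>"] show ?thesis using ab d unfolding E_def by (simp add: real_nat_ceiling_ge)
qed

lemma good_signed_diff:
  assumes g: "good p q A D" and e: "\<bar>e1\<bar> \<le> 1" "\<bar>e2\<bar> \<le> 1" and AD: "0 \<le> D"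
    and \<delta>: "0 \<le> \<delta>" "\<delta> \<le> 1"
    and d: "\<bar>(a1 + e1 * x) - (a2 + e2 * x)\<bar> \<le> \<delta>" "\<bar>(a1 + e1 * y) - (a2 + e2 * y)\<bar> \<le> \<delta>"
  shows "norm (sint (line p q a1 e1) x y - sint (line p q a2 e2) x y)
        \<le> (\<bar>x - y\<bar> + 1) * (D * sqrt \<delta> * norm (Phi p))"
proof (cases "x \<le> y")
  case True
  then have "\<bar>x - y\<bar> = y - x" by simp
  then show ?thesis using good_long_diff[OF g e AD True \<delta> d] True by (simp add: sint_def)
next
  case False
  then have "y \<le> x" by simp
  moreover have "\<bar>x - y\<bar> = x - y" using False by simp
  ultimately show ?thesis using good_long_diff[OF g e AD _ \<delta> d(2,1)] False
    by (simp add: sint_def norm_minus_commute)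
qed

section \<open>One shear acting on line integrals\<close>

text \<open>\<open>step1 p q\<close> and \<open>step2 p\<close> are the coefficients, with \<open>x\<close> and \<open>y\<close> exchanged, of the pull-back of
  \<open>exp (2 \<pi> \<i> z) (p dx + q dy)\<close> by a single shear. Because of the exchange, pulling back by the whole map
  is two steps of the same kind.\<close>

definition step1 :: "(real \<Rightarrow> real \<Rightarrow> complex) \<Rightarrow> (real \<Rightarrow> real \<Rightarrow> complex) \<Rightarrow> real \<Rightarrow> real \<Rightarrow> complex" where
  "step1 p q x y = phase x * (q (y + stretch * tent x) x + of_real (stretch * slope x) * p (y + stretch * tent x) x)"

definition step2 :: "(real \<Rightarrow> real \<Rightarrow> complex) \<Rightarrow> real \<Rightarrow> real \<Rightarrow> complex" where
  "step2 p x y = phase x * p (y + stretch * tent x) x"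

lemma abs_slope: "\<bar>slope x\<bar> = 1"
  by (simp add: slope_def)

lemma planar_step2: assumes "planar p" shows "planar (step2 p)"
proof -
  obtain C where C: "\<And>x y. norm (p x y) \<le> C" using assms by (auto simp: planar_def)
  have "(\<lambda>z. step2 p (fst z) (snd z)) \<in> borel_measurable (borel \<Otimes>\<^sub>M borel)"
    unfolding step2_def by (intro borel_measurable_times planar_compose[OF assms]) measurable
  moreover have "norm (step2 p x y) \<le> C" for x y
    using C by (simp add: step2_def norm_mult)
  moreover have "step2 p (x + 1) y = step2 p x y" "step2 p x (y + 1) = step2 p x y" for x y
  proof -
    have "y + 1 + stretch * tent x = (y + stretch * tent x) + 1" by simp
    then show "step2 p x (y + 1) = step2 p x y" using assms by (simp only: step2_def planar_def)
  qed (use assms in \<open>simp add: step2_def planar_def\<close>)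
  ultimately show ?thesis unfolding planar_def borel_prod by blast
qed

lemma planar_step1: assumes "planar p" "planar q" shows "planar (step1 p q)"
proof -
  obtain C E where C: "\<And>x y. norm (p x y) \<le> C" "\<And>x y. norm (q x y) \<le> E" using assms by (auto simp: planar_def)
  have "(\<lambda>z. step1 p q (fst z) (snd z)) \<in> borel_measurable (borel \<Otimes>\<^sub>M borel)"
    unfolding step1_def
    by (intro borel_measurable_times borel_measurable_add planar_compose[OF assms(1)] planar_compose[OF assms(2)]) measurable
  moreover have "norm (step1 p q x y) \<le> E + stretch * C" for x y
  proof -
    have "norm (step1 p q x y) = norm (q (y + stretch * tent x) x + of_real (stretch * slope x) * p (y + stretch * tent x) x)"
      by (simp add: step1_def norm_mult)
    also have "\<dots> \<le> norm (q (y + stretch * tent x) x) + norm (of_real (stretch * slope x) * p (y + stretch * tent x) x)"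
      by (rule norm_triangle_ineq)
    also have "norm (of_real (stretch * slope x) * p (y + stretch * tent x) x) = stretch * norm (p (y + stretch * tent x) x)"
      by (simp add: norm_mult abs_mult abs_slope stretch_def)
    finally show ?thesis using C(1)[of "y + stretch * tent x" x] C(2)[of "y + stretch * tent x" x]
      by (simp add: stretch_def)
  qed
  moreover have "step1 p q (x + 1) y = step1 p q x y" "step1 p q x (y + 1) = step1 p q x y" for x y
  proof -
    have "y + 1 + stretch * tent x = (y + stretch * tent x) + 1" by simp
    then show "step1 p q x (y + 1) = step1 p q x y" using assms by (simp only: step1_def planar_def)
  qed (use assms in \<open>simp add: step1_def planar_def\<close>)
  ultimately show ?thesis unfolding planar_def borel_prod by blast
qed

text \<open>The creases have spacing 1/2, so an interval of length at most 1 meets three cells in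
  the worst case, two of them partially. Every estimate on a single branch therefore costs a factor
  3.\<close>

lemma three_cells:
  fixes f :: "real \<Rightarrow> complex"
  assumes f: "bmeas f" and ab: "\<alpha> \<le> \<beta>" "\<beta> \<le> \<alpha> + 1"
    and X: "\<And>\<alpha>' \<beta>' k. \<alpha> \<le> \<alpha>' \<Longrightarrow> \<alpha>' \<le> \<beta>' \<Longrightarrow> \<beta>' \<le> \<beta> \<Longrightarrow> of_int k / 2 \<le> \<alpha>' \<Longrightarrow> \<beta>' \<le> (of_int k + 1) / 2
      \<Longrightarrow> norm (integral {\<alpha>'..\<beta>'} f) \<le> X"
  shows "norm (integral {\<alpha>..\<beta>} f) \<le> 3 * X"
proof -
  define k where "k = \<lfloor>2 * \<alpha>\<rfloor>"
  have k: "of_int k / 2 \<le> \<alpha>" "\<alpha> \<le> (of_int k + 1) / 2"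
    using of_int_floor_le[of "2 * \<alpha>"] real_of_int_floor_add_one_ge[of "2 * \<alpha>"] unfolding k_def by (simp_all add: field_simps)
  have k1: "of_int (k + 1) / 2 = (of_int k + 1) / (2::real)" "(of_int (k + 1) + 1) / 2 = (of_int k + 2) / (2::real)"
    "of_int (k + 2) / 2 = (of_int k + 2) / (2::real)" "(of_int (k + 2) + 1) / 2 = (of_int k + 3) / (2::real)"
    by simp_all
  have comb: "integral {x..y} f = integral {x..z} f + integral {z..y} f" if "x \<le> z" "z \<le> y" for x y z
    using bmeas_integrable_on[OF f] that by (intro Henstock_Kurzweil_Integration.integral_combine[symmetric]) auto
  have X0: "0 \<le> X" using X[of \<alpha> \<alpha> k] ab k by simp
  consider "\<beta> \<le> (of_int k + 1) / 2" | "(of_int k + 1) / 2 < \<beta>" "\<beta> \<le> (of_int k + 2) / 2"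
    | "(of_int k + 2) / 2 < \<beta>" by linarith
  then show ?thesis
  proof cases
    case 1
    then show ?thesis using X[of \<alpha> \<beta> k] X0 ab k by simp
  next
    case 2
    have "norm (integral {\<alpha>..(of_int k + 1) / 2} f) \<le> X" "norm (integral {(of_int k + 1) / 2..\<beta>} f) \<le> X"
      using X[of \<alpha> "(of_int k + 1) / 2" k] X[of "(of_int k + 1) / 2" \<beta> "k + 1"] 2 k by (simp_all add: k1)
    then have "norm (integral {\<alpha>..(of_int k + 1) / 2} f + integral {(of_int k + 1) / 2..\<beta>} f) \<le> X + X"
      by (rule norm_triangle_mono)
    then show ?thesis using comb[of \<alpha> "(of_int k + 1) / 2" \<beta>] X0 2 k by simp
  next
    case 3
    let ?h1 = "(of_int k + 1) / (2::real)" and ?h2 = "(of_int k + 2) / (2::real)"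
    have b3: "\<beta> \<le> (of_int k + 3) / 2" using ab k by (simp add: field_simps)
    have "norm (integral {\<alpha>..?h1} f) \<le> X" "norm (integral {?h1..?h2} f) \<le> X" "norm (integral {?h2..\<beta>} f) \<le> X"
      using X[of \<alpha> ?h1 k] X[of ?h1 ?h2 "k + 1"] X[of ?h2 \<beta> "k + 2"] 3 k b3 by (simp_all add: k1)
    then have "norm (integral {\<alpha>..?h1} f + (integral {?h1..?h2} f + integral {?h2..\<beta>} f)) \<le> X + (X + X)"
      by (intro norm_triangle_mono)
    moreover have "integral {\<alpha>..\<beta>} f = integral {\<alpha>..?h1} f + (integral {?h1..?h2} f + integral {?h2..\<beta>} f)"
      using comb[of \<alpha> ?h1 \<beta>] comb[of ?h1 ?h2 \<beta>] 3 k by simp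
    ultimately show ?thesis by simp
  qed
qed

text \<open>Put c = a + stretch * b. Inside a cell, the sheared point over s has first coordinate u
  = c + m * s, with m = e + \<eta> * stretch. With u as parameter the image is the segment of height
  (u - c) / m, hence of slope 1 / m, and the factor m is the substitution. So the exchange of
  coordinates returns a nearly horizontal segment.\<close>

lemma step_branch:
  assumes pq: "planar p" "planar q" and ab: "\<alpha> \<le> \<beta>"
    and t: "\<And>s. \<alpha> \<le> s \<Longrightarrow> s \<le> \<beta> \<Longrightarrow> tent s = \<eta> * s + b"
    and sl: "\<And>s. \<alpha> \<le> s \<Longrightarrow> s < \<beta> \<Longrightarrow> slope s = \<eta>"
    and m: "m = e + \<eta> * stretch" "m \<noteq> 0"
  shows "integral {\<alpha>..\<beta>} (line (step1 p q) (step2 p) a e)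
     = integral {\<alpha>..\<beta>} (\<lambda>s. phase s * (of_real m * line p q (- ((a + stretch * b) / m)) (1 / m) (a + stretch * b + m * s)))"
\<comment> \<open>The slope formula is available only to the left of \<beta>, which may be a
  crease.\<close>
proof (rule integral_spike[of "{\<beta>}"])
  fix s assume s: "s \<in> {\<alpha>..\<beta>} - {\<beta>}"
  have u: "a + e * s + stretch * tent s = a + stretch * b + m * s"
    using t[of s] s by (simp add: m algebra_simps)
  have v: "- ((a + stretch * b) / m) + 1 / m * (a + stretch * b + m * s) = s"
    using m(2) by (simp add: field_simps)
  \<comment> \<open>Along the segment \<open>step1\<close> contributes (m - e) times p and
    \<open>step2\<close> contributes e times p, together m times p; the coefficient 1 of q is m * (1
    / m).\<close>
  have c: "of_real (stretch * slope s) = (of_real m - of_real e :: complex)"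
    using sl[of s] s by (simp add: m)
  show "phase s * (of_real m * line p q (- ((a + stretch * b) / m)) (1 / m) (a + stretch * b + m * s)) = line (step1 p q) (step2 p) a e s"
    unfolding line_def step1_def step2_def u v c using m(2)
    by (simp add: algebra_simps)
qed auto

lemma slope_bounds:
  assumes "m = e + \<eta> * stretch" "\<bar>e\<bar> \<le> 1" "\<eta> = 1 \<or> \<eta> = - 1"
  shows "m \<noteq> 0" "\<bar>m\<bar> \<le> stretch + 1" "stretch - 1 \<le> \<bar>m\<bar>" "\<bar>1 / m\<bar> \<le> 1"
  using assms by (auto simp: stretch_def abs_if field_simps split: if_splits)

text \<open>Integration by parts removes \<open>phase s\<close> at the cost of the factor 9. What
  remains are oriented integrals of the old form along the image segment, whose extent is at most
  (stretch + 1) * (\<beta> - \<alpha>).\<close>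

lemma step_cell_bound:
  assumes g: "good p q A D" and AD: "0 \<le> A" "0 \<le> D" "D \<le> 1"
    and e: "\<bar>e\<bar> \<le> 1" and ab: "\<alpha> \<le> \<beta>" "of_int k / 2 \<le> \<alpha>" "\<beta> \<le> (of_int k + 1) / 2"
  shows "norm (integral {\<alpha>..\<beta>} (line (step1 p q) (step2 p) a e))
    \<le> (2 * ((stretch + 1) * (\<beta> - \<alpha>)) + (A + 1) * sqrt ((stretch + 1) * (\<beta> - \<alpha>))) * norm (Phi p) * 9"
proof -
  obtain \<eta> b where \<eta>: "\<eta> = 1 \<or> \<eta> = - 1"
    and t: "\<And>s. k / 2 \<le> s \<Longrightarrow> s \<le> (k + 1) / 2 \<Longrightarrow> tent s = \<eta> * s + b"
    and sl: "\<And>s. k / 2 \<le> s \<Longrightarrow> s < (k + 1) / 2 \<Longrightarrow> slope s = \<eta>"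
    using tent_cell[of k] by blast
  define m where "m = e + \<eta> * stretch"
  note mb = slope_bounds[OF m_def e \<eta>]
  have pq: "planar p" "planar q" using g by (auto simp: good_def)
  define \<phi> where "\<phi> = line p q (- ((a + stretch * b) / m)) (1 / m)"
  have b\<phi>: "bmeas \<phi>" unfolding \<phi>_def by (rule bmeas_line[OF pq])
  define M where "M = (2 * ((stretch + 1) * (\<beta> - \<alpha>)) + (A + 1) * sqrt ((stretch + 1) * (\<beta> - \<alpha>))) * norm (Phi p)"
  have eq: "integral {\<alpha>..\<beta>} (line (step1 p q) (step2 p) a e) = integral {\<alpha>..\<beta>} (\<lambda>s. phase s * (of_real m * \<phi> (a + stretch * b + m * s)))"
    unfolding \<phi>_def using t sl ab by (intro step_branch[OF pq ab(1)]) (auto simp: m_def mb(1)[unfolded m_def])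
  have "norm (integral {\<alpha>..\<beta>} (\<lambda>s. phase s * (of_real m * \<phi> (a + stretch * b + m * s)))) \<le> M * (1 + 16 * (\<beta> - \<alpha>))"
  proof (rule integral_by_parts_bound[OF _ ab(1) phase_deriv continuous_phase' norm_phase'])
    show "bmeas (\<lambda>s. of_real m * \<phi> (a + stretch * b + m * s))"
      by (rule bmeas_mult_affine[OF b\<phi>])
    fix r assume r: "\<alpha> \<le> r" "r \<le> \<beta>"
    have "integral {\<alpha>..r} (\<lambda>s. of_real m * \<phi> (a + stretch * b + m * s)) = sint \<phi> (a + stretch * b + m * \<alpha>) (a + stretch * b + m * r)"
      by (rule integral_affine[OF b\<phi> r(1) mb(1)])
    also have "norm \<dots> \<le> (2 * \<bar>(a + stretch * b + m * \<alpha>) - (a + stretch * b + m * r)\<bar>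
       + (A + 1) * sqrt \<bar>(a + stretch * b + m * \<alpha>) - (a + stretch * b + m * r)\<bar>) * norm (Phi p)"
      unfolding \<phi>_def by (rule good_signed[OF g mb(4) AD])
    also have "\<dots> \<le> M"
    proof -
      have "\<bar>(a + stretch * b + m * \<alpha>) - (a + stretch * b + m * r)\<bar> = \<bar>m\<bar> * \<bar>\<alpha> - r\<bar>"
        by (simp add: abs_mult[symmetric] algebra_simps)
      also have "\<dots> \<le> (stretch + 1) * (\<beta> - \<alpha>)"
        using mb r by (intro mult_mono) (auto simp: stretch_def)
      finally show ?thesis unfolding M_def using AD
        by (intro mult_right_mono add_mono mult_left_mono real_sqrt_le_mono) auto
    qed
    finally show "norm (integral {\<alpha>..r} (\<lambda>s. of_real m * \<phi> (a + stretch * b + m * s))) \<le> M" .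
  qed simp
  also have "\<dots> \<le> M * 9"
  proof (rule mult_left_mono)
    show "0 \<le> M" unfolding M_def using ab AD by (auto simp: stretch_def)
  qed (use ab in \<open>simp add: field_simps\<close>)
  finally show ?thesis using eq by (simp add: M_def)
qed

text \<open>As functions of \<open>s\<close>, the two integrands carry the same factor \<open>phase s\<close>. After integration by parts against it
  only the integrals of \<open>line p q\<close> along the two image segments have to be compared; these lie at distance
  \<open>\<delta> / (stretch - 1)\<close>, with endpoints that differ by at most \<open>\<delta>\<close>.\<close>

lemma step_cell_diff:
  assumes g: "good p q A D" and AD: "0 \<le> A" "0 \<le> D" "D \<le> 1"
    and e: "\<bar>e1\<bar> \<le> 1" "\<bar>e2\<bar> \<le> 1" and ab: "\<alpha> \<le> \<beta>" "of_int k / 2 \<le> \<alpha>" "\<beta> \<le> (of_int k + 1) / 2"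
    and \<delta>: "0 \<le> \<delta>" "\<delta> \<le> 1"
    and d: "\<bar>(a1 + e1 * \<alpha>) - (a2 + e2 * \<alpha>)\<bar> \<le> \<delta>" "\<bar>(a1 + e1 * \<beta>) - (a2 + e2 * \<beta>)\<bar> \<le> \<delta>"
  shows "norm (integral {\<alpha>..\<beta>} (line (step1 p q) (step2 p) a1 e1) - integral {\<alpha>..\<beta>} (line (step1 p q) (step2 p) a2 e2))
    \<le> ((stretch + 2) * (D * sqrt (\<delta> / (stretch - 1))) + 2 * A * sqrt \<delta>) * norm (Phi p) * 9"
proof -
  obtain \<eta> b where \<eta>: "\<eta> = 1 \<or> \<eta> = - 1"
    and t: "\<And>s. k / 2 \<le> s \<Longrightarrow> s \<le> (k + 1) / 2 \<Longrightarrow> tent s = \<eta> * s + b"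
    and sl: "\<And>s. k / 2 \<le> s \<Longrightarrow> s < (k + 1) / 2 \<Longrightarrow> slope s = \<eta>"
    using tent_cell[of k] by blast
  define m1 where "m1 = e1 + \<eta> * stretch"
  define m2 where "m2 = e2 + \<eta> * stretch"
  note mb1 = slope_bounds[OF m1_def e(1) \<eta>]
  note mb2 = slope_bounds[OF m2_def e(2) \<eta>]
  have pq: "planar p" "planar q" using g by (auto simp: good_def)
  define c1 where "c1 = a1 + stretch * b"
  define c2 where "c2 = a2 + stretch * b"
  define \<phi>1 where "\<phi>1 = line p q (- (c1 / m1)) (1 / m1)"
  define \<phi>2 where "\<phi>2 = line p q (- (c2 / m2)) (1 / m2)"
  have b1: "bmeas \<phi>1" and b2: "bmeas \<phi>2" unfolding \<phi>1_def \<phi>2_def by (rule bmeas_line[OF pq])+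
  define f where "f = (\<lambda>s. of_real m1 * \<phi>1 (c1 + m1 * s) - of_real m2 * \<phi>2 (c2 + m2 * s))"
  have bf1: "bmeas (\<lambda>s. of_real m1 * \<phi>1 (c1 + m1 * s))" and bf2: "bmeas (\<lambda>s. of_real m2 * \<phi>2 (c2 + m2 * s))"
    by (rule bmeas_mult_affine[OF b1] bmeas_mult_affine[OF b2])+
  have bp: "bmeas phase" by (auto simp: bmeas_def intro: exI[of _ 1])
  have bf: "bmeas f" unfolding f_def by (rule bmeas_diff[OF bf1 bf2])
  define F where "F = norm (Phi p)"
  have F0: "0 \<le> F" by (simp add: F_def)
  define M where "M = ((stretch + 2) * (D * sqrt (\<delta> / (stretch - 1))) + 2 * A * sqrt \<delta>) * F"
  have eq1: "integral {\<alpha>..\<beta>} (line (step1 p q) (step2 p) a1 e1) = integral {\<alpha>..\<beta>} (\<lambda>s. phase s * (of_real m1 * \<phi>1 (c1 + m1 * s)))"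
    unfolding \<phi>1_def c1_def using t sl ab by (intro step_branch[OF pq ab(1)]) (auto simp: m1_def mb1(1)[unfolded m1_def])
  have eq2: "integral {\<alpha>..\<beta>} (line (step1 p q) (step2 p) a2 e2) = integral {\<alpha>..\<beta>} (\<lambda>s. phase s * (of_real m2 * \<phi>2 (c2 + m2 * s)))"
    unfolding \<phi>2_def c2_def using t sl ab by (intro step_branch[OF pq ab(1)]) (auto simp: m2_def mb2(1)[unfolded m2_def])
  have eq: "integral {\<alpha>..\<beta>} (line (step1 p q) (step2 p) a1 e1) - integral {\<alpha>..\<beta>} (line (step1 p q) (step2 p) a2 e2)
      = integral {\<alpha>..\<beta>} (\<lambda>s. phase s * f s)"
    unfolding eq1 eq2 f_def right_diff_distrib
    by (rule Henstock_Kurzweil_Integration.integral_diff[symmetric, OF bmeas_integrable_on[OF bmeas_mult[OF bp bf1]] bmeas_integrable_on[OF bmeas_mult[OF bp bf2]]])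
  have "norm (integral {\<alpha>..\<beta>} (\<lambda>s. phase s * f s)) \<le> M * (1 + 16 * (\<beta> - \<alpha>))"
  proof (rule integral_by_parts_bound[OF bf ab(1) phase_deriv continuous_phase' norm_phase'])
    fix r assume r: "\<alpha> \<le> r" "r \<le> \<beta>"
    define x1 where "x1 = c1 + m1 * \<alpha>"
    define y1 where "y1 = c1 + m1 * r"
    define x2 where "x2 = c2 + m2 * \<alpha>"
    define y2 where "y2 = c2 + m2 * r"
    have dd: "\<bar>(c1 + m1 * s) - (c2 + m2 * s)\<bar> \<le> \<delta>" if "\<alpha> \<le> s" "s \<le> \<beta>" for s
      using convex_abs_bound[of "a1 - a2" "e1 - e2" \<alpha> \<delta> \<beta> s] d that
      by (simp add: c1_def c2_def m1_def m2_def algebra_simps)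
    have xd: "\<bar>x1 - x2\<bar> \<le> \<delta>" and yd: "\<bar>y1 - y2\<bar> \<le> \<delta>"
      using dd[of \<alpha>] dd[of r] r ab by (simp_all add: x1_def x2_def y1_def y2_def)
    have "integral {\<alpha>..r} f = sint \<phi>1 x1 y1 - sint \<phi>2 x2 y2"
      unfolding f_def x1_def y1_def x2_def y2_def
      using integral_affine[OF b1 r(1) mb1(1), of c1] integral_affine[OF b2 r(1) mb2(1), of c2]
      by (subst Henstock_Kurzweil_Integration.integral_diff[OF bmeas_integrable_on[OF bf1] bmeas_integrable_on[OF bf2]]) simp
    \<comment> \<open>The two lines are compared over the same parameter range x1 to y1, and the
      ends of the second range are corrected. Orientation makes this an identity whatever the order
      of the four endpoints.\<close>
    also have "\<dots> = (sint \<phi>1 x1 y1 - sint \<phi>2 x1 y1) + (sint \<phi>2 x1 x2 + sint \<phi>2 y2 y1)"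
      by (simp add: sint_add[OF b2, of x1 y2 y1, symmetric] sint_add[OF b2, of x1 x2 y2, symmetric])
    finally have split: "integral {\<alpha>..r} f = (sint \<phi>1 x1 y1 - sint \<phi>2 x1 y1) + (sint \<phi>2 x1 x2 + sint \<phi>2 y2 y1)" .
    have short: "norm (sint \<phi>2 x y) \<le> A * sqrt \<delta> * F" if "\<bar>x - y\<bar> \<le> \<delta>" for x y
    proof -
      have "norm (integral {x..y} \<phi>2) \<le> A * sqrt \<delta> * F" if "x \<le> y" "y - x \<le> \<delta>" for x y
      proof -
        have "norm (integral {x..y} \<phi>2) \<le> A * sqrt (y - x) * F"
          unfolding \<phi>2_def F_def using that \<delta> by (intro good_line[OF g mb2(4)]) auto
        also have "\<dots> \<le> A * sqrt \<delta> * F"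
          using that AD F0 by (intro mult_right_mono mult_left_mono real_sqrt_le_mono) auto
        finally show ?thesis .
      qed
      from this[of x y] this[of y x] show ?thesis using that by (auto simp: sint_def)
    qed
    \<comment> \<open>At the parameter c1 + m1 * s the first image line has height s. The second has
      height s at c2 + m2 * s, at most \<delta> away, and has slope 1 / m2, so the displacement is
      divided by at least stretch - 1.\<close>
    have near: "\<bar>(- (c1 / m1) + 1 / m1 * (c1 + m1 * s)) - (- (c2 / m2) + 1 / m2 * (c1 + m1 * s))\<bar> \<le> \<delta> / (stretch - 1)"
      if "\<alpha> \<le> s" "s \<le> \<beta>" for s
    proof -
      have "(- (c1 / m1) + 1 / m1 * (c1 + m1 * s)) = s"
        using mb1(1) by (simp add: field_simps)
      then have "(- (c1 / m1) + 1 / m1 * (c1 + m1 * s)) - (- (c2 / m2) + 1 / m2 * (c1 + m1 * s))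
          = ((c2 + m2 * s) - (c1 + m1 * s)) / m2"
        using mb2(1) by (simp add: field_simps)
      also have "\<bar>\<dots>\<bar> \<le> \<delta> / (stretch - 1)"
        unfolding abs_divide using dd[OF that] mb2(3) \<delta> by (intro frac_le) (auto simp: stretch_def abs_minus_commute)
      finally show ?thesis .
    qed
    have st: "\<delta> / (stretch - 1) \<le> 1" "0 \<le> \<delta> / (stretch - 1)" using \<delta> by (simp_all add: stretch_def)
    have "norm (sint \<phi>1 x1 y1 - sint \<phi>2 x1 y1) \<le> (\<bar>x1 - y1\<bar> + 1) * (D * sqrt (\<delta> / (stretch - 1)) * norm (Phi p))"
      unfolding \<phi>1_def \<phi>2_def
      by (rule good_signed_diff[OF g mb1(4) mb2(4) AD(2) st(2,1)]) (use near[of \<alpha>] near[of r] r ab in \<open>simp_all add: x1_def y1_def\<close>)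
    also have "\<dots> \<le> (stretch + 2) * (D * sqrt (\<delta> / (stretch - 1)) * norm (Phi p))"
    proof (rule mult_right_mono)
      have "\<bar>x1 - y1\<bar> = \<bar>m1\<bar> * \<bar>\<alpha> - r\<bar>"
        by (simp add: abs_mult[symmetric] x1_def y1_def algebra_simps)
      also have "\<dots> \<le> (stretch + 1) * 1"
        using mb1 r ab by (intro mult_mono) auto
      finally show "\<bar>x1 - y1\<bar> + 1 \<le> stretch + 2" by simp
    qed (use AD st in auto)
    finally have 1: "norm (sint \<phi>1 x1 y1 - sint \<phi>2 x1 y1) \<le> (stretch + 2) * (D * sqrt (\<delta> / (stretch - 1)) * F)"
      by (simp add: F_def)
    have 2: "norm (sint \<phi>2 x1 x2 + sint \<phi>2 y2 y1) \<le> A * sqrt \<delta> * F + A * sqrt \<delta> * F"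
      using xd yd by (intro norm_triangle_mono short) (auto simp: abs_minus_commute)
    show "norm (integral {\<alpha>..r} f) \<le> M"
      unfolding split using norm_triangle_mono[OF 1 2] by (simp add: M_def algebra_simps)
  qed simp
  also have "\<dots> \<le> M * 9"
  proof (rule mult_left_mono)
    show "0 \<le> M" unfolding M_def using AD F0 \<delta> by (auto simp: stretch_def)
  qed (use ab in \<open>simp add: field_simps\<close>)
  finally show ?thesis using eq by (simp add: M_def F_def)
qed

text \<open>The image of a full cell consists of about stretch / 2 unit segments, each contributing
  nearly \<open>Phi p\<close>. After the constant density m * Phi p is subtracted, the running
  integrals are only errors, and integration by parts shows that weighting them with
  \<open>phase\<close> costs no more than the factor 9.\<close>

lemma step_cell_main:
  assumes g: "good p q A D" and AD: "0 \<le> A" "0 \<le> D" "D \<le> 1"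
    and \<eta>: "\<eta> = 1 \<or> \<eta> = - 1" and ab: "\<alpha> \<le> \<beta>" "\<beta> \<le> \<alpha> + 1 / 2"
    and t: "\<And>s. \<alpha> \<le> s \<Longrightarrow> s \<le> \<beta> \<Longrightarrow> tent s = \<eta> * s + b"
    and sl: "\<And>s. \<alpha> \<le> s \<Longrightarrow> s < \<beta> \<Longrightarrow> slope s = \<eta>"
  shows "norm (integral {\<alpha>..\<beta>} (line (step1 p q) (step2 p) a 0) - of_real (\<eta> * stretch) * Phi p * integral {\<alpha>..\<beta>} phase)
    \<le> (stretch / 2 * D + A + 1) * norm (Phi p) * 9"
proof -
  define m where "m = 0 + \<eta> * stretch"
  have "\<bar>0::real\<bar> \<le> 1" by simp
  note mb = slope_bounds[OF m_def this \<eta>]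
  have am: "\<bar>m\<bar> = stretch" using \<eta> by (auto simp: m_def stretch_def)
  have pq: "planar p" "planar q" using g by (auto simp: good_def)
  define c where "c = a + stretch * b"
  define \<phi> where "\<phi> = line p q (- (c / m)) (1 / m)"
  have b\<phi>: "bmeas \<phi>" unfolding \<phi>_def by (rule bmeas_line[OF pq])
  have bp: "bmeas phase" by (auto simp: bmeas_def intro: exI[of _ 1])
  define M where "M = (stretch / 2 * D + A + 1) * norm (Phi p)"
  have bf1: "bmeas (\<lambda>s. of_real m * \<phi> (c + m * s))"
    by (rule bmeas_mult_affine[OF b\<phi>])
  define f where "f = (\<lambda>s. of_real m * \<phi> (c + m * s) - of_real m * Phi p)"
  have bf: "bmeas f" unfolding f_def by (rule bmeas_diff[OF bf1 bmeas_const])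
  have eq1: "integral {\<alpha>..\<beta>} (line (step1 p q) (step2 p) a 0) = integral {\<alpha>..\<beta>} (\<lambda>s. phase s * (of_real m * \<phi> (c + m * s)))"
    unfolding \<phi>_def c_def using t sl mb(1) by (intro step_branch[OF pq ab(1)]) (auto simp: m_def)
  have "integral {\<alpha>..\<beta>} (\<lambda>s. phase s * f s)
      = integral {\<alpha>..\<beta>} (\<lambda>s. phase s * (of_real m * \<phi> (c + m * s))) - integral {\<alpha>..\<beta>} (\<lambda>s. phase s * (of_real m * Phi p))"
    unfolding f_def right_diff_distrib
    by (rule Henstock_Kurzweil_Integration.integral_diff[OF bmeas_integrable_on[OF bmeas_mult[OF bp bf1]] bmeas_integrable_on[OF bmeas_mult[OF bp bmeas_const]]])
  also have "integral {\<alpha>..\<beta>} (\<lambda>s. phase s * (of_real m * Phi p)) = of_real (\<eta> * stretch) * Phi p * integral {\<alpha>..\<beta>} phase"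
    using bmeas_integrable_on[OF bp] by (simp add: m_def algebra_simps)
  finally have eq: "integral {\<alpha>..\<beta>} (line (step1 p q) (step2 p) a 0) - of_real (\<eta> * stretch) * Phi p * integral {\<alpha>..\<beta>} phase
      = integral {\<alpha>..\<beta>} (\<lambda>s. phase s * f s)"
    by (simp add: eq1)
  have "norm (integral {\<alpha>..\<beta>} (\<lambda>s. phase s * f s)) \<le> M * (1 + 16 * (\<beta> - \<alpha>))"
  proof (rule integral_by_parts_bound[OF bf ab(1) phase_deriv continuous_phase' norm_phase'])
    fix r assume r: "\<alpha> \<le> r" "r \<le> \<beta>"
    have "integral {\<alpha>..r} f = sint \<phi> (c + m * \<alpha>) (c + m * r) - of_real ((c + m * r) - (c + m * \<alpha>)) * Phi p"
      unfolding f_def using r integral_affine[OF b\<phi> r(1) mb(1), of c]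
      by (subst Henstock_Kurzweil_Integration.integral_diff[OF bmeas_integrable_on[OF bf1] bmeas_integrable_on[OF bmeas_const]])
         (simp add: algebra_simps scaleR_conv_of_real)
    also have "norm \<dots> \<le> (\<bar>(c + m * \<alpha>) - (c + m * r)\<bar> * D + A + 1) * norm (Phi p)"
      unfolding \<phi>_def by (rule good_long_signed[OF g mb(4) AD(1,2)])
    also have "\<dots> \<le> M"
    proof -
      have "\<bar>(c + m * \<alpha>) - (c + m * r)\<bar> = \<bar>m\<bar> * \<bar>\<alpha> - r\<bar>"
        by (simp add: abs_mult[symmetric] algebra_simps)
      also have "\<dots> \<le> stretch * (1 / 2)"
        using am r ab by (intro mult_mono) (auto simp: stretch_def)
      finally show ?thesis unfolding M_def using AD
        by (intro mult_right_mono add_mono) auto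
    qed
    finally show "norm (integral {\<alpha>..r} f) \<le> M" .
  qed simp
  also have "\<dots> \<le> M * 9"
  proof (rule mult_left_mono)
    show "0 \<le> M" unfolding M_def using AD by (auto simp: stretch_def)
  qed (use ab in \<open>simp add: field_simps\<close>)
  finally show ?thesis using eq by (simp add: M_def)
qed

section \<open>Correlation of the phase with the slope\<close>

lemma sin_ge_chord:
  assumes "0 \<le> x" "x \<le> 1" shows "x \<le> sin (pi / 2 * x)"
proof -
  have "concave_on {0..pi/2} sin"
    by (rule f''_le0_imp_concave[where f' = cos and f'' = "\<lambda>x. - sin x"])
       (auto intro!: derivative_eq_intros sin_ge_zero)
  from concave_onD[OF this, of x 0 "pi / 2"] assms
  show ?thesis by (simp add: mult.commute)
qed

text \<open>The integral of \<open>slope\<close> times \<open>phase\<close> over a period. With a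
  constant phase it would be 0: the two branches of the fold run over the same range in opposite
  directions and cancel.\<close>

definition gain :: complex where
  "gain = integral {0..1/2} phase - integral {1/2..1} phase"

text \<open>The imaginary part suffices: sin (\<pi> / 2 * sin (2 \<pi> s)) has the sign of sin (2
  \<pi> s) and is at least as large in absolute value, and the integral of the absolute value of sin
  (2 \<pi> s) over a period is 2 / \<pi>.\<close>

lemma gain_lower: "1 / 2 \<le> norm gain"
proof -
  define h where "h = (\<lambda>s. Im (phase s))"
  have h: "h s = sin (pi / 2 * sin (2 * pi * s))" for s by (simp add: h_def phase_def)
  have ci: "h integrable_on {a..b}" for a b
    unfolding h by (intro integrable_continuous_interval continuous_intros)
  have pi': "phase integrable_on {a..b}" for a b
    by (intro integrable_continuous_interval continuous_phase)
  have Im: "Im (integral {a..b} phase) = integral {a..b} h" for a b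
    using integral_linear[OF pi' bounded_linear_Im, of a b] by (simp add: o_def h_def)
  define H where "H = (\<lambda>s::real. - cos (2 * pi * s) / (2 * pi))"
  have "(H has_vector_derivative sin (2 * pi * s)) (at s within S)" for s S
    unfolding H_def by (auto intro!: derivative_eq_intros simp flip: has_real_derivative_iff_has_vector_derivative)
  then have I: "((\<lambda>s. sin (2 * pi * s)) has_integral (H b - H a)) {a..b}" if "a \<le> b" for a b
    using that by (intro fundamental_theorem_of_calculus) auto
  have 1: "H (1/2) - H 0 \<le> integral {0..1/2} h"
  proof (rule has_integral_le[OF I integrable_integral[OF ci]])
    fix s :: real assume s: "s \<in> {0..1/2}"
    have "0 \<le> sin (2 * pi * s)" using s by (intro sin_ge_zero) auto
    then show "sin (2 * pi * s) \<le> h s" unfolding h by (intro sin_ge_chord) auto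
  qed simp
  have 2: "integral {1/2..1} h \<le> H 1 - H (1/2)"
  proof (rule has_integral_le[OF integrable_integral[OF ci] I])
    fix s :: real assume s: "s \<in> {1/2..1}"
    have "sin (2 * pi * s) = - sin (2 * pi * s - pi)" by simp
    moreover have "0 \<le> sin (2 * pi * s - pi)" using s by (intro sin_ge_zero) (auto simp: field_simps)
    ultimately have "0 \<le> - sin (2 * pi * s)" by linarith
    then have "- sin (2 * pi * s) \<le> sin (pi / 2 * (- sin (2 * pi * s)))" by (intro sin_ge_chord) auto
    then show "h s \<le> sin (2 * pi * s)" unfolding h by simp
  qed simp
  have "Im gain = integral {0..1/2} h - integral {1/2..1} h"
    by (simp add: gain_def Im)
  moreover have "H (1/2) = 1 / (2 * pi)" "H 0 = - 1 / (2 * pi)" "H 1 = - 1 / (2 * pi)"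
    by (simp_all add: H_def)
  moreover have "2 / pi = 1 / (2 * pi) - (- 1 / (2 * pi)) + (1 / (2 * pi) - (- 1 / (2 * pi)))"
    by (simp add: field_simps)
  ultimately have "2 / pi \<le> Im gain" using 1 2 by linarith
  moreover have "1 / 2 \<le> 2 / pi" using pi_less_4 pi_gt_zero by (simp add: field_simps)
  ultimately show ?thesis using abs_Im_le_cmod[of gain] by linarith
qed

text \<open>The horizontal circle consists of exactly two cells, one ascending and one descending.
  Their main terms carry opposite signs and add up to \<open>gain\<close>; the 18 is twice the 9 of
  a cell.\<close>

lemma step_Phi:
  assumes g: "good p q A D" and AD: "0 \<le> A" "0 \<le> D" "D \<le> 1"
  shows "norm (Phi (step1 p q) - of_real stretch * Phi p * gain) \<le> 18 * (stretch / 2 * D + A + 1) * norm (Phi p)"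
proof -
  have pq: "planar p" "planar q" using g by (auto simp: good_def)
  have bl: "bmeas (line (step1 p q) (step2 p) 0 0)"
    by (intro bmeas_line planar_step1 planar_step2 pq)
  have P: "Phi (step1 p q) = integral {0..1/2} (line (step1 p q) (step2 p) 0 0) + integral {1/2..1} (line (step1 p q) (step2 p) 0 0)"
  proof -
    have "Phi (step1 p q) = integral {0..1} (line (step1 p q) (step2 p) 0 0)"
      by (simp add: Phi_def line_def[abs_def])
    then show ?thesis
      using Henstock_Kurzweil_Integration.integral_combine[OF _ _ bmeas_integrable_on[OF bl], of 0 "1/2" 1] by simp
  qed
  have fr: "frac s = s" if "0 \<le> s" "s < 1" for s :: real using that frac_unique[of 0 s] by simp
  have t0: "tent s = 1 * s + 0" if "0 \<le> s" "s \<le> 1/2" for s using that fr[of s] by (simp add: tent_def)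
  have t1: "tent s = - 1 * s + 1" if "1/2 \<le> s" "s \<le> 1" for s
    using that fr[of s] by (cases "s = 1") (simp_all add: tent_def)
  have 1: "norm (integral {0..1/2} (line (step1 p q) (step2 p) 0 0) - of_real (1 * stretch) * Phi p * integral {0..1/2} phase)
    \<le> (stretch / 2 * D + A + 1) * norm (Phi p) * 9"
    using t0 fr by (intro step_cell_main[OF g AD]) (auto simp: slope_def)
  have 2: "norm (integral {1/2..1} (line (step1 p q) (step2 p) 0 0) - of_real (- 1 * stretch) * Phi p * integral {1/2..1} phase)
    \<le> (stretch / 2 * D + A + 1) * norm (Phi p) * 9"
    using t1 fr by (intro step_cell_main[OF g AD]) (auto simp: slope_def)
  have "Phi (step1 p q) - of_real stretch * Phi p * gain
     = (integral {0..1/2} (line (step1 p q) (step2 p) 0 0) - of_real (1 * stretch) * Phi p * integral {0..1/2} phase)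
     + (integral {1/2..1} (line (step1 p q) (step2 p) 0 0) - of_real (- 1 * stretch) * Phi p * integral {1/2..1} phase)"
    unfolding P gain_def by (simp add: algebra_simps)
  also have "norm \<dots> \<le> (stretch / 2 * D + A + 1) * norm (Phi p) * 9 + (stretch / 2 * D + A + 1) * norm (Phi p) * 9"
    by (rule norm_triangle_mono[OF 1 2])
  finally show ?thesis by (simp add: algebra_simps)
qed

lemma good_mono:
  assumes "good p q A D" "A \<le> A'" "D \<le> D'" shows "good p q A' D'"
proof -
  have le: "K * x * norm (Phi p) \<le> K' * x * norm (Phi p)" if "K \<le> K'" "0 \<le> x" for K K' x :: real
    using that by (intro mult_right_mono) auto
  show ?thesis
    unfolding good_def
  proof (intro conjI allI impI)
    show "planar p" "planar q" "Phi p \<noteq> 0" using good_planar[OF assms(1)] by auto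
    fix a e \<alpha> \<beta> :: real assume h: "\<bar>e\<bar> \<le> 1" "\<alpha> \<le> \<beta>" "\<beta> \<le> \<alpha> + 1"
    show "norm (integral {\<alpha>..\<beta>} (line p q a e)) \<le> A' * sqrt (\<beta> - \<alpha>) * norm (Phi p)"
      by (rule order_trans[OF good_line[OF assms(1) h] le[OF assms(2)]]) (use h in auto)
  next
    fix a1 e1 a2 e2 \<alpha> \<beta> \<delta> :: real
    assume h: "\<bar>e1\<bar> \<le> 1" "\<bar>e2\<bar> \<le> 1" "\<alpha> \<le> \<beta>" "\<beta> \<le> \<alpha> + 1" "0 \<le> \<delta>" "\<delta> \<le> 1"
      "\<bar>(a1 + e1 * \<alpha>) - (a2 + e2 * \<alpha>)\<bar> \<le> \<delta>" "\<bar>(a1 + e1 * \<beta>) - (a2 + e2 * \<beta>)\<bar> \<le> \<delta>"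
    show "norm (integral {\<alpha>..\<beta>} (line p q a1 e1) - integral {\<alpha>..\<beta>} (line p q a2 e2)) \<le> D' * sqrt \<delta> * norm (Phi p)"
      by (rule order_trans[OF good_lines[OF assms(1) h] le[OF assms(3)]]) (use h in auto)
  qed
qed

text \<open>A step regains the room that \<open>good_average\<close> below loses.\<close>

lemma good_step:
  assumes g: "good p q 900 (1 / 100)"
  shows "good (step1 p q) (step2 p) 450 (1 / 1000)" "stretch / 4 * norm (Phi p) \<le> norm (Phi (step1 p q))"
proof -
  have pq: "planar p" "planar q" using g by (auto simp: good_def)
  define F where "F = norm (Phi p)"
  define F' where "F' = norm (Phi (step1 p q))"
  have F0: "0 < F" using g by (simp add: F_def good_def)
  have "norm (of_real stretch * Phi p * gain) - norm (Phi (step1 p q)) \<le> norm (Phi (step1 p q) - of_real stretch * Phi p * gain)"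
    by (metis norm_minus_commute norm_triangle_ineq2)
  also have "\<dots> \<le> 18 * (stretch / 2 * (1/100) + 900 + 1) * F"
    unfolding F_def by (rule step_Phi[OF g]) auto
  finally have "stretch * F * norm gain - F' \<le> 18 * (stretch / 2 * (1/100) + 900 + 1) * F"
    by (simp add: norm_mult F_def F'_def stretch_def)
  moreover define Z where "Z = F * norm gain"
  \<comment> \<open>The coefficient is 18 * (10 ^ 10 / 200 + 901). Once the product of F with the
    norm of \<open>gain\<close> is named Z, only linear arithmetic is left.\<close>
  ultimately have "10 ^ 10 * Z - F' \<le> 900016218 * F" by (simp add: stretch_def mult.assoc)
  moreover have "F * (1 / 2) \<le> Z"
    unfolding Z_def using F0 gain_lower by (intro mult_left_mono) auto
  ultimately have FF: "stretch / 4 * F \<le> F'" using F0 by (simp add: stretch_def)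
  then show "stretch / 4 * norm (Phi p) \<le> norm (Phi (step1 p q))" unfolding F_def F'_def .
  have bl: "bmeas (line (step1 p q) (step2 p) a e)" for a e
    by (intro bmeas_line planar_step1 planar_step2 pq)
  have s1: "sqrt (stretch + 1) \<le> 2 * 10 ^ 5"
    by (rule real_le_lsqrt) (auto simp: stretch_def)
  have s2: "sqrt (\<delta> / (stretch - 1)) \<le> sqrt \<delta> / (9 * 10 ^ 4)" if "0 \<le> \<delta>" for \<delta>
  proof -
    have "9 * 10 ^ 4 \<le> sqrt (stretch - 1)" by (rule real_le_rsqrt) (auto simp: stretch_def)
    then show ?thesis unfolding real_sqrt_divide using that by (intro divide_left_mono) (auto simp: stretch_def)
  qed
  show "good (step1 p q) (step2 p) 450 (1 / 1000)"
    unfolding good_def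
  proof (intro conjI allI impI)
    show "planar (step1 p q)" "planar (step2 p)" by (intro planar_step1 planar_step2 pq)+
    show "Phi (step1 p q) \<noteq> 0" using FF F0 by (auto simp: F'_def stretch_def)
    fix a e \<alpha> \<beta> :: real assume e: "\<bar>e\<bar> \<le> 1" and ab: "\<alpha> \<le> \<beta>" "\<beta> \<le> \<alpha> + 1"
    define X where "X = (2 * ((stretch + 1) * (\<beta> - \<alpha>)) + (900 + 1) * sqrt ((stretch + 1) * (\<beta> - \<alpha>))) * F * 9"
    have "norm (integral {\<alpha>..\<beta>} (line (step1 p q) (step2 p) a e)) \<le> 3 * X"
    proof (rule three_cells[OF bl ab])
      fix \<alpha>' \<beta>' and k :: int
      assume h: "\<alpha> \<le> \<alpha>'" "\<alpha>' \<le> \<beta>'" "\<beta>' \<le> \<beta>" "of_int k / 2 \<le> \<alpha>'" "\<beta>' \<le> (of_int k + 1) / 2"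
      have "norm (integral {\<alpha>'..\<beta>'} (line (step1 p q) (step2 p) a e))
        \<le> (2 * ((stretch + 1) * (\<beta>' - \<alpha>')) + (900 + 1) * sqrt ((stretch + 1) * (\<beta>' - \<alpha>'))) * norm (Phi p) * 9"
        by (rule step_cell_bound[OF g _ _ _ e h(2,4,5)]) auto
      also have "\<dots> \<le> X"
        unfolding X_def F_def using h
        by (intro mult_right_mono add_mono mult_left_mono real_sqrt_le_mono) (auto simp: stretch_def)
      finally show "norm (integral {\<alpha>'..\<beta>'} (line (step1 p q) (step2 p) a e)) \<le> X" .
    qed
    \<comment> \<open>The 27 below is 3 cells times 9. Since \<beta> - \<alpha> is at most its
      square root w, the leading term is 54 * stretch * w; the target has 112.5 * stretch * w, and
      the part with sqrt stretch fits into the difference.\<close>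
    also have "3 * X \<le> 450 * sqrt (\<beta> - \<alpha>) * (stretch / 4 * F)"
    proof -
      define w where "w = sqrt (\<beta> - \<alpha>)"
      have w: "0 \<le> w" "w \<le> 1" "\<beta> - \<alpha> = w * w" using ab by (auto simp: w_def)
      have "\<beta> - \<alpha> \<le> w" using w mult_left_le[of w w] by simp
      then have e1: "(stretch + 1) * (\<beta> - \<alpha>) \<le> (stretch + 1) * w" by (intro mult_left_mono) (auto simp: stretch_def)
      have e2: "sqrt ((stretch + 1) * (\<beta> - \<alpha>)) \<le> 2 * 10 ^ 5 * w"
        unfolding real_sqrt_mult w_def[symmetric] using s1 w by (intro mult_right_mono) auto
      have "2 * ((stretch + 1) * (\<beta> - \<alpha>)) + (900 + 1) * sqrt ((stretch + 1) * (\<beta> - \<alpha>))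
          \<le> 2 * ((stretch + 1) * w) + (900 + 1) * (2 * 10 ^ 5 * w)"
        by (rule add_mono[OF mult_left_mono[OF e1] mult_left_mono[OF e2]]) auto
      from mult_right_mono[OF mult_right_mono[OF this less_imp_le[OF F0]], of 9]
      have "X \<le> (2 * ((stretch + 1) * w) + (900 + 1) * (2 * 10 ^ 5 * w)) * F * 9"
        unfolding X_def by simp
      then have "3 * X \<le> 3 * ((2 * ((stretch + 1) * w) + (900 + 1) * (2 * 10 ^ 5 * w)) * F * 9)"
        by (rule mult_left_mono) simp
      also have "\<dots> = 27 * (2 * (stretch + 1) + 901 * (2 * 10 ^ 5)) * (w * F)"
        by (simp add: algebra_simps)
      also have "\<dots> \<le> (450 * (stretch / 4)) * (w * F)"
        using w F0 by (intro mult_right_mono) (auto simp: stretch_def)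
      also have "\<dots> = 450 * sqrt (\<beta> - \<alpha>) * (stretch / 4 * F)"
        unfolding w_def by (simp only: mult_ac)
      finally show ?thesis .
    qed
    also have "\<dots> \<le> 450 * sqrt (\<beta> - \<alpha>) * norm (Phi (step1 p q))"
      using FF ab unfolding F'_def by (intro mult_left_mono) auto
    finally show "norm (integral {\<alpha>..\<beta>} (line (step1 p q) (step2 p) a e)) \<le> 450 * sqrt (\<beta> - \<alpha>) * norm (Phi (step1 p q))" .
  next
    fix a1 e1 a2 e2 \<alpha> \<beta> \<delta> :: real
    assume e: "\<bar>e1\<bar> \<le> 1" "\<bar>e2\<bar> \<le> 1" and ab: "\<alpha> \<le> \<beta>" "\<beta> \<le> \<alpha> + 1" and \<delta>: "0 \<le> \<delta>" "\<delta> \<le> 1"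
      and d: "\<bar>(a1 + e1 * \<alpha>) - (a2 + e2 * \<alpha>)\<bar> \<le> \<delta>" "\<bar>(a1 + e1 * \<beta>) - (a2 + e2 * \<beta>)\<bar> \<le> \<delta>"
    define l1 where "l1 = line (step1 p q) (step2 p) a1 e1"
    define l2 where "l2 = line (step1 p q) (step2 p) a2 e2"
    have b12: "bmeas l1" "bmeas l2" unfolding l1_def l2_def by (rule bl)+
    define X where "X = ((stretch + 2) * ((1/100) * sqrt (\<delta> / (stretch - 1))) + 2 * 900 * sqrt \<delta>) * F * 9"
    have id: "integral {x..y} (\<lambda>s. l1 s - l2 s) = integral {x..y} l1 - integral {x..y} l2" for x y
      by (rule Henstock_Kurzweil_Integration.integral_diff[OF bmeas_integrable_on[OF b12(1)] bmeas_integrable_on[OF b12(2)]])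
    have "norm (integral {\<alpha>..\<beta>} (\<lambda>s. l1 s - l2 s)) \<le> 3 * X"
    proof (rule three_cells[OF bmeas_diff[OF b12] ab])
      fix \<alpha>' \<beta>' and k :: int
      assume h: "\<alpha> \<le> \<alpha>'" "\<alpha>' \<le> \<beta>'" "\<beta>' \<le> \<beta>" "of_int k / 2 \<le> \<alpha>'" "\<beta>' \<le> (of_int k + 1) / 2"
      have dd: "\<bar>(a1 + e1 * s) - (a2 + e2 * s)\<bar> \<le> \<delta>" if "\<alpha> \<le> s" "s \<le> \<beta>" for s
        using convex_abs_bound[of "a1 - a2" "e1 - e2" \<alpha> \<delta> \<beta> s] d that by (simp add: algebra_simps)
      have "norm (integral {\<alpha>'..\<beta>'} l1 - integral {\<alpha>'..\<beta>'} l2) \<le> X"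
        unfolding X_def F_def l1_def l2_def
        by (rule step_cell_diff[OF g _ _ _ e h(2,4,5) \<delta>]) (use h in \<open>auto intro: dd\<close>)
      then show "norm (integral {\<alpha>'..\<beta>'} (\<lambda>s. l1 s - l2 s)) \<le> X" by (simp add: id)
    qed
    \<comment> \<open>About stretch unit pieces cost sqrt (\<delta> / stretch) each, and the ends
      cost 2 * 900 * sqrt \<delta>. Numerically this is 27 * (1112 + 1800) at most, against stretch
      / 4000 = 2500000.\<close>
    also have "3 * X \<le> 1 / 1000 * sqrt \<delta> * (stretch / 4 * F)"
    proof -
      have "(stretch + 2) * ((1/100) * sqrt (\<delta> / (stretch - 1))) \<le> (stretch + 2) * ((1/100) * (sqrt \<delta> / (9 * 10 ^ 4)))"
        by (rule mult_left_mono[OF mult_left_mono[OF s2[OF \<delta>(1)]]]) (auto simp: stretch_def)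
      from mult_right_mono[OF mult_right_mono[OF add_right_mono[OF this] less_imp_le[OF F0]], of 9]
      have "X \<le> ((stretch + 2) * ((1/100) * (sqrt \<delta> / (9 * 10 ^ 4))) + 2 * 900 * sqrt \<delta>) * F * 9"
        unfolding X_def by simp
      then have "3 * X \<le> 3 * (((stretch + 2) * ((1/100) * (sqrt \<delta> / (9 * 10 ^ 4))) + 2 * 900 * sqrt \<delta>) * F * 9)"
        by (rule mult_left_mono) simp
      also have "\<dots> = 27 * ((stretch + 2) * ((1/100) / (9 * 10 ^ 4)) + 1800) * (sqrt \<delta> * F)"
        by (simp add: field_simps)
      also have "\<dots> \<le> (1 / 1000 * (stretch / 4)) * (sqrt \<delta> * F)"
        using \<delta> F0 by (intro mult_right_mono) (auto simp: stretch_def)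
      also have "\<dots> = 1 / 1000 * sqrt \<delta> * (stretch / 4 * F)"
        by (simp only: mult_ac)
      finally show ?thesis .
    qed
    also have "\<dots> \<le> 1 / 1000 * sqrt \<delta> * norm (Phi (step1 p q))"
      using FF \<delta> unfolding F'_def by (intro mult_left_mono) auto
    finally show "norm (integral {\<alpha>..\<beta>} (line (step1 p q) (step2 p) a1 e1) - integral {\<alpha>..\<beta>} (line (step1 p q) (step2 p) a2 e2))
       \<le> 1 / 1000 * sqrt \<delta> * norm (Phi (step1 p q))"
      unfolding id unfolding l1_def l2_def .
  qed
qed

section \<open>Averages over translations\<close>

text \<open>Provides the integrability for exchanging a weighted average over M with an integral
  along a bounded interval. M is kept general: it will be Lebesgue measure with the heat kernel as
  weight, and the torus measure with weight 1.\<close>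

lemma (in sigma_finite_measure) integrable_strip:
  fixes k :: "'a \<Rightarrow> complex" and h :: "'a \<times> real \<Rightarrow> complex"
  assumes k: "integrable M k" and h: "h \<in> borel_measurable (M \<Otimes>\<^sub>M lborel)" and C: "\<And>z. norm (h z) \<le> C"
  shows "integrable (M \<Otimes>\<^sub>M lborel) (\<lambda>z. indicat_real {\<alpha>..\<beta>} (snd z) *\<^sub>R (k (fst z) * h z))"
proof (rule integrableI_bounded)
  have [measurable]: "k \<in> borel_measurable M" "h \<in> borel_measurable (M \<Otimes>\<^sub>M lborel)" using k h by auto
  show "(\<lambda>z. indicat_real {\<alpha>..\<beta>} (snd z) *\<^sub>R (k (fst z) * h z)) \<in> borel_measurable (M \<Otimes>\<^sub>M lborel)"
    by measurable
  have C0: "0 \<le> C" using C[of undefined] norm_ge_zero order_trans by blast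
  have "(\<integral>\<^sup>+z. norm (indicat_real {\<alpha>..\<beta>} (snd z) *\<^sub>R (k (fst z) * h z)) \<partial>(M \<Otimes>\<^sub>M lborel))
     \<le> (\<integral>\<^sup>+z. ennreal (norm (k (fst z))) * (ennreal C * indicator {\<alpha>..\<beta>} (snd z)) \<partial>(M \<Otimes>\<^sub>M lborel))"
  proof (rule nn_integral_mono)
    fix z
    have "norm (indicat_real {\<alpha>..\<beta>} (snd z) *\<^sub>R (k (fst z) * h z)) \<le> norm (k (fst z)) * (C * indicat_real {\<alpha>..\<beta>} (snd z))"
      using C[of z] by (auto simp: norm_mult indicator_def intro: mult_left_mono)
    then show "ennreal (norm (indicat_real {\<alpha>..\<beta>} (snd z) *\<^sub>R (k (fst z) * h z)))
       \<le> ennreal (norm (k (fst z))) * (ennreal C * indicator {\<alpha>..\<beta>} (snd z))"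
      using C0 by (simp add: ennreal_mult'[symmetric] ennreal_indicator[symmetric] del: ennreal_indicator)
  qed
  also have "\<dots> = (\<integral>\<^sup>+x. \<integral>\<^sup>+y. ennreal (norm (k x)) * (ennreal C * indicator {\<alpha>..\<beta>} y) \<partial>lborel \<partial>M)"
    by (subst lborel.nn_integral_fst[symmetric]) (auto intro!: measurable_compose[OF measurable_fst] measurable_compose[OF measurable_snd])
  also have "\<dots> = (\<integral>\<^sup>+x. ennreal (norm (k x)) * (ennreal C * emeasure lborel {\<alpha>..\<beta>}) \<partial>M)"
    by (simp add: nn_integral_cmult)
  also have "\<dots> = (\<integral>\<^sup>+x. ennreal (norm (k x)) \<partial>M) * (ennreal C * emeasure lborel {\<alpha>..\<beta>})"
    by (rule nn_integral_multc) auto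
  also have "\<dots> < \<infinity>"
    using k by (auto simp: integrable_iff_bounded emeasure_lborel_Icc_eq ennreal_mult_less_top)
  finally show "(\<integral>\<^sup>+z. norm (indicat_real {\<alpha>..\<beta>} (snd z) *\<^sub>R (k (fst z) * h z)) \<partial>(M \<Otimes>\<^sub>M lborel)) < \<infinity>" .
qed

text \<open>Convolution in the plane with the image of the complex measure of density k under (X,
  Y). Keeping M abstract allows shifts by vectors in space whose third coordinate enters only
  through the weight.\<close>

definition average :: "'a measure \<Rightarrow> ('a \<Rightarrow> complex) \<Rightarrow> ('a \<Rightarrow> real) \<Rightarrow> ('a \<Rightarrow> real)
    \<Rightarrow> (real \<Rightarrow> real \<Rightarrow> complex) \<Rightarrow> real \<Rightarrow> real \<Rightarrow> complex" where
  "average M k X Y p x y = (\<integral>\<xi>. k \<xi> * p (x - X \<xi>) (y - Y \<xi>) \<partial>M)"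

context sigma_finite_measure
begin

context
  fixes k :: "'a \<Rightarrow> complex" and X Y :: "'a \<Rightarrow> real"
  assumes k: "integrable M k" and XY[measurable]: "X \<in> borel_measurable M" "Y \<in> borel_measurable M"
begin

lemma integrable_average:
  assumes p: "planar p"
  shows "integrable M (\<lambda>\<xi>. k \<xi> * p (x - X \<xi>) (y - Y \<xi>))"
proof -
  obtain C where C: "\<And>x y. norm (p x y) \<le> C" using p by (auto simp: planar_def)
  have [measurable]: "k \<in> borel_measurable M" using k by auto
  have [measurable]: "(\<lambda>\<xi>. p (x - X \<xi>) (y - Y \<xi>)) \<in> borel_measurable M"
    by (intro planar_compose[OF p]) auto
  show ?thesis
  proof (rule Bochner_Integration.integrable_bound[of M "\<lambda>\<xi>. C * norm (k \<xi>)"])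
    show "integrable M (\<lambda>\<xi>. C * norm (k \<xi>))" using k by auto
    have "0 \<le> C" using C[of 0 0] norm_ge_zero order_trans by blast
    then show "AE x' in M. norm (k x' * p (x - X x') (y - Y x')) \<le> norm (C * norm (k x'))"
      using C by (auto simp: norm_mult mult.commute[of C] intro!: AE_I2 mult_left_mono)
  qed auto
qed

lemma planar_average:
  assumes p: "planar p" shows "planar (average M k X Y p)"
proof -
  obtain C where C: "\<And>x y. norm (p x y) \<le> C" using p by (auto simp: planar_def)
  have [measurable]: "k \<in> borel_measurable M" using k by auto
  have "(\<lambda>(z, \<xi>). k \<xi> * p (fst z - X \<xi>) (snd z - Y \<xi>)) \<in> borel_measurable ((borel \<Otimes>\<^sub>M borel) \<Otimes>\<^sub>M M)"
  proof -
    have "(\<lambda>w. p (fst (fst w) - X (snd w)) (snd (fst w) - Y (snd w))) \<in> borel_measurable ((borel \<Otimes>\<^sub>M borel) \<Otimes>\<^sub>M M)"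
      by (intro planar_compose[OF p]) measurable
    then show ?thesis by (simp add: case_prod_beta)
  qed
  then have "(\<lambda>z. average M k X Y p (fst z) (snd z)) \<in> borel_measurable borel"
    unfolding average_def borel_prod[symmetric] by (rule borel_measurable_lebesgue_integral)
  moreover have "norm (average M k X Y p x y) \<le> (\<integral>\<xi>. C * norm (k \<xi>) \<partial>M)" for x y
  proof -
    have "norm (average M k X Y p x y) \<le> (\<integral>\<xi>. norm (k \<xi> * p (x - X \<xi>) (y - Y \<xi>)) \<partial>M)"
      unfolding average_def by (rule integral_norm_bound)
    also have "\<dots> \<le> (\<integral>\<xi>. C * norm (k \<xi>) \<partial>M)"
      using integrable_norm[OF integrable_average[OF p], unfolded norm_mult] k C
      by (intro integral_mono) (auto simp: norm_mult mult.commute[of C] intro!: mult_left_mono)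
    finally show ?thesis .
  qed
  moreover have "average M k X Y p (x + 1) y = average M k X Y p x y" "average M k X Y p x (y + 1) = average M k X Y p x y" for x y
  proof -
    have "p (x + 1 - X \<xi>) z = p (x - X \<xi>) z" "p z (y + 1 - Y \<xi>) = p z (y - Y \<xi>)" for z \<xi>
      using p unfolding planar_def by (metis add.commute add_diff_eq)+
    then show "average M k X Y p (x + 1) y = average M k X Y p x y" "average M k X Y p x (y + 1) = average M k X Y p x y"
      by (simp_all add: average_def)
  qed
  ultimately show ?thesis unfolding planar_def by blast
qed

text \<open>A translate of a segment is a segment with the same slope and horizontal extent.
  Substituting s - X for the parameter turns the intercept a into a - Y + e * X; the rest is
  Fubini.\<close>

lemma integral_line_average:
  fixes a e \<alpha> \<beta> :: real
  assumes pq: "planar p" "planar q" and ab: "\<alpha> \<le> \<beta>"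
  defines "w \<equiv> \<lambda>\<xi>. integral {\<alpha> - X \<xi>..\<beta> - X \<xi>} (line p q (a - Y \<xi> + e * X \<xi>) e)"
  shows "integrable M (\<lambda>\<xi>. k \<xi> * w \<xi>)"
    "integral {\<alpha>..\<beta>} (line (average M k X Y p) (average M k X Y q) a e) = (\<integral>\<xi>. k \<xi> * w \<xi> \<partial>M)"
proof -
  obtain C C' where C: "\<And>x y. norm (p x y) \<le> C" "\<And>x y. norm (q x y) \<le> C'" using pq by (auto simp: planar_def)
  have [measurable]: "k \<in> borel_measurable M" using k by auto
  define h where "h = (\<lambda>z. p (snd z - X (fst z)) (a + e * snd z - Y (fst z)) + of_real e * q (snd z - X (fst z)) (a + e * snd z - Y (fst z)))"
  have hm: "h \<in> borel_measurable (M \<Otimes>\<^sub>M lborel)"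
    unfolding h_def by (intro borel_measurable_add borel_measurable_times planar_compose[OF pq(1)] planar_compose[OF pq(2)]) measurable
  have hb: "norm (h z) \<le> C + \<bar>e\<bar> * C'" for z
    unfolding h_def using C by (intro norm_triangle_mono) (auto simp: norm_mult intro: mult_left_mono)
  have int: "integrable (M \<Otimes>\<^sub>M lborel) (\<lambda>z. indicat_real {\<alpha>..\<beta>} (snd z) *\<^sub>R (k (fst z) * h z))"
    by (rule integrable_strip[OF k hm hb])
  have ps: "pair_sigma_finite M (lborel :: real measure)" ..
  have bl: "bmeas (line p q a e)" for a e by (rule bmeas_line[OF pq])
  have in1: "(\<integral>s. indicat_real {\<alpha>..\<beta>} s *\<^sub>R (k \<xi> * h (\<xi>, s)) \<partial>lborel) = k \<xi> * w \<xi>" for \<xi>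
  proof -
    have hs: "h (\<xi>, s) = line p q (a - Y \<xi> + e * X \<xi>) e (- X \<xi> + 1 * s)" for s
      by (simp add: h_def line_def algebra_simps)
    have bh: "bmeas (\<lambda>s. k \<xi> * h (\<xi>, s))"
      unfolding hs by (rule bmeas_mult_affine[OF bl])
    have bh1: "bmeas (\<lambda>s. h (\<xi>, s))"
      unfolding hs by (rule bmeas_affine[OF bl])
    have "(\<integral>s. indicat_real {\<alpha>..\<beta>} s *\<^sub>R (k \<xi> * h (\<xi>, s)) \<partial>lborel) = integral {\<alpha>..\<beta>} (\<lambda>s. k \<xi> * h (\<xi>, s))"
      using set_borel_integral_eq_integral(2)[OF bmeas_set_integrable[OF bh, of \<alpha> \<beta>]]
      unfolding set_lebesgue_integral_def .
    also have "\<dots> = k \<xi> * integral {\<alpha>..\<beta>} (\<lambda>s. h (\<xi>, s))"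
      by simp
    also have "integral {\<alpha>..\<beta>} (\<lambda>s. h (\<xi>, s)) = w \<xi>"
      unfolding hs w_def using integral_affine[OF bl ab, of 1 "a - Y \<xi> + e * X \<xi>" e "- X \<xi>"] ab
      by (simp add: sint_def)
    finally show ?thesis .
  qed
  show "integrable M (\<lambda>\<xi>. k \<xi> * w \<xi>)"
  proof -
    have "integrable (M \<Otimes>\<^sub>M lborel) (\<lambda>(x, y). indicat_real {\<alpha>..\<beta>} y *\<^sub>R (k x * h (x, y)))"
      using int by (simp add: case_prod_beta')
    from pair_sigma_finite.integrable_fst[OF ps this] show ?thesis unfolding in1 .
  qed
  have in2: "(\<integral>\<xi>. indicat_real {\<alpha>..\<beta>} s *\<^sub>R (k \<xi> * h (\<xi>, s)) \<partial>M)
      = indicat_real {\<alpha>..\<beta>} s *\<^sub>R line (average M k X Y p) (average M k X Y q) a e s" for s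
  proof -
    have "(\<integral>\<xi>. k \<xi> * h (\<xi>, s) \<partial>M) = line (average M k X Y p) (average M k X Y q) a e s"
    proof -
      have "(\<integral>\<xi>. k \<xi> * h (\<xi>, s) \<partial>M) = (\<integral>\<xi>. k \<xi> * p (s - X \<xi>) (a + e * s - Y \<xi>) + of_real e * (k \<xi> * q (s - X \<xi>) (a + e * s - Y \<xi>)) \<partial>M)"
        by (simp add: h_def algebra_simps)
      also have "\<dots> = (\<integral>\<xi>. k \<xi> * p (s - X \<xi>) (a + e * s - Y \<xi>) \<partial>M) + of_real e * (\<integral>\<xi>. (k \<xi> * q (s - X \<xi>) (a + e * s - Y \<xi>)) \<partial>M)"
        using integrable_average[OF pq(1)] integrable_average[OF pq(2)]
        by (subst Bochner_Integration.integral_add) auto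
      finally show ?thesis by (simp add: line_def average_def)
    qed
    then show ?thesis by simp
  qed
  have "(\<integral>s. (\<integral>\<xi>. indicat_real {\<alpha>..\<beta>} s *\<^sub>R (k \<xi> * h (\<xi>, s)) \<partial>M) \<partial>lborel) = (\<integral>\<xi>. (\<integral>s. indicat_real {\<alpha>..\<beta>} s *\<^sub>R (k \<xi> * h (\<xi>, s)) \<partial>lborel) \<partial>M)"
    using pair_sigma_finite.Fubini_integral[OF ps, of "\<lambda>x y. indicat_real {\<alpha>..\<beta>} y *\<^sub>R (k x * h (x, y))"] int
    by (simp add: case_prod_beta')
  then have "(\<integral>\<xi>. k \<xi> * w \<xi> \<partial>M) = (\<integral>s. indicat_real {\<alpha>..\<beta>} s *\<^sub>R line (average M k X Y p) (average M k X Y q) a e s \<partial>lborel)"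
    unfolding in1 in2 by simp
  also have "\<dots> = integral {\<alpha>..\<beta>} (line (average M k X Y p) (average M k X Y q) a e)"
    using set_borel_integral_eq_integral(2)[OF bmeas_set_integrable[OF bmeas_line[OF planar_average[OF pq(1)] planar_average[OF pq(2)]]]]
    by (simp add: set_lebesgue_integral_def)
  finally show "integral {\<alpha>..\<beta>} (line (average M k X Y p) (average M k X Y q) a e) = (\<integral>\<xi>. k \<xi> * w \<xi> \<partial>M)" ..
qed

lemma norm_weighted_integral:
  assumes "integrable M (\<lambda>\<xi>. k \<xi> * u \<xi>)" "\<And>\<xi>. norm (u \<xi>) \<le> B" "(\<integral>\<xi>. norm (k \<xi>) \<partial>M) \<le> 1"
  shows "norm (\<integral>\<xi>. k \<xi> * u \<xi> \<partial>M) \<le> B"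
proof -
  have B0: "0 \<le> B" using assms(2)[of undefined] norm_ge_zero order_trans by blast
  have "norm (\<integral>\<xi>. k \<xi> * u \<xi> \<partial>M) \<le> (\<integral>\<xi>. norm (k \<xi> * u \<xi>) \<partial>M)"
    by (rule integral_norm_bound)
  also have "\<dots> \<le> (\<integral>\<xi>. norm (k \<xi>) * B \<partial>M)"
    using assms integrable_norm[OF assms(1), unfolded norm_mult] k
    by (intro integral_mono) (auto simp: norm_mult intro!: mult_left_mono)
  also have "\<dots> = (\<integral>\<xi>. norm (k \<xi>) \<partial>M) * B" by simp
  also have "\<dots> \<le> 1 * B" using assms(3) B0 by (rule mult_right_mono)
  finally show ?thesis by simp
qed

text \<open>Translated segments obey the same bounds, and a weight of total variation at most 1
  preserves them as long as the old \<open>Phi p\<close> stands on the right. Replacing it by the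
  new value costs a factor 2: the translated circles differ from \<open>Phi p\<close> by 1/1000 and
  the total weight from 1 by 1/4. So 450 doubles, and 1/1000 becomes 1/500, rounded up to
  1/100.\<close>

lemma good_average:
  assumes g: "good p q 450 (1 / 1000)" and k1: "(\<integral>\<xi>. norm (k \<xi>) \<partial>M) \<le> 1" and k2: "norm ((\<integral>\<xi>. k \<xi> \<partial>M) - 1) \<le> 1 / 4"
  shows "good (average M k X Y p) (average M k X Y q) 900 (1 / 100)"
    "1 / 2 * norm (Phi p) \<le> norm (Phi (average M k X Y p))"
proof -
  have pq: "planar p" "planar q" using g by (auto simp: good_def)
  define F where "F = norm (Phi p)"
  define F' where "F' = norm (Phi (average M k X Y p))"
  have F0: "0 < F" using g by (simp add: F_def good_def)
  have FF: "1 / 2 * F \<le> F'"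
  proof -
    define w where "w = (\<lambda>\<xi>. integral {0 - X \<xi>..1 - X \<xi>} (line p q (0 - Y \<xi> + 0 * X \<xi>) 0))"
    have wi: "integrable M (\<lambda>\<xi>. k \<xi> * w \<xi>)" and we: "integral {0..1} (line (average M k X Y p) (average M k X Y q) 0 0) = (\<integral>\<xi>. k \<xi> * w \<xi> \<partial>M)"
      unfolding w_def using integral_line_average[OF pq, of 0 1 0 0] by auto
    have P: "Phi (average M k X Y p) = (\<integral>\<xi>. k \<xi> * w \<xi> \<partial>M)"
      unfolding we[symmetric] by (simp add: Phi_def line_def[abs_def])
    have wb: "norm (w \<xi> - Phi p) \<le> 1 / 1000 * F" for \<xi>
      using good_unit[OF g, of 0 "- X \<xi>" "0 - Y \<xi> + 0 * X \<xi>"] by (simp add: w_def F_def)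
    have di: "integrable M (\<lambda>\<xi>. k \<xi> * (w \<xi> - Phi p))"
      using wi k by (simp add: right_diff_distrib)
    have "(\<integral>\<xi>. k \<xi> * w \<xi> \<partial>M) - Phi p = (\<integral>\<xi>. k \<xi> * (w \<xi> - Phi p) \<partial>M) + ((\<integral>\<xi>. k \<xi> \<partial>M) - 1) * Phi p"
      using wi k by (simp add: right_diff_distrib left_diff_distrib)
    also have "norm \<dots> \<le> 1 / 1000 * F + 1 / 4 * F"
    proof (rule norm_triangle_mono)
      show "norm (\<integral>\<xi>. k \<xi> * (w \<xi> - Phi p) \<partial>M) \<le> 1 / 1000 * F"
        by (rule norm_weighted_integral[OF di wb k1])
      show "norm (((\<integral>\<xi>. k \<xi> \<partial>M) - 1) * Phi p) \<le> 1 / 4 * F"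
        unfolding norm_mult F_def by (rule mult_right_mono[OF k2]) simp
    qed
    finally have "norm (Phi (average M k X Y p) - Phi p) \<le> 1 / 1000 * F + 1 / 4 * F" by (simp add: P)
    moreover have "F - F' \<le> norm (Phi (average M k X Y p) - Phi p)"
      unfolding F_def F'_def by (metis norm_minus_commute norm_triangle_ineq2)
    ultimately show ?thesis using F0 by simp
  qed
  then show "1 / 2 * norm (Phi p) \<le> norm (Phi (average M k X Y p))" by (simp add: F_def F'_def)
  show "good (average M k X Y p) (average M k X Y q) 900 (1 / 100)"
    unfolding good_def
  proof (intro conjI allI impI)
    show "planar (average M k X Y p)" "planar (average M k X Y q)" by (intro planar_average pq)+
    show "Phi (average M k X Y p) \<noteq> 0" using FF F0 by (auto simp: F'_def)
    fix a e \<alpha> \<beta> :: real assume e: "\<bar>e\<bar> \<le> 1" and ab: "\<alpha> \<le> \<beta>" "\<beta> \<le> \<alpha> + 1"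
    have "norm (integral {\<alpha>..\<beta>} (line (average M k X Y p) (average M k X Y q) a e)) \<le> 450 * sqrt (\<beta> - \<alpha>) * F"
      unfolding integral_line_average(2)[OF pq ab(1)]
    proof (rule norm_weighted_integral[OF integral_line_average(1)[OF pq ab(1)] _ k1])
      fix \<xi>
      have "norm (integral {\<alpha> - X \<xi>..\<beta> - X \<xi>} (line p q (a - Y \<xi> + e * X \<xi>) e)) \<le> 450 * sqrt ((\<beta> - X \<xi>) - (\<alpha> - X \<xi>)) * norm (Phi p)"
        using ab by (intro good_line[OF g e]) auto
      then show "norm (integral {\<alpha> - X \<xi>..\<beta> - X \<xi>} (line p q (a - Y \<xi> + e * X \<xi>) e)) \<le> 450 * sqrt (\<beta> - \<alpha>) * F"
        by (simp add: F_def)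
    qed
    also have "\<dots> = 900 * sqrt (\<beta> - \<alpha>) * (1 / 2 * F)" by simp
    also have "\<dots> \<le> 900 * sqrt (\<beta> - \<alpha>) * norm (Phi (average M k X Y p))"
      using FF ab unfolding F'_def by (intro mult_left_mono) auto
    finally show "norm (integral {\<alpha>..\<beta>} (line (average M k X Y p) (average M k X Y q) a e)) \<le> 900 * sqrt (\<beta> - \<alpha>) * norm (Phi (average M k X Y p))" .
  next
    fix a1 e1 a2 e2 \<alpha> \<beta> \<delta> :: real
    assume e: "\<bar>e1\<bar> \<le> 1" "\<bar>e2\<bar> \<le> 1" and ab: "\<alpha> \<le> \<beta>" "\<beta> \<le> \<alpha> + 1" and \<delta>: "0 \<le> \<delta>" "\<delta> \<le> 1"
      and d: "\<bar>(a1 + e1 * \<alpha>) - (a2 + e2 * \<alpha>)\<bar> \<le> \<delta>" "\<bar>(a1 + e1 * \<beta>) - (a2 + e2 * \<beta>)\<bar> \<le> \<delta>"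
    define w where "w = (\<lambda>a e \<xi>. integral {\<alpha> - X \<xi>..\<beta> - X \<xi>} (line p q (a - Y \<xi> + e * X \<xi>) e))"
    have wi: "integrable M (\<lambda>\<xi>. k \<xi> * w a e \<xi>)" for a e
      unfolding w_def by (rule integral_line_average(1)[OF pq ab(1)])
    have di: "integrable M (\<lambda>\<xi>. k \<xi> * (w a1 e1 \<xi> - w a2 e2 \<xi>))"
      using wi by (simp add: right_diff_distrib)
    have "integral {\<alpha>..\<beta>} (line (average M k X Y p) (average M k X Y q) a1 e1) - integral {\<alpha>..\<beta>} (line (average M k X Y p) (average M k X Y q) a2 e2)
       = (\<integral>\<xi>. k \<xi> * (w a1 e1 \<xi> - w a2 e2 \<xi>) \<partial>M)"
      using wi integral_line_average(2)[OF pq ab(1), of a1 e1] integral_line_average(2)[OF pq ab(1), of a2 e2]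
      by (simp add: right_diff_distrib w_def)
    also have "norm \<dots> \<le> 1 / 1000 * sqrt \<delta> * F"
    proof (rule norm_weighted_integral[OF di _ k1])
      fix \<xi>
      show "norm (w a1 e1 \<xi> - w a2 e2 \<xi>) \<le> 1 / 1000 * sqrt \<delta> * F"
        unfolding w_def F_def using d ab
        by (intro good_lines[OF g e _ _ \<delta>]) (auto simp: algebra_simps)
    qed
    also have "\<dots> = 1 / 500 * sqrt \<delta> * (1 / 2 * F)" by simp
    also have "\<dots> \<le> 1 / 100 * sqrt \<delta> * norm (Phi (average M k X Y p))"
      using FF F0 \<delta> unfolding F'_def by (intro mult_mono mult_right_mono) auto
    finally show "norm (integral {\<alpha>..\<beta>} (line (average M k X Y p) (average M k X Y q) a1 e1) - integral {\<alpha>..\<beta>} (line (average M k X Y p) (average M k X Y q) a2 e2))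
       \<le> 1 / 100 * sqrt \<delta> * norm (Phi (average M k X Y p))" .
  qed
qed

end

end

section \<open>Integration over the torus\<close>

definition vec3 :: "real \<Rightarrow> real \<Rightarrow> real \<Rightarrow> real^3" where
  "vec3 x y z = vector [x, y, z]"

lemma vec3_nth [simp]: "vec3 x y z $ 1 = x" "vec3 x y z $ 2 = y" "vec3 x y z $ 3 = z"
  by (simp_all add: vec3_def)

lemma vec3_eq: "v = vec3 (v $ 1) (v $ 2) (v $ 3)"
  by (simp add: vec_eq_iff forall_3)

lemma continuous_vec3 [continuous_intros]:
  "continuous_on S f \<Longrightarrow> continuous_on S g \<Longrightarrow> continuous_on S h \<Longrightarrow> continuous_on S (\<lambda>x. vec3 (f x) (g x) (h x))"
proof -
  assume "continuous_on S f" "continuous_on S g" "continuous_on S h"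
  then have "continuous_on S (\<lambda>x. if i = 1 then f x else if i = 2 then g x else h x)" for i :: 3
    by (cases "i = 1"; cases "i = 2") simp_all
  then have "continuous_on S (\<lambda>x. \<chi> i::3. if i = 1 then f x else if i = 2 then g x else h x)"
    by (rule continuous_on_vec_lambda)
  moreover have "(\<lambda>x. \<chi> i::3. if i = 1 then f x else if i = 2 then g x else h x) = (\<lambda>x. vec3 (f x) (g x) (h x))"
    by (simp add: vec_eq_iff forall_3 fun_eq_iff)
  ultimately show "continuous_on S (\<lambda>x. vec3 (f x) (g x) (h x))" by (simp only:)
qed

lemma borel_vec3_triple [measurable]: "(\<lambda>(x, y, z). vec3 x y z) \<in> borel_measurable (borel \<Otimes>\<^sub>M (borel \<Otimes>\<^sub>M borel))"
proof -
  have "continuous_on UNIV (\<lambda>w::real\<times>real\<times>real. vec3 (fst w) (fst (snd w)) (snd (snd w)))"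
    by (intro continuous_intros)
  then have "(\<lambda>w::real\<times>real\<times>real. vec3 (fst w) (fst (snd w)) (snd (snd w))) \<in> borel_measurable borel"
    by (rule borel_measurable_continuous_onI)
  then show ?thesis by (simp add: borel_prod case_prod_beta)
qed

lemma borel_vec3 [measurable]:
  assumes "f \<in> borel_measurable M" "g \<in> borel_measurable M" "h \<in> borel_measurable M"
  shows "(\<lambda>x. vec3 (f x) (g x) (h x)) \<in> borel_measurable M"
proof -
  have "(\<lambda>x. (\<lambda>(x, y, z). vec3 x y z) (f x, g x, h x)) \<in> borel_measurable M"
    using assms by (intro measurable_compose[OF _ borel_vec3_triple] measurable_Pair)
  then show ?thesis by simp
qed

abbreviation lborel3 :: "(real \<times> real \<times> real) measure" where
  "lborel3 \<equiv> lborel \<Otimes>\<^sub>M (lborel \<Otimes>\<^sub>M lborel)"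

lemma sigma_finite_lborel2: "sigma_finite_measure (lborel \<Otimes>\<^sub>M lborel :: (real \<times> real) measure)"
  unfolding lborel_prod by (rule sigma_finite_lborel)

lemma measurable_vec3_lborel [measurable]: "(\<lambda>(x, y, z). vec3 x y z) \<in> measurable lborel3 borel"
  using borel_vec3_triple by (simp cong: measurable_cong_sets)

text \<open>Lebesgue measure is characterised by its values on boxes, and these are products of
  three lengths. This is the passage from vectors to iterated integrals, on which all explicit
  integration over space and torus rests.\<close>

lemma lborel_vec3: "lborel = distr lborel3 borel (\<lambda>(x, y, z). vec3 x y z)"
proof (rule lborel_eqI)
  fix l u :: "real^3"
  assume le: "\<And>b. b \<in> Basis \<Longrightarrow> l \<bullet> b \<le> u \<bullet> b"
  have le': "l $ i \<le> u $ i" for i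
    using le[of "axis i 1"] by (simp add: cart_eq_inner_axis axis_in_Basis_iff)
  have pre: "(\<lambda>(x, y, z). vec3 x y z) -` box l u \<inter> space lborel3 = {l $ 1<..<u $ 1} \<times> {l $ 2<..<u $ 2} \<times> {l $ 3<..<u $ 3}"
    by (auto simp: mem_box_cart forall_3 space_pair_measure)
  have "emeasure (distr lborel3 borel (\<lambda>(x, y, z). vec3 x y z)) (box l u)
     = emeasure lborel3 ({l $ 1<..<u $ 1} \<times> {l $ 2<..<u $ 2} \<times> {l $ 3<..<u $ 3})"
    by (subst emeasure_distr[OF measurable_vec3_lborel]) (simp_all add: pre)
  also have "\<dots> = emeasure lborel {l $ 1<..<u $ 1} * (emeasure lborel {l $ 2<..<u $ 2} * emeasure lborel {l $ 3<..<u $ 3})"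
    by (subst sigma_finite_measure.emeasure_pair_measure_Times[OF sigma_finite_lborel2])
       (simp_all add: lborel.emeasure_pair_measure_Times)
  also have "\<dots> = ennreal ((u $ 1 - l $ 1) * ((u $ 2 - l $ 2) * (u $ 3 - l $ 3)))"
    using le' by (simp add: ennreal_mult)
  also have "(u $ 1 - l $ 1) * ((u $ 2 - l $ 2) * (u $ 3 - l $ 3)) = (\<Prod>b\<in>Basis. (u - l) \<bullet> b)"
  proof -
    have ne: "cbox l u \<noteq> {}" using le' by (simp add: interval_ne_empty_cart)
    have "(\<Prod>b\<in>Basis. (u - l) \<bullet> b) = measure lborel (cbox l u)"
      using content_cbox[of l u] le by (simp add: inner_diff_left)
    also have "\<dots> = (\<Prod>i\<in>UNIV. u $ i - l $ i)"
      by (rule content_cbox_cart[OF ne])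
    also have "\<dots> = (u $ 1 - l $ 1) * ((u $ 2 - l $ 2) * (u $ 3 - l $ 3))"
      unfolding UNIV_3 by (subst prod.insert, simp, simp, subst prod.insert, simp, simp, simp)
    finally show ?thesis by (rule sym)
  qed
  finally show "emeasure (distr lborel3 borel (\<lambda>(x, y, z). vec3 x y z)) (box l u) = (\<Prod>b\<in>Basis. (u - l) \<bullet> b)" .
qed simp

lemma nn_integral_lborel_vec3:
  assumes [measurable]: "f \<in> borel_measurable borel"
  shows "(\<integral>\<^sup>+v. f v \<partial>lborel) = (\<integral>\<^sup>+x. \<integral>\<^sup>+y. \<integral>\<^sup>+z. f (vec3 x y z) \<partial>lborel \<partial>lborel \<partial>lborel)"
proof -
  have "(\<integral>\<^sup>+v. f v \<partial>lborel) = (\<integral>\<^sup>+w. f (case w of (x, y, z) \<Rightarrow> vec3 x y z) \<partial>lborel3)"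
    by (subst lborel_vec3, subst nn_integral_distr) auto
  also have "\<dots> = (\<integral>\<^sup>+x. \<integral>\<^sup>+w. f (case (x, w) of (x, y, z) \<Rightarrow> vec3 x y z) \<partial>(lborel \<Otimes>\<^sub>M lborel) \<partial>lborel)"
    by (rule sigma_finite_measure.nn_integral_fst[OF sigma_finite_lborel2, symmetric]) measurable
  also have "\<dots> = (\<integral>\<^sup>+x. \<integral>\<^sup>+y. \<integral>\<^sup>+z. f (vec3 x y z) \<partial>lborel \<partial>lborel \<partial>lborel)"
    by (intro nn_integral_cong, subst lborel.nn_integral_fst[symmetric]) (auto simp: case_prod_beta)
  finally show ?thesis .
qed

definition mk :: "real \<Rightarrow> real \<Rightarrow> real \<Rightarrow> torus3" where
  "mk x y z = proj (vec3 x y z)"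

lemma mk_cases: obtains x y z where "P = mk x y z"
  using proj_surj[of P] vec3_eq unfolding mk_def by metis

lemma mk_eq_iff: "mk x y z = mk x' y' z' \<longleftrightarrow> x - x' \<in> \<int> \<and> y - y' \<in> \<int> \<and> z - z' \<in> \<int>"
  by (simp add: mk_def proj_eq_iff forall_3)

lemma borel_proj [measurable]: "proj \<in> borel_measurable borel"
  by (rule borel_measurable_continuous_onI[OF continuous_on_proj])

lemma borel_mk [measurable]:
  assumes "f \<in> borel_measurable M" "g \<in> borel_measurable M" "h \<in> borel_measurable M"
  shows "(\<lambda>x. mk (f x) (g x) (h x)) \<in> borel_measurable M"
  unfolding mk_def by (rule measurable_compose[OF borel_vec3[OF assms] borel_proj])

lemma sets_torus_measure [simp, measurable_cong]: "sets torus_measure = sets borel"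
  by (simp add: torus_measure_def)

lemma space_torus_measure [simp]: "space torus_measure = UNIV"
  by (simp add: torus_measure_def)

text \<open>An integral over one period; three nested copies give the torus integral. The interval
  is half-open like the fundamental cube of \<open>torus_measure\<close>.\<close>

definition cube_sum :: "(real \<Rightarrow> ennreal) \<Rightarrow> ennreal" where
  "cube_sum h = (\<integral>\<^sup>+x. indicator {0..<1} x * h x \<partial>lborel)"

lemma nn_integral_torus:
  assumes [measurable]: "f \<in> borel_measurable borel"
  shows "(\<integral>\<^sup>+p. f p \<partial>torus_measure) = cube_sum (\<lambda>x. cube_sum (\<lambda>y. cube_sum (\<lambda>z. f (mk x y z))))"
proof -
  define Q where "Q = {x::real^3. \<forall>i. 0 \<le> x $ i \<and> x $ i < 1}"
  have Q[measurable]: "Q \<in> sets borel"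
  proof -
    have "Q = (\<Inter>i. {x. 0 \<le> x $ i} \<inter> {x. x $ i < 1})" by (auto simp: Q_def)
    also have "\<dots> \<in> sets borel"
      by (intro sets.finite_INT) (auto intro!: sets.Int borel_closed borel_open closed_halfspace_component_ge_cart open_halfspace_component_lt_cart)
    finally show ?thesis .
  qed
  have "(\<integral>\<^sup>+p. f p \<partial>torus_measure) = (\<integral>\<^sup>+v. f (proj v) \<partial>restrict_space lborel Q)"
    unfolding torus_measure_def Q_def[symmetric]
    by (subst nn_integral_distr) (auto intro!: measurable_restrict_space1)
  also have "\<dots> = (\<integral>\<^sup>+v. f (proj v) * indicator Q v \<partial>lborel)"
    using Q by (subst nn_integral_restrict_space) auto
  also have "\<dots> = (\<integral>\<^sup>+x. \<integral>\<^sup>+y. \<integral>\<^sup>+z. f (mk x y z) * indicator Q (vec3 x y z) \<partial>lborel \<partial>lborel \<partial>lborel)"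
    unfolding mk_def using Q by (intro nn_integral_lborel_vec3) measurable
  also have "\<dots> = (\<integral>\<^sup>+x. \<integral>\<^sup>+y. \<integral>\<^sup>+z. indicator {0..<1} x * (indicator {0..<1} y * (indicator {0..<1} z * f (mk x y z))) \<partial>lborel \<partial>lborel \<partial>lborel)"
    by (intro nn_integral_cong) (auto simp: Q_def forall_3 indicator_def)
  also have "\<dots> = cube_sum (\<lambda>x. cube_sum (\<lambda>y. cube_sum (\<lambda>z. f (mk x y z))))"
    unfolding cube_sum_def
    by (intro nn_integral_cong) (simp add: nn_integral_cmult)
  finally show ?thesis .
qed

text \<open>Periodicity reduces the shift to its fractional part \<theta>. The window from \<theta>
  to 1 + \<theta> is cut at 1, and the second piece is moved back by one period.\<close>

lemma cube_sum_shift: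
  assumes [measurable]: "h \<in> borel_measurable borel" and per: "\<And>x. h (x + 1) = h x"
  shows "cube_sum (\<lambda>x. h (x + a)) = cube_sum h"
proof -
  have tr: "(\<integral>\<^sup>+x. F x \<partial>lborel) = (\<integral>\<^sup>+x. F (x + b) \<partial>lborel)" if "F \<in> borel_measurable borel" for F :: "real \<Rightarrow> ennreal" and b
    using nn_integral_real_affine[OF that, of 1 b] by (simp add: add.commute)
  have per': "h (x + of_int k) = h x" for x k
  proof (induction k rule: int_induct[where k = 0])
    case (step1 i)
    have "h (x + of_int (i + 1)) = h ((x + of_int i) + 1)" by (simp add: add.assoc)
    then show ?case using per step1 by metis
  next
    case (step2 i)
    have "h (x + of_int (i - 1)) = h ((x + of_int (i - 1)) + 1)" using per by metis
    then show ?case using step2 by (simp add: add.assoc)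
  qed simp
  define \<theta> where "\<theta> = frac a"
  have th: "0 \<le> \<theta>" "\<theta> < 1" using frac_lt_1[of a] by (auto simp: \<theta>_def)
  have "h (x + a) = h (x + \<theta>)" for x
    using per'[of "x + \<theta>" "\<lfloor>a\<rfloor>"] by (simp add: \<theta>_def frac_def)
  then have "cube_sum (\<lambda>x. h (x + a)) = (\<integral>\<^sup>+x. indicator {0..<1} x * h (x + \<theta>) \<partial>lborel)"
    by (simp add: cube_sum_def)
  also have "\<dots> = (\<integral>\<^sup>+x. indicator {0..<1} (x - \<theta>) * h x \<partial>lborel)"
    by (subst tr[of "\<lambda>x. indicator {0..<1} (x - \<theta>) * h x" \<theta>]) auto
  also have "\<dots> = (\<integral>\<^sup>+x. indicator {\<theta>..<1} x * h x + indicator {1..<1 + \<theta>} x * h x \<partial>lborel)"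
    using th by (intro nn_integral_cong) (auto simp: indicator_def)
  also have "\<dots> = (\<integral>\<^sup>+x. indicator {\<theta>..<1} x * h x \<partial>lborel) + (\<integral>\<^sup>+x. indicator {1..<1 + \<theta>} x * h x \<partial>lborel)"
    by (intro nn_integral_add) auto
  also have "(\<integral>\<^sup>+x. indicator {1..<1 + \<theta>} x * h x \<partial>lborel) = (\<integral>\<^sup>+x. indicator {0..<\<theta>} x * h x \<partial>lborel)"
    by (subst tr[of _ 1]) (auto intro!: nn_integral_cong simp: per indicator_def)
  also have "(\<integral>\<^sup>+x. indicator {\<theta>..<1} x * h x \<partial>lborel) + (\<integral>\<^sup>+x. indicator {0..<\<theta>} x * h x \<partial>lborel)
      = (\<integral>\<^sup>+x. indicator {\<theta>..<1} x * h x + indicator {0..<\<theta>} x * h x \<partial>lborel)"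
    by (intro nn_integral_add[symmetric]) auto
  also have "\<dots> = cube_sum h"
    unfolding cube_sum_def using th by (intro nn_integral_cong) (auto simp: indicator_def)
  finally show ?thesis .
qed

lemma borel_cube_sum [measurable]:
  assumes [measurable]: "(\<lambda>(x, y). f x y) \<in> borel_measurable (M \<Otimes>\<^sub>M borel)"
  shows "(\<lambda>x. cube_sum (f x)) \<in> borel_measurable M"
proof -
  have "(\<lambda>(x, y). indicator {0..<1::real} y * f x y) \<in> borel_measurable (M \<Otimes>\<^sub>M lborel)"
    by measurable
  then show ?thesis unfolding cube_sum_def by (rule lborel.borel_measurable_nn_integral)
qed

lemma cube_sum_swap:
  assumes [measurable]: "(\<lambda>(x, y). f x y) \<in> borel_measurable (borel \<Otimes>\<^sub>M borel)"
  shows "cube_sum (\<lambda>x. cube_sum (\<lambda>y. f x y)) = cube_sum (\<lambda>y. cube_sum (\<lambda>x. f x y))"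
proof -
  have 1: "cube_sum (\<lambda>x. cube_sum (\<lambda>y. f x y)) = (\<integral>\<^sup>+x. \<integral>\<^sup>+y. indicator {0..<1} x * (indicator {0..<1} y * f x y) \<partial>lborel \<partial>lborel)"
    unfolding cube_sum_def by (intro nn_integral_cong nn_integral_cmult[symmetric]) measurable
  have 2: "cube_sum (\<lambda>y. cube_sum (\<lambda>x. f x y)) = (\<integral>\<^sup>+y. \<integral>\<^sup>+x. indicator {0..<1} y * (indicator {0..<1} x * f x y) \<partial>lborel \<partial>lborel)"
    unfolding cube_sum_def by (intro nn_integral_cong nn_integral_cmult[symmetric]) measurable
  have "(\<integral>\<^sup>+x. \<integral>\<^sup>+y. indicator {0..<1} x * (indicator {0..<1} y * f x y) \<partial>lborel \<partial>lborel)
      = (\<integral>\<^sup>+y. \<integral>\<^sup>+x. indicator {0..<1} x * (indicator {0..<1} y * f x y) \<partial>lborel \<partial>lborel)"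
    by (rule lborel_pair.Fubini'[symmetric]) measurable
  then show ?thesis unfolding 1 2 by (simp add: mult.left_commute)
qed

lemma mk_periodic [simp]: "mk (x + 1) y z = mk x y z" "mk x (y + 1) z = mk x y z" "mk x y (z + 1) = mk x y z"
  by (simp_all add: mk_eq_iff)

lemma torus_shift_mk: "torus_shift v (mk x y z) = mk (x + v $ 1) (y + v $ 2) (z + v $ 3)"
  unfolding mk_def by (simp add: torus_shift.abs_eq proj_eq_iff forall_3)

section \<open>The map\<close>

definition rho :: "real \<Rightarrow> real" where
  "rho x = sin (2 * pi * x) / 4"

lemma rho_periodic [simp]: "rho (x + 1) = rho x"
  by (simp add: rho_def distrib_left)

lemma periodic_diff:
  assumes "\<And>x. f (x + 1) = (f x :: 'a)" "x - y \<in> \<int>" shows "f x = f (y :: real)"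
proof -
  obtain k where "x - y = of_int k" using assms(2) by (auto elim: Ints_cases)
  then have "x = y + of_int k" by simp
  then show ?thesis using periodic_int[of f y k] assms(1) by simp
qed

section \<open>Lipschitz bounds for the two profiles\<close>

lemma tent_le: "tent x \<le> \<bar>x - of_int n\<bar>"
proof -
  have x: "x = of_int \<lfloor>x\<rfloor> + frac x" by (simp add: frac_def)
  have f: "0 \<le> frac x" "frac x < 1" using frac_lt_1[of x] by auto
  show ?thesis
  proof (cases "n \<le> \<lfloor>x\<rfloor>")
    case True
    then have "of_int n \<le> (of_int \<lfloor>x\<rfloor> :: real)" by simp
    then have "frac x \<le> \<bar>x - of_int n\<bar>" using x f by linarith
    then show ?thesis by (simp add: tent_def)
  next
    case False
    then have "\<lfloor>x\<rfloor> + 1 \<le> n" by simp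
    then have "of_int (\<lfloor>x\<rfloor> + 1) \<le> (of_int n :: real)" by (simp only: of_int_le_iff)
    then have "1 - frac x \<le> \<bar>x - of_int n\<bar>" using x f unfolding of_int_add by linarith
    then show ?thesis by (simp add: tent_def)
  qed
qed

lemma tent_attained: "\<exists>n. tent x = \<bar>x - of_int n\<bar>"
proof (cases "frac x \<le> 1 - frac x")
  case True
  then have "tent x = \<bar>x - of_int \<lfloor>x\<rfloor>\<bar>" by (simp add: tent_def frac_def min_def)
  then show ?thesis by blast
next
  case False
  then have "tent x = 1 - frac x" by (simp add: tent_def)
  also have "\<dots> = \<bar>x - of_int (\<lfloor>x\<rfloor> + 1)\<bar>" using frac_lt_1[of x] by (simp add: frac_def abs_if)
  finally show ?thesis by blast
qed

text \<open>\<open>tent\<close> is the distance to the nearest integer, a minimum of functions with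
  Lipschitz constant 1: the integer that is optimal for one point is a competitor for the
  other.\<close>

lemma tent_lipschitz: "\<bar>tent x - tent y\<bar> \<le> \<bar>x - y\<bar>"
proof -
  obtain n m where n: "tent x = \<bar>x - of_int n\<bar>" and m: "tent y = \<bar>y - of_int m\<bar>"
    using tent_attained by metis
  show ?thesis using tent_le[of x m] tent_le[of y n] n m by linarith
qed

lemma sin_lipschitz: "\<bar>sin x - sin y\<bar> \<le> \<bar>x - y\<bar>" for x y :: real
proof -
  have "\<bar>sin x - sin y\<bar> = 2 * (\<bar>sin ((x - y) / 2)\<bar> * \<bar>cos ((x + y) / 2)\<bar>)"
    unfolding sin_diff_sin by (simp add: abs_mult)
  also have "\<dots> \<le> 2 * (\<bar>(x - y) / 2\<bar> * 1)"
    by (intro mult_left_mono mult_mono abs_sin_x_le_abs_x) auto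
  finally show ?thesis by simp
qed

lemma rho_lipschitz: "\<bar>rho x - rho y\<bar> \<le> 2 * \<bar>x - y\<bar>"
proof -
  have "\<bar>rho x - rho y\<bar> = \<bar>sin (2 * pi * x) - sin (2 * pi * y)\<bar> / 4"
    by (simp add: rho_def flip: diff_divide_distrib)
  also have "\<dots> \<le> \<bar>2 * pi * x - 2 * pi * y\<bar> / 4"
    using sin_lipschitz by (intro divide_right_mono) auto
  also have "\<bar>2 * pi * x - 2 * pi * y\<bar> = 2 * pi * \<bar>x - y\<bar>"
    by (simp add: abs_mult flip: right_diff_distrib)
  also have "2 * pi * \<bar>x - y\<bar> / 4 \<le> 2 * 4 * \<bar>x - y\<bar> / 4"
    using pi_less_4 by (intro divide_right_mono mult_right_mono) auto
  finally show ?thesis by simp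
qed

lemma rho_bound: "\<bar>rho x\<bar> \<le> 1"
  unfolding rho_def abs_divide using abs_sin_le_one[of "2 * pi * x"] by linarith

text \<open>The parameter t scales the displacement, which is periodic for every real t, so all
  intermediate maps descend to the torus. Values from 0 to 1 give the isotopy, and - t gives the
  inverse.\<close>

lift_definition shear1 :: "real \<Rightarrow> torus3 \<Rightarrow> torus3" is
  "\<lambda>t v. vec3 (v $ 1) (v $ 2 + t * stretch * tent (v $ 1)) (v $ 3 + t * rho (v $ 1))"
proof -
  fix t and v w :: "real^3" assume "lattice_rel v w"
  then have d: "v $ 1 - w $ 1 \<in> \<int>" "v $ 2 - w $ 2 \<in> \<int>" "v $ 3 - w $ 3 \<in> \<int>" by (auto simp: lattice_rel_def)
  then have "tent (v $ 1) = tent (w $ 1)" "rho (v $ 1) = rho (w $ 1)" by (auto intro: periodic_diff)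
  then show "lattice_rel (vec3 (v $ 1) (v $ 2 + t * stretch * tent (v $ 1)) (v $ 3 + t * rho (v $ 1)))
      (vec3 (w $ 1) (w $ 2 + t * stretch * tent (w $ 1)) (w $ 3 + t * rho (w $ 1)))"
    using d by (simp add: lattice_rel_def forall_3)
qed

lift_definition shear2 :: "real \<Rightarrow> torus3 \<Rightarrow> torus3" is
  "\<lambda>t v. vec3 (v $ 1 + t * stretch * tent (v $ 2)) (v $ 2) (v $ 3 + t * rho (v $ 2))"
proof -
  fix t and v w :: "real^3" assume "lattice_rel v w"
  then have d: "v $ 1 - w $ 1 \<in> \<int>" "v $ 2 - w $ 2 \<in> \<int>" "v $ 3 - w $ 3 \<in> \<int>" by (auto simp: lattice_rel_def)
  then have "tent (v $ 2) = tent (w $ 2)" "rho (v $ 2) = rho (w $ 2)" by (auto intro: periodic_diff)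
  then show "lattice_rel (vec3 (v $ 1 + t * stretch * tent (v $ 2)) (v $ 2) (v $ 3 + t * rho (v $ 2)))
      (vec3 (w $ 1 + t * stretch * tent (w $ 2)) (w $ 2) (w $ 3 + t * rho (w $ 2)))"
    using d by (simp add: lattice_rel_def forall_3)
qed

lemma shear1_mk: "shear1 t (mk x y z) = mk x (y + t * stretch * tent x) (z + t * rho x)"
  by (simp add: mk_def shear1.abs_eq)

lemma shear2_mk: "shear2 t (mk x y z) = mk (x + t * stretch * tent y) y (z + t * rho y)"
  by (simp add: mk_def shear2.abs_eq)

lemma shear_inverse [simp]:
  "shear1 (- t) (shear1 t P) = P" "shear1 t (shear1 (- t) P) = P"
  "shear2 (- t) (shear2 t P) = P" "shear2 t (shear2 (- t) P) = P"
  by (cases P rule: mk_cases; simp add: shear1_mk shear2_mk)+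

lemma shear_0 [simp]: "shear1 0 P = P" "shear2 0 P = P"
  by (cases P rule: mk_cases; simp add: shear1_mk shear2_mk)+

lemma shear_term_bound:
  assumes "\<bar>t'\<bar> \<le> 1" "\<bar>x - x'\<bar> \<le> d"
  shows "\<bar>t * stretch * tent x - t' * stretch * tent x'\<bar> \<le> stretch * (\<bar>t - t'\<bar> + d)" "\<bar>t * rho x - t' * rho x'\<bar> \<le> \<bar>t - t'\<bar> + 2 * d"
proof -
  have d0: "0 \<le> d" using assms by linarith
  have m1: "\<bar>(t - t') * u\<bar> \<le> \<bar>t - t'\<bar> * 1" if "\<bar>u\<bar> \<le> 1" for u
    unfolding abs_mult using that by (rule mult_left_mono) simp
  have m2: "\<bar>t' * u\<bar> \<le> 1 * e" if "\<bar>u\<bar> \<le> e" for u e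
    unfolding abs_mult using that assms(1) by (intro mult_mono) auto
  have A: "\<bar>(t - t') * tent x\<bar> \<le> \<bar>t - t'\<bar> * 1"
    using tent_bound[of x] by (intro m1) linarith
  have B: "\<bar>t' * (tent x - tent x')\<bar> \<le> 1 * d"
    using tent_lipschitz[of x x'] assms by (intro m2) linarith
  have "\<bar>(t - t') * tent x + t' * (tent x - tent x')\<bar> \<le> \<bar>t - t'\<bar> + d"
    using order_trans[OF abs_triangle_ineq add_mono[OF A B]] by simp
  then have A2: "stretch * \<bar>(t - t') * tent x + t' * (tent x - tent x')\<bar> \<le> stretch * (\<bar>t - t'\<bar> + d)"
    by (rule mult_left_mono) (simp add: stretch_def)
  have B2: "t * stretch * tent x - t' * stretch * tent x' = stretch * ((t - t') * tent x + t' * (tent x - tent x'))"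
    by (simp add: algebra_simps)
  have "\<bar>stretch\<bar> = stretch" by (simp add: stretch_def)
  with A2 show "\<bar>t * stretch * tent x - t' * stretch * tent x'\<bar> \<le> stretch * (\<bar>t - t'\<bar> + d)"
    unfolding B2 abs_mult[of stretch] by simp
  have E: "t * rho x - t' * rho x' = (t - t') * rho x + t' * (rho x - rho x')" by (simp add: algebra_simps)
  have A': "\<bar>(t - t') * rho x\<bar> \<le> \<bar>t - t'\<bar> * 1"
    by (rule m1[OF rho_bound])
  have B': "\<bar>t' * (rho x - rho x')\<bar> \<le> 1 * (2 * d)"
    using order_trans[OF rho_lipschitz[of x x'], of "2 * d"] assms(2) by (intro m2) simp
  show "\<bar>t * rho x - t' * rho x'\<bar> \<le> \<bar>t - t'\<bar> + 2 * d"
    unfolding E using order_trans[OF abs_triangle_ineq add_mono[OF A' B']] by simp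
qed

lemma norm_real3: "norm v \<le> \<bar>v $ 1\<bar> + \<bar>v $ 2\<bar> + \<bar>v $ 3\<bar>" for v :: "real^3"
  using norm_le_l1_cart[of v] by (simp add: sum_3)

text \<open>Stated jointly in t and the point, so that it yields both the Lipschitz constant of the
  map and the continuity of the isotopy. The lifts are chosen so that their distance is the distance
  on the torus.\<close>

lemma shear_lipschitz:
  assumes "\<bar>t'\<bar> \<le> 1"
  shows "dist (shear1 t P) (shear1 t' P') \<le> 10 * stretch * (\<bar>t - t'\<bar> + dist P P')"
    "dist (shear2 t P) (shear2 t' P') \<le> 10 * stretch * (\<bar>t - t'\<bar> + dist P P')"
proof -
  obtain v w0 where v: "P = proj v" and w0: "P' = proj w0" using proj_surj by metis
  obtain w where w: "P' = proj w" "dist P P' = dist v w"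
    using dist_torus3_attained[of w0 v] v w0 by metis
  define d where "d = dist P P'"
  have d0: "0 \<le> d" by (simp add: d_def)
  have c: "\<bar>v $ i - w $ i\<bar> \<le> d" for i
    using component_le_norm_cart[of "v - w" i] w by (simp add: d_def dist_norm)
  have tt: "0 \<le> \<bar>t - t'\<bar>" by simp
  have fin: "d + (d + stretch * (\<bar>t - t'\<bar> + d)) + (d + (\<bar>t - t'\<bar> + 2 * d)) \<le> 10 * stretch * (\<bar>t - t'\<bar> + d)"
    using d0 tt by (simp add: stretch_def)
  have "dist (shear1 t P) (shear1 t' P') \<le> dist (vec3 (v $ 1) (v $ 2 + t * stretch * tent (v $ 1)) (v $ 3 + t * rho (v $ 1)))
      (vec3 (w $ 1) (w $ 2 + t' * stretch * tent (w $ 1)) (w $ 3 + t' * rho (w $ 1)))"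
    unfolding v w(1) shear1.abs_eq by (rule dist_torus3_le)
  also have "\<dots> \<le> \<bar>v $ 1 - w $ 1\<bar> + \<bar>(v $ 2 - w $ 2) + (t * stretch * tent (v $ 1) - t' * stretch * tent (w $ 1))\<bar>
      + \<bar>(v $ 3 - w $ 3) + (t * rho (v $ 1) - t' * rho (w $ 1))\<bar>"
    unfolding dist_norm by (rule order_trans[OF norm_real3]) (simp add: algebra_simps)
  also have "\<dots> \<le> d + (d + stretch * (\<bar>t - t'\<bar> + d)) + (d + (\<bar>t - t'\<bar> + 2 * d))"
    using c shear_term_bound[OF assms c]
    by (intro add_mono order_trans[OF abs_triangle_ineq]) auto
  also note fin
  finally show "dist (shear1 t P) (shear1 t' P') \<le> 10 * stretch * (\<bar>t - t'\<bar> + dist P P')" by (simp add: d_def)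
  have "dist (shear2 t P) (shear2 t' P') \<le> dist (vec3 (v $ 1 + t * stretch * tent (v $ 2)) (v $ 2) (v $ 3 + t * rho (v $ 2)))
      (vec3 (w $ 1 + t' * stretch * tent (w $ 2)) (w $ 2) (w $ 3 + t' * rho (w $ 2)))"
    unfolding v w(1) shear2.abs_eq by (rule dist_torus3_le)
  also have "\<dots> \<le> \<bar>(v $ 1 - w $ 1) + (t * stretch * tent (v $ 2) - t' * stretch * tent (w $ 2))\<bar> + \<bar>v $ 2 - w $ 2\<bar>
      + \<bar>(v $ 3 - w $ 3) + (t * rho (v $ 2) - t' * rho (w $ 2))\<bar>"
    unfolding dist_norm by (rule order_trans[OF norm_real3]) (simp add: algebra_simps)
  also have "\<dots> \<le> (d + stretch * (\<bar>t - t'\<bar> + d)) + d + (d + (\<bar>t - t'\<bar> + 2 * d))"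
    using c shear_term_bound[OF assms c]
    by (intro add_mono order_trans[OF abs_triangle_ineq]) auto
  also have "\<dots> = d + (d + stretch * (\<bar>t - t'\<bar> + d)) + (d + (\<bar>t - t'\<bar> + 2 * d))" by simp
  also note fin
  finally show "dist (shear2 t P) (shear2 t' P') \<le> 10 * stretch * (\<bar>t - t'\<bar> + dist P P')" by (simp add: d_def)
qed

lemma continuous_shears:
  fixes f :: "'a::metric_space \<Rightarrow> torus3"
  assumes f: "continuous_on S f" "continuous_on S t" and t: "\<And>x. x \<in> S \<Longrightarrow> \<bar>t x\<bar> \<le> 1"
  shows "continuous_on S (\<lambda>x. shear1 (t x) (f x))" "continuous_on S (\<lambda>x. shear2 (t x) (f x))"
proof -
  have *: "continuous_on S g"
    if g: "\<And>x y. x \<in> S \<Longrightarrow> y \<in> S \<Longrightarrow> dist (g y) (g x) \<le> 10 * stretch * (\<bar>t y - t x\<bar> + dist (f y) (f x))" for g :: "_ \<Rightarrow> torus3"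
    unfolding continuous_on_iff
  proof (intro ballI allI impI)
    fix x and e :: real assume x: "x \<in> S" and e: "0 < e"
    define e' where "e' = e / (20 * stretch)"
    have e': "0 < e'" using e by (simp add: e'_def stretch_def)
    obtain d1 where d1: "0 < d1" "\<And>y. y \<in> S \<Longrightarrow> dist y x < d1 \<Longrightarrow> dist (f y) (f x) < e'"
      using f(1) x e' unfolding continuous_on_iff by metis
    obtain d2 where d2: "0 < d2" "\<And>y. y \<in> S \<Longrightarrow> dist y x < d2 \<Longrightarrow> dist (t y) (t x) < e'"
      using f(2) x e' unfolding continuous_on_iff by metis
    have "dist (g y) (g x) < e" if "y \<in> S" "dist y x < min d1 d2" for y
    proof -
      have "dist (g y) (g x) \<le> 10 * stretch * (\<bar>t y - t x\<bar> + dist (f y) (f x))" by (rule g[OF x that(1)])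
      also have "\<dots> < 10 * stretch * (e' + e')"
        using d1(2)[of y] d2(2)[of y] that by (intro mult_strict_left_mono add_strict_mono) (auto simp: dist_real_def stretch_def)
      also have "\<dots> = e" by (simp add: e'_def stretch_def)
      finally show ?thesis .
    qed
    then show "\<exists>d>0. \<forall>y\<in>S. dist y x < d \<longrightarrow> dist (g y) (g x) < e"
      using d1(1) d2(1) by (intro exI[of _ "min d1 d2"]) auto
  qed
  show "continuous_on S (\<lambda>x. shear1 (t x) (f x))" "continuous_on S (\<lambda>x. shear2 (t x) (f x))"
    by (intro * shear_lipschitz t; assumption)+
qed

section \<open>The map, its inverse and the isotopy\<close>

definition dynamo_map :: "torus3 \<Rightarrow> torus3" where
  "dynamo_map P = shear2 1 (shear1 1 P)"

definition dynamo_inv :: "torus3 \<Rightarrow> torus3" where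
  "dynamo_inv P = shear1 (- 1) (shear2 (- 1) P)"

lemma dynamo_inverse [simp]: "dynamo_inv (dynamo_map P) = P" "dynamo_map (dynamo_inv P) = P"
  using shear_inverse(1)[of 1] shear_inverse(2)[of 1] shear_inverse(3)[of 1] shear_inverse(4)[of 1]
  by (simp_all add: dynamo_map_def dynamo_inv_def)

lemma bij_dynamo: "bij dynamo_map"
  by (rule o_bij[of dynamo_inv]) (auto simp: fun_eq_iff)

lemma inv_dynamo: "inv dynamo_map = dynamo_inv"
  by (rule inv_unique_comp) (auto simp: fun_eq_iff)

lemma lipschitz_dynamo: "\<exists>C. C-lipschitz_on UNIV dynamo_map"
proof -
  have "dist (dynamo_map P) (dynamo_map Q) \<le> (10 * stretch) * ((10 * stretch) * dist P Q)" for P Q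
  proof -
    have "dist (dynamo_map P) (dynamo_map Q) \<le> 10 * stretch * (\<bar>1 - 1\<bar> + dist (shear1 1 P) (shear1 1 Q))"
      unfolding dynamo_map_def by (rule shear_lipschitz) simp
    also have "\<dots> \<le> 10 * stretch * (10 * stretch * (\<bar>1 - 1\<bar> + dist P Q))"
      using shear_lipschitz(1)[of 1 1 P Q] by (intro mult_left_mono) (auto simp: stretch_def)
    finally show ?thesis by simp
  qed
  then show ?thesis
    by (intro exI[of _ "(10 * stretch) * (10 * stretch)"] lipschitz_onI) (auto simp: mult.assoc stretch_def)
qed

text \<open>Both shears are switched on simultaneously, and at each time the explicit inverse, with
  - t in reverse order, is continuous as well.\<close>

lemma isotopic_dynamo: "isotopic_to_id dynamo_map"
proof -
  define h where "h = (\<lambda>(t, P). shear2 t (shear1 t P))"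
  have "continuous_on ({0..1} \<times> UNIV) (\<lambda>z. shear2 (fst z) (shear1 (fst z) (snd z)))"
    by (intro continuous_shears continuous_intros) auto
  then have ch: "continuous_on ({0..1} \<times> UNIV) h" by (simp add: h_def case_prod_beta')
  have "prod_topology (top_of_set {0..1::real}) (euclidean :: torus3 topology) = top_of_set ({0..1} \<times> UNIV)"
    using prod_topology_subtopology_eu[of "{0..1::real}" "UNIV :: torus3 set"] by simp
  then have c: "continuous_map (prod_topology (top_of_set {0..1::real}) euclidean) euclidean h"
    using ch by simp
  have hom: "homeomorphic_map euclidean euclidean (\<lambda>P. h (t, P))" if t: "t \<in> {0..1}" for t
  proof -
    have "homeomorphic_maps euclidean euclidean (\<lambda>P. h (t, P)) (\<lambda>P. shear1 (- t) (shear2 (- t) P))"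
    proof -
      have "continuous_on UNIV (\<lambda>P. shear2 t (shear1 t P))" "continuous_on UNIV (\<lambda>P. shear1 (- t) (shear2 (- t) P))"
        using t by (intro continuous_shears continuous_intros; simp)+
      then show ?thesis
        unfolding homeomorphic_maps_def h_def using shear_inverse[of t] shear_inverse[of "- t"] by simp
    qed
    then show ?thesis by (rule homeomorphic_maps_imp_map)
  qed
  show ?thesis
    unfolding isotopic_to_id_def homotopic_with_def
    by (intro exI[of _ h] conjI ballI c hom) (auto simp: h_def dynamo_map_def)
qed

section \<open>Invariance of the torus measure\<close>

lemma borel_shears [measurable]:
  assumes "\<bar>t\<bar> \<le> 1"
  shows "shear1 t \<in> borel_measurable borel" "shear2 t \<in> borel_measurable borel"
  using assms by (auto intro!: borel_measurable_continuous_onI continuous_shears continuous_intros)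

lemma nn_integral_shear1:
  assumes f[measurable]: "f \<in> borel_measurable borel" and t: "\<bar>t\<bar> \<le> 1"
  shows "(\<integral>\<^sup>+p. f (shear1 t p) \<partial>torus_measure) = (\<integral>\<^sup>+p. f p \<partial>torus_measure)"
proof -
  have m: "(\<lambda>p. f (shear1 t p)) \<in> borel_measurable borel"
    using borel_shears(1)[OF t] f by (rule measurable_compose)
  have "cube_sum (\<lambda>y. cube_sum (\<lambda>z. f (mk x (y + t * stretch * tent x) (z + t * rho x)))) = cube_sum (\<lambda>y. cube_sum (\<lambda>z. f (mk x y z)))" for x
  proof -
    have "cube_sum (\<lambda>z. f (mk x y (z + t * rho x))) = cube_sum (\<lambda>z. f (mk x y z))" for y
      by (rule cube_sum_shift) auto
    moreover have "cube_sum (\<lambda>y. cube_sum (\<lambda>z. f (mk x (y + t * stretch * tent x) z))) = cube_sum (\<lambda>y. cube_sum (\<lambda>z. f (mk x y z)))"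
      by (rule cube_sum_shift) auto
    ultimately show ?thesis by simp
  qed
  then show ?thesis unfolding nn_integral_torus[OF m] nn_integral_torus[OF f] shear1_mk by simp
qed

text \<open>The displacement of x depends on y, so x has to be integrated inside y: the two
  integrals are exchanged, the inner one is shifted, and they are exchanged back.\<close>

lemma nn_integral_shear2:
  assumes f[measurable]: "f \<in> borel_measurable borel" and t: "\<bar>t\<bar> \<le> 1"
  shows "(\<integral>\<^sup>+p. f (shear2 t p) \<partial>torus_measure) = (\<integral>\<^sup>+p. f p \<partial>torus_measure)"
proof -
  have m: "(\<lambda>p. f (shear2 t p)) \<in> borel_measurable borel"
    using borel_shears(2)[OF t] f by (rule measurable_compose)
  have z: "cube_sum (\<lambda>z. f (mk x y (z + t * rho y'))) = cube_sum (\<lambda>z. f (mk x y z))" for x y y'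
    by (rule cube_sum_shift) auto
  have x: "cube_sum (\<lambda>x. cube_sum (\<lambda>z. f (mk (x + t * stretch * tent y) y z))) = cube_sum (\<lambda>x. cube_sum (\<lambda>z. f (mk x y z)))" for y
    by (rule cube_sum_shift) auto
  have "cube_sum (\<lambda>x. cube_sum (\<lambda>y. cube_sum (\<lambda>z. f (mk (x + t * stretch * tent y) y z))))
      = cube_sum (\<lambda>y. cube_sum (\<lambda>x. cube_sum (\<lambda>z. f (mk (x + t * stretch * tent y) y z))))"
    by (rule cube_sum_swap) measurable
  also have "\<dots> = cube_sum (\<lambda>x. cube_sum (\<lambda>y. cube_sum (\<lambda>z. f (mk x y z))))"
    unfolding x by (rule cube_sum_swap) measurable
  finally show ?thesis unfolding nn_integral_torus[OF m] nn_integral_torus[OF f] shear2_mk z .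
qed

lemma borel_dynamo [measurable]: "dynamo_map \<in> borel_measurable borel" "dynamo_inv \<in> borel_measurable borel"
proof -
  have "(\<lambda>P. shear2 1 (shear1 1 P)) \<in> borel_measurable borel"
    by (rule measurable_compose[of _ borel borel]) (auto intro: borel_shears)
  then show "dynamo_map \<in> borel_measurable borel" by (simp add: dynamo_map_def[abs_def])
  have "(\<lambda>P. shear1 (-1) (shear2 (-1) P)) \<in> borel_measurable borel"
    by (rule measurable_compose[of _ borel borel]) (auto intro: borel_shears)
  then show "dynamo_inv \<in> borel_measurable borel" by (simp add: dynamo_inv_def[abs_def])
qed

lemma nn_integral_dynamo:
  assumes f: "f \<in> borel_measurable borel"
  shows "(\<integral>\<^sup>+p. f (dynamo_map p) \<partial>torus_measure) = (\<integral>\<^sup>+p. f p \<partial>torus_measure)"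
  unfolding dynamo_map_def
  using nn_integral_shear1[OF measurable_compose[OF borel_shears(2)[of 1] f], of 1] nn_integral_shear2[OF f, of 1] by simp

lemma nn_integral_torus_shift:
  assumes f[measurable]: "f \<in> borel_measurable borel"
  shows "(\<integral>\<^sup>+p. f (torus_shift v p) \<partial>torus_measure) = (\<integral>\<^sup>+p. f p \<partial>torus_measure)"
proof -
  have "dist (torus_shift v P) (torus_shift v Q) \<le> dist P Q" for P Q
  proof -
    obtain x y0 where x: "P = proj x" and y0: "Q = proj y0" using proj_surj by metis
    obtain y where y: "Q = proj y" "dist P Q = dist x y"
      using dist_torus3_attained[of y0 x] x y0 by metis
    show ?thesis using dist_torus3_le[of "x + v" "y + v"] y(2) unfolding x y(1) torus_shift.abs_eq by simp
  qed
  then have "continuous_on UNIV (torus_shift v)"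
    unfolding continuous_on_iff by (meson le_less_trans)
  then have "torus_shift v \<in> borel_measurable borel" by (rule borel_measurable_continuous_onI)
  then have m: "(\<lambda>p. f (torus_shift v p)) \<in> borel_measurable borel"
    using f by (rule measurable_compose)
  have "cube_sum (\<lambda>z. f (mk x y (z + c))) = cube_sum (\<lambda>z. f (mk x y z))" for x y c
    by (rule cube_sum_shift) auto
  moreover have "cube_sum (\<lambda>y. cube_sum (\<lambda>z. f (mk x (y + c) z))) = cube_sum (\<lambda>y. cube_sum (\<lambda>z. f (mk x y z)))" for x c
    by (rule cube_sum_shift) auto
  moreover have "cube_sum (\<lambda>x. cube_sum (\<lambda>y. cube_sum (\<lambda>z. f (mk (x + c) y z)))) = cube_sum (\<lambda>x. cube_sum (\<lambda>y. cube_sum (\<lambda>z. f (mk x y z))))" for c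
    by (rule cube_sum_shift) auto
  ultimately show ?thesis unfolding nn_integral_torus[OF m] nn_integral_torus[OF f] torus_shift_mk by simp
qed

lemma distr_torus:
  assumes g: "g \<in> borel_measurable borel"
    and inv: "\<And>f. f \<in> borel_measurable borel \<Longrightarrow> (\<integral>\<^sup>+p. f (g p) \<partial>torus_measure) = (\<integral>\<^sup>+p. f p \<partial>torus_measure)"
  shows "g \<in> measurable torus_measure torus_measure" "distr torus_measure torus_measure g = torus_measure"
proof -
  show m: "g \<in> measurable torus_measure torus_measure"
    using g by (simp cong: measurable_cong_sets)
  show "distr torus_measure torus_measure g = torus_measure"
  proof (rule measure_eqI)
    fix A assume "A \<in> sets (distr torus_measure torus_measure g)"
    then have A: "A \<in> sets borel" by simp
    have "emeasure (distr torus_measure torus_measure g) A = (\<integral>\<^sup>+p. indicator A p \<partial>distr torus_measure torus_measure g)"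
      using A by simp
    also have "\<dots> = (\<integral>\<^sup>+p. indicator A (g p) \<partial>torus_measure)"
      using A by (intro nn_integral_distr m) (simp cong: measurable_cong_sets)
    also have "\<dots> = (\<integral>\<^sup>+p. indicator A p \<partial>torus_measure)"
      using A by (intro inv) simp
    finally show "emeasure (distr torus_measure torus_measure g) A = emeasure torus_measure A"
      using A by simp
  qed simp
qed

lemma measure_preserving_dynamo: "torus_measure_preserving dynamo_map"
  unfolding torus_measure_preserving_def
  using distr_torus[OF borel_dynamo(1) nn_integral_dynamo] by blast

section \<open>The Jacobian matrix\<close>

definition drho :: "real \<Rightarrow> real" where
  "drho x = pi / 2 * cos (2 * pi * x)"

lemma rho_deriv: "(rho has_real_derivative drho x) (at x)"
  unfolding rho_def[abs_def] drho_def by (auto intro!: derivative_eq_intros)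

lemma sin_frac: "sin (2 * pi * x) = sin (2 * pi * frac x)" "cos (2 * pi * x) = cos (2 * pi * frac x)"
proof -
  have "2 * pi * x = 2 * pi * frac x + 2 * pi * of_int \<lfloor>x\<rfloor>"
    by (simp add: frac_def algebra_simps)
  then show "sin (2 * pi * x) = sin (2 * pi * frac x)" "cos (2 * pi * x) = cos (2 * pi * frac x)"
    by (simp_all add: sin_add cos_add sin_integer_2pi cos_integer_2pi)
qed

text \<open>Sine and cosine descend to continuous functions on the torus, so this form of the slope
  gives a Borel function there. At the creases the sine is 0, and the cosine separates integers,
  with slope 1, from half-integers, with slope - 1.\<close>

lemma slope_sin_cos: "slope x = (if sin (2 * pi * x) > 0 \<or> (sin (2 * pi * x) = 0 \<and> cos (2 * pi * x) = 1) then 1 else - 1)"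
proof -
  define f where "f = frac x"
  have f: "0 \<le> f" "f < 1" using frac_lt_1[of x] by (auto simp: f_def)
  have half: "2 * pi * f = pi" if "f = 1 / 2" using that by simp
  consider "f = 0" | "0 < f" "f < 1 / 2" | "f = 1 / 2" | "1 / 2 < f" using f by linarith
  then show ?thesis
  proof cases
    case 2
    then have "0 < sin (2 * pi * f)" by (intro sin_gt_zero) auto
    then show ?thesis using 2 unfolding sin_frac[of x] f_def[symmetric] slope_def by simp
  next
    case 3
    then show ?thesis unfolding sin_frac[of x] f_def[symmetric] slope_def half[OF 3] by simp
  next
    case 4
    then have "sin (2 * pi * f) < 0" using f by (intro sin_lt_zero) auto
    then show ?thesis using 4 unfolding sin_frac[of x] f_def[symmetric] slope_def by simp
  qed (unfold sin_frac[of x] f_def[symmetric] slope_def, simp_all)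
qed

lemma sin_zero_half_int: "sin (2 * pi * x) = 0 \<longleftrightarrow> (\<exists>k::int. x = k / 2)"
  unfolding sin_zero_iff_int2 by (auto simp: field_simps)

lemma tent_deriv:
  assumes "sin (2 * pi * x) \<noteq> 0"
  shows "(tent has_real_derivative slope x) (at x)"
proof -
  define k where "k = \<lfloor>2 * x\<rfloor>"
  obtain \<eta> b where c: "\<And>s. k / 2 \<le> s \<Longrightarrow> s \<le> (k + 1) / 2 \<Longrightarrow> tent s = \<eta> * s + b"
    "\<And>s. k / 2 \<le> s \<Longrightarrow> s < (k + 1) / 2 \<Longrightarrow> slope s = \<eta>"
    using tent_cell[of k] by metis
  have "x \<noteq> k / 2" using assms sin_zero_half_int by blast
  moreover have "k / 2 \<le> x" "x < (k + 1) / 2"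
    using of_int_floor_le[of "2 * x"] floor_correct[of "2 * x"] unfolding k_def by (simp_all add: field_simps)
  ultimately have x: "k / 2 < x" "x < (k + 1) / 2" by auto
  have "((\<lambda>s. \<eta> * s + b) has_real_derivative \<eta>) (at x)"
    by (auto intro!: derivative_eq_intros)
  then have "(tent has_real_derivative \<eta>) (at x)"
    by (rule has_field_derivative_transform_within_open[of _ _ _ "{k / 2<..<(k + 1) / 2}"]) (use x c in auto)
  then show ?thesis using c(2)[of x] x by simp
qed

text \<open>The one-sided derivatives at k / 2 are the slopes of the adjacent cells, which have
  opposite signs by the parity of k. This is the source of the exact value of
  \<open>torus_jacobian\<close> on the creases.\<close>

lemma tent_not_deriv:
  assumes "sin (2 * pi * x) = 0" "(tent has_real_derivative D) (at x)"
  shows False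
proof -
  obtain k :: int where x: "x = k / 2" using assms(1) sin_zero_half_int by blast
  have q: "((\<lambda>h. (tent (x + h) - tent x) / h) \<longlongrightarrow> D) (at 0)"
    using assms(2) by (simp add: DERIV_def)
  obtain \<eta> b where c: "\<And>s. k / 2 \<le> s \<Longrightarrow> s \<le> (k + 1) / 2 \<Longrightarrow> tent s = \<eta> * s + b"
    "\<And>s. k / 2 \<le> s \<Longrightarrow> s < (k + 1) / 2 \<Longrightarrow> slope s = \<eta>"
    using tent_cell[of k] by metis
  obtain \<eta>' b' where c': "\<And>s. (k - 1) / 2 \<le> s \<Longrightarrow> s \<le> k / 2 \<Longrightarrow> tent s = \<eta>' * s + b'"
    "\<And>s. (k - 1) / 2 \<le> s \<Longrightarrow> s < k / 2 \<Longrightarrow> slope s = \<eta>'"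
    using tent_cell[of "k - 1"] by (metis diff_add_cancel)
  have "D = \<eta>"
  proof (rule tendsto_unique)
    show "at_right (0::real) \<noteq> bot" by simp
    show "((\<lambda>h. (tent (x + h) - tent x) / h) \<longlongrightarrow> D) (at_right 0)"
      by (rule tendsto_mono[OF at_le q]) simp
    have "(tent (x + h) - tent x) / h = \<eta>" if "0 < h" "h < 1 / 2" for h
      using c(1)[of x] c(1)[of "x + h"] that by (simp add: x field_simps)
    then have "\<forall>\<^sub>F h in at_right 0. (tent (x + h) - tent x) / h = \<eta>"
      unfolding eventually_at_right[OF zero_less_one] by (intro exI[of _ "1 / 2"]) auto
    then show "((\<lambda>h. (tent (x + h) - tent x) / h) \<longlongrightarrow> \<eta>) (at_right 0)"
      by (rule tendsto_eventually)
  qed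
  moreover have "D = \<eta>'"
  proof (rule tendsto_unique)
    show "at_left (0::real) \<noteq> bot" by simp
    show "((\<lambda>h. (tent (x + h) - tent x) / h) \<longlongrightarrow> D) (at_left 0)"
      by (rule tendsto_mono[OF at_le q]) simp
    have "(tent (x + h) - tent x) / h = \<eta>'" if "h < 0" "- 1 / 2 < h" for h
      using c'(1)[of x] c'(1)[of "x + h"] that by (simp add: x field_simps)
    then have "\<forall>\<^sub>F h in at_left 0. (tent (x + h) - tent x) / h = \<eta>'"
      unfolding eventually_at_left[of "-1" "0::real", simplified] by (intro exI[of _ "- 1 / 2"]) auto
    then show "((\<lambda>h. (tent (x + h) - tent x) / h) \<longlongrightarrow> \<eta>') (at_left 0)"
      by (rule tendsto_eventually)
  qed
  moreover have "\<eta> = (if even k then 1 else - 1)" "\<eta>' = (if even (k - 1) then 1 else - 1)"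
  proof -
    have *: "slope (of_int j / 2) = (if even j then 1 else - 1)" for j :: int
    proof (cases "even j")
      case True
      then obtain i where "j = 2 * i" by blast
      then show ?thesis by (simp add: slope_def)
    next
      case False
      then obtain i where j: "j = 2 * i + 1" by (metis oddE)
      then have "frac (of_int j / 2 :: real) = 1 / 2"
        using frac_unique[of i "of_int j / 2"] by (simp add: field_simps)
      then show ?thesis using False by (simp add: slope_def)
    qed
    show "\<eta> = (if even k then 1 else - 1)" using *[of k] c(2)[of "k / 2"] by simp
    show "\<eta>' = (if even (k - 1) then 1 else - 1)" using *[of "k - 1"] c'(2)[of "(k - 1) / 2"] by simp
  qed
  ultimately show False by (auto split: if_splits)
qed

section \<open>Trigonometric coordinates on the torus\<close>

lift_definition tsin :: "3 \<Rightarrow> torus3 \<Rightarrow> real" is "\<lambda>i v. sin (2 * pi * v $ i)"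
  by (rule periodic_diff[where f = "\<lambda>x. sin (2 * pi * x)"]) (auto simp: lattice_rel_def distrib_left)

lift_definition tcos :: "3 \<Rightarrow> torus3 \<Rightarrow> real" is "\<lambda>i v. cos (2 * pi * v $ i)"
  by (rule periodic_diff[where f = "\<lambda>x. cos (2 * pi * x)"]) (auto simp: lattice_rel_def distrib_left)

lemma continuous_torus_lift:
  assumes "\<And>v w. \<bar>f (proj v) - f (proj w)\<bar> \<le> C * dist v w"
  shows "continuous_on S (f :: torus3 \<Rightarrow> real)"
proof -
  have "dist (f P) (f Q) \<le> \<bar>C\<bar> * dist P Q" for P Q
  proof -
    obtain v w0 where v: "P = proj v" and w0: "Q = proj w0" using proj_surj by metis
    obtain w where w: "Q = proj w" "dist P Q = dist v w"
      using dist_torus3_attained[of w0 v] v w0 by metis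
    have "dist (f P) (f Q) \<le> C * dist v w" unfolding dist_real_def v w(1) by (rule assms)
    also have "\<dots> \<le> \<bar>C\<bar> * dist v w" by (rule mult_right_mono) auto
    finally show ?thesis using w by simp
  qed
  then have "\<bar>C\<bar>-lipschitz_on S f" by (intro lipschitz_onI) auto
  then show ?thesis by (rule lipschitz_on_continuous_on)
qed

lemma comp_dist: "\<bar>2 * pi * v $ i - 2 * pi * w $ i\<bar> \<le> 2 * pi * dist v w" for v w :: "real^3"
proof -
  have "\<bar>v $ i - w $ i\<bar> \<le> dist v w"
    using component_le_norm_cart[of "v - w" i] by (simp add: dist_norm)
  then show ?thesis by (simp add: abs_mult flip: right_diff_distrib)
qed

lemma continuous_tsin: "continuous_on S (tsin i)"
  by (rule continuous_torus_lift[where C = "2 * pi"])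
     (simp add: tsin.abs_eq order_trans[OF sin_lipschitz comp_dist])

lemma continuous_tcos: "continuous_on S (tcos i)"
proof (rule continuous_torus_lift[where C = "2 * pi"])
  fix v w :: "real^3"
  have "\<bar>sin (pi / 2 - 2 * pi * v $ i) - sin (pi / 2 - 2 * pi * w $ i)\<bar> \<le> \<bar>(pi / 2 - 2 * pi * v $ i) - (pi / 2 - 2 * pi * w $ i)\<bar>"
    by (rule sin_lipschitz)
  also have "\<dots> = \<bar>2 * pi * v $ i - 2 * pi * w $ i\<bar>" by simp
  also have "\<dots> \<le> 2 * pi * dist v w" by (rule comp_dist)
  finally show "\<bar>tcos i (proj v) - tcos i (proj w)\<bar> \<le> 2 * pi * dist v w"
    by (simp add: tcos.abs_eq sin_diff)
qed

lemma borel_tsin [measurable]: "tsin i \<in> borel_measurable borel" "tcos i \<in> borel_measurable borel"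
  by (intro borel_measurable_continuous_onI continuous_tsin continuous_tcos)+

lemma tsin_mk [simp]:
  "tsin 1 (mk x y z) = sin (2 * pi * x)" "tsin 2 (mk x y z) = sin (2 * pi * y)"
  "tcos 1 (mk x y z) = cos (2 * pi * x)" "tcos 2 (mk x y z) = cos (2 * pi * y)"
  by (simp_all add: mk_def tsin.abs_eq tcos.abs_eq)

definition tslope :: "3 \<Rightarrow> torus3 \<Rightarrow> real" where
  "tslope i p = (if tsin i p > 0 \<or> (tsin i p = 0 \<and> tcos i p = 1) then 1 else - 1)"

lemma tslope_mk [simp]: "tslope 1 (mk x y z) = slope x" "tslope 2 (mk x y z) = slope y"
  by (simp_all add: tslope_def slope_sin_cos)

lemma borel_tslope [measurable]: "tslope i \<in> borel_measurable borel"
  unfolding tslope_def[abs_def] by measurable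

text \<open>The product of the derivative of the second shear with that of the first: s1, s2 stand
  for the slopes and r1, r2 for the derivatives of \<open>rho\<close> at the coordinates that drive
  the two shears. The last column is the third unit vector, so the third direction never feeds into
  the other two.\<close>

definition jac_matrix :: "real \<Rightarrow> real \<Rightarrow> real \<Rightarrow> real \<Rightarrow> real^3^3" where
  "jac_matrix s1 s2 r1 r2 = vector
    [vec3 (1 + stretch * s2 * (stretch * s1)) (stretch * s2) 0,
     vec3 (stretch * s1) 1 0,
     vec3 (r2 * (stretch * s1) + r1) r2 1]"

lemma jac_matrix_nth [simp]:
  "jac_matrix s1 s2 r1 r2 $ 1 = vec3 (1 + stretch * s2 * (stretch * s1)) (stretch * s2) 0"
  "jac_matrix s1 s2 r1 r2 $ 2 = vec3 (stretch * s1) 1 0"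
  "jac_matrix s1 s2 r1 r2 $ 3 = vec3 (r2 * (stretch * s1) + r1) r2 1"
  by (simp_all add: jac_matrix_def)

section \<open>A global lift and its derivative\<close>

definition dynamo_lift :: "real^3 \<Rightarrow> real^3" where
  "dynamo_lift v = vec3 (v $ 1 + stretch * tent (v $ 2 + stretch * tent (v $ 1))) (v $ 2 + stretch * tent (v $ 1))
     (v $ 3 + rho (v $ 1) + rho (v $ 2 + stretch * tent (v $ 1)))"

lemma dynamo_lift: "proj (dynamo_lift v) = dynamo_map (proj v)"
  by (simp add: dynamo_lift_def dynamo_map_def shear1.abs_eq shear2.abs_eq)

lemma continuous_tent: "continuous_on S tent"
proof -
  have "1-lipschitz_on S tent" using tent_lipschitz by (intro lipschitz_onI) (auto simp: dist_real_def)
  then show ?thesis by (rule lipschitz_on_continuous_on)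
qed

lemma continuous_dynamo_lift: "continuous_on UNIV dynamo_lift"
  unfolding dynamo_lift_def[abs_def] rho_def
  by (intro continuous_intros continuous_on_compose2[OF continuous_tent[of UNIV]]) auto

lemma has_derivative_vec3:
  assumes "(f has_derivative f') F" "(g has_derivative g') F" "(h has_derivative h') F"
  shows "((\<lambda>x. vec3 (f x) (g x) (h x)) has_derivative (\<lambda>x. vec3 (f' x) (g' x) (h' x))) F"
proof -
  have *: "vec3 a b c = a *\<^sub>R axis 1 1 + b *\<^sub>R axis 2 1 + c *\<^sub>R axis 3 1" for a b c
    by (simp add: vec_eq_iff forall_3 axis_def)
  show ?thesis unfolding * using assms by (intro has_derivative_add has_derivative_scaleR_left)
qed

lemma has_derivative_nth: "((\<lambda>v::real^3. v $ i) has_derivative (\<lambda>h. h $ i)) F"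
  by (rule bounded_linear.has_derivative[OF bounded_linear_vec_nth has_derivative_ident])

lemma dynamo_lift_deriv:
  assumes "sin (2 * pi * v $ 1) \<noteq> 0" "sin (2 * pi * (v $ 2 + stretch * tent (v $ 1))) \<noteq> 0"
  shows "(dynamo_lift has_derivative (\<lambda>h. jac_matrix (slope (v $ 1)) (slope (v $ 2 + stretch * tent (v $ 1)))
      (drho (v $ 1)) (drho (v $ 2 + stretch * tent (v $ 1))) *v h)) (at v)"
proof -
  define y where "y = v $ 2 + stretch * tent (v $ 1)"
  define yf where "yf = (\<lambda>v::real^3. v $ 2 + stretch * tent (v $ 1))"
  define yd where "yd = (\<lambda>h::real^3. h $ 2 + stretch * (h $ 1 * slope (v $ 1)))"
  have t1: "((\<lambda>v::real^3. tent (v $ 1)) has_derivative (\<lambda>h. h $ 1 * slope (v $ 1))) (at v)"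
    by (rule DERIV_compose_FDERIV[where f = tent and g = "\<lambda>v. v $ 1", OF tent_deriv[OF assms(1)] has_derivative_nth])
  have yd: "(yf has_derivative yd) (at v)"
    unfolding yf_def yd_def
    by (intro has_derivative_add has_derivative_nth has_derivative_mult_right t1)
  have t2: "((\<lambda>v. tent (yf v)) has_derivative (\<lambda>h. yd h * slope y)) (at v)"
    using tent_deriv[OF assms(2)] by (intro DERIV_compose_FDERIV yd) (simp add: y_def yf_def)
  have r2: "((\<lambda>v. rho (yf v)) has_derivative (\<lambda>h. yd h * drho y)) (at v)"
    using rho_deriv[of y] by (intro DERIV_compose_FDERIV yd) (simp add: y_def yf_def)
  have r1: "((\<lambda>v::real^3. rho (v $ 1)) has_derivative (\<lambda>h. h $ 1 * drho (v $ 1))) (at v)"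
    by (rule DERIV_compose_FDERIV[where f = rho and g = "\<lambda>v. v $ 1", OF rho_deriv has_derivative_nth])
  have "((\<lambda>v. vec3 (v $ 1 + stretch * tent (yf v)) (yf v) (v $ 3 + rho (v $ 1) + rho (yf v)))
    has_derivative (\<lambda>h. vec3 (h $ 1 + stretch * (yd h * slope y)) (yd h) (h $ 3 + h $ 1 * drho (v $ 1) + yd h * drho y))) (at v)"
    by (intro has_derivative_vec3 has_derivative_add has_derivative_nth has_derivative_mult_right yd t2 r1 r2)
  moreover have "(\<lambda>h. vec3 (h $ 1 + stretch * (yd h * slope y)) (yd h) (h $ 3 + h $ 1 * drho (v $ 1) + yd h * drho y))
     = (\<lambda>h. jac_matrix (slope (v $ 1)) (slope y) (drho (v $ 1)) (drho y) *v h)"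
    by (simp add: fun_eq_iff vec_eq_iff forall_3 matrix_vector_mult_def sum_3 yd_def algebra_simps)
  ultimately show ?thesis unfolding y_def[symmetric] dynamo_lift_def[abs_def] yf_def by simp
qed

text \<open>The difference of two lifts is lattice-valued. Continuity of F is available only at x,
  from differentiability, but a lattice-valued function that is continuous at a point is constant
  near it.\<close>

lemma lift_deriv_unique:
  assumes F: "\<And>z. proj (F z) = dynamo_map (proj z)" and d: "(F has_derivative D) (at x)"
  shows "(dynamo_lift has_derivative D) (at x)"
proof -
  define E where "E = (\<lambda>z. (F z - dynamo_lift z) - (F x - dynamo_lift x))"
  have int: "E z $ i \<in> \<int>" for z i
  proof -
    have "F w $ i - dynamo_lift w $ i \<in> \<int>" for w
      using F[of w] dynamo_lift[of w] by (metis proj_eq_iff)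
    then have "(F z $ i - dynamo_lift z $ i) - (F x $ i - dynamo_lift x $ i) \<in> \<int>"
      by (rule Ints_diff) fact
    then show ?thesis by (simp add: E_def)
  qed
  have "continuous (at x) E"
    unfolding E_def using has_derivative_continuous[OF d] continuous_dynamo_lift
    by (intro continuous_intros) (auto simp: continuous_on_eq_continuous_at)
  then have "(E \<longlongrightarrow> 0) (at x)" by (simp add: continuous_at E_def)
  then have "\<forall>\<^sub>F z in at x. dist (E z) 0 < 1" by (rule tendstoD) simp
  then have ev: "\<forall>\<^sub>F z in at x. F z - (F x - dynamo_lift x) = dynamo_lift z"
  proof (rule eventually_mono)
    fix z assume "dist (E z) 0 < 1"
    then have "\<bar>E z $ i\<bar> < 1" for i
      using component_le_norm_cart[of "E z" i] by (simp add: dist_norm)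
    then have "E z $ i = 0" for i using int[of z i] by (metis Ints_nonzero_abs_less1)
    then have "E z = 0" by (simp add: vec_eq_iff)
    then show "F z - (F x - dynamo_lift x) = dynamo_lift z" by (simp add: E_def algebra_simps)
  qed
  have "((\<lambda>z. F z - (F x - dynamo_lift x)) has_derivative D) (at x)"
    using has_derivative_diff[OF d has_derivative_const] by simp
  then show ?thesis
    by (rule has_derivative_transform_eventually[OF _ ev]) auto
qed

lemma line_deriv:
  fixes G :: "real^3 \<Rightarrow> real^3"
  assumes "(G has_derivative D) (at v)"
  shows "\<exists>d. ((\<lambda>s. G (v + s *\<^sub>R u) $ i) has_real_derivative d) (at 0)"
proof -
  have "((\<lambda>s. v + s *\<^sub>R u) has_derivative (\<lambda>s. s *\<^sub>R u)) (at 0)"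
    by (auto intro!: derivative_eq_intros)
  from has_derivative_compose[OF this, of G D] assms
  have "((\<lambda>s. G (v + s *\<^sub>R u)) has_derivative (\<lambda>s. D (s *\<^sub>R u))) (at 0)" by simp
  from bounded_linear.has_derivative[OF bounded_linear_vec_nth this, of i]
  have 1: "((\<lambda>s. G (v + s *\<^sub>R u) $ i) has_derivative (\<lambda>s. D (s *\<^sub>R u) $ i)) (at 0)" .
  have "D (s *\<^sub>R u) $ i = (D u $ i) * s" for s
    using linear_scale[OF has_derivative_linear[OF assms]] by simp
  then show ?thesis using 1 by (auto simp: has_field_derivative_def)
qed

text \<open>A crease becomes visible along a direction in which one coordinate of the lift is a
  constant plus stretch times \<open>tent\<close>: moving x exposes the first fold in the second
  coordinate, moving y exposes the second fold in the first.\<close>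

lemma dynamo_lift_not_deriv:
  assumes z: "sin (2 * pi * v $ 1) = 0 \<or> sin (2 * pi * (v $ 2 + stretch * tent (v $ 1))) = 0"
    and d: "(dynamo_lift has_derivative D) (at v)"
  shows False
proof -
  have st: "stretch \<noteq> 0" by (simp add: stretch_def)
  have *: False if "sin (2 * pi * x) = 0" "((\<lambda>s. c + stretch * tent (x + s)) has_real_derivative e) (at 0)" for x c e
  proof -
    have "((\<lambda>s. ((c + stretch * tent (x + s)) - c) / stretch) has_real_derivative (e - 0) / stretch) (at 0)"
      by (intro DERIV_cdivide DERIV_diff that DERIV_const)
    then have "((\<lambda>s. tent (x + s)) has_real_derivative e / stretch) (at 0)" using st by simp
    then have "(tent has_real_derivative e / stretch) (at (0 + x))"
      unfolding DERIV_shift by (simp add: add.commute)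
    then show False using tent_not_deriv that(1) by simp
  qed
  from z show False
  proof
    assume 0: "sin (2 * pi * v $ 1) = 0"
    obtain e where "((\<lambda>s. dynamo_lift (v + s *\<^sub>R axis 1 1) $ 2) has_real_derivative e) (at 0)"
      using line_deriv[OF d] by blast
    moreover have "dynamo_lift (v + s *\<^sub>R axis 1 1) $ 2 = v $ 2 + stretch * tent (v $ 1 + s)" for s
      by (simp add: dynamo_lift_def axis_def)
    ultimately show False using *[OF 0] by simp
  next
    assume 0: "sin (2 * pi * (v $ 2 + stretch * tent (v $ 1))) = 0"
    obtain e where "((\<lambda>s. dynamo_lift (v + s *\<^sub>R axis 2 1) $ 1) has_real_derivative e) (at 0)"
      using line_deriv[OF d] by blast
    moreover have "dynamo_lift (v + s *\<^sub>R axis 2 1) $ 1 = v $ 1 + stretch * tent ((v $ 2 + stretch * tent (v $ 1)) + s)" for s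
      by (simp add: dynamo_lift_def axis_def algebra_simps)
    ultimately show False using *[OF 0] by simp
  qed
qed

definition singular :: "torus3 \<Rightarrow> bool" where
  "singular p \<longleftrightarrow> tsin 1 p = 0 \<or> tsin 2 (shear1 1 p) = 0"

definition dynamo_jac :: "torus3 \<Rightarrow> real^3^3" where
  "dynamo_jac p = jac_matrix (tslope 1 p) (tslope 2 (shear1 1 p)) (pi / 2 * tcos 1 p) (pi / 2 * tcos 2 (shear1 1 p))"

text \<open>Valid at every point. On the creases no matrix qualifies, so the description collapses
  to \<open>THE A. False\<close>, one fixed though unknown matrix. That it is the same for all p
  makes the push-forward Borel and bounded everywhere, as membership in \<open>l2_fields\<close>
  demands.\<close>

lemma torus_jacobian_dynamo:
  "torus_jacobian dynamo_map p = (if singular p then (THE A. False) else dynamo_jac p)"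
proof -
  have sing: "singular (proj x) \<longleftrightarrow> sin (2 * pi * x $ 1) = 0 \<or> sin (2 * pi * (x $ 2 + stretch * tent (x $ 1))) = 0" for x
    by (simp add: singular_def tsin.abs_eq shear1.abs_eq)
  show ?thesis
  proof (cases "singular p")
    case True
    have "\<not> has_torus_jacobian dynamo_map A p" for A
      unfolding has_torus_jacobian_def using lift_deriv_unique dynamo_lift_not_deriv sing True by blast
    then show ?thesis using True by (simp add: torus_jacobian_def)
  next
    case False
    have jac: "dynamo_jac (proj x) = jac_matrix (slope (x $ 1)) (slope (x $ 2 + stretch * tent (x $ 1)))
      (drho (x $ 1)) (drho (x $ 2 + stretch * tent (x $ 1)))" for x
    proof -
      obtain a b c where x: "x = vec3 a b c" using vec3_eq by blast
      show ?thesis unfolding x mk_def[symmetric] dynamo_jac_def shear1_mk by (simp add: drho_def)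
    qed
    have D: "(dynamo_lift has_derivative (\<lambda>h. dynamo_jac p *v h)) (at x)" if "proj x = p" for x
      using dynamo_lift_deriv[of x] False that sing[of x] jac[of x] by auto
    have "torus_jacobian dynamo_map p = dynamo_jac p"
      unfolding torus_jacobian_def
    proof (rule the_equality)
      obtain x where "proj x = p" using proj_surj by metis
      then show "has_torus_jacobian dynamo_map (dynamo_jac p) p"
        unfolding has_torus_jacobian_def using D dynamo_lift by blast
      fix A assume "has_torus_jacobian dynamo_map A p"
      then obtain F x where x: "proj x = p" and F: "\<And>z. proj (F z) = dynamo_map (proj z)"
        and d: "(F has_derivative (\<lambda>h. A *v h)) (at x)"
        unfolding has_torus_jacobian_def by blast
      have "(\<lambda>h. A *v h) = (\<lambda>h. dynamo_jac p *v h)"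
        by (rule has_derivative_unique[OF lift_deriv_unique[OF F d] D[OF x]])
      then show "A = dynamo_jac p" by (simp add: matrix_eq fun_eq_iff)
    qed
    then show ?thesis using False by simp
  qed
qed

section \<open>The heat kernel\<close>

lemma norm_vec3_sq: "(norm (vec3 x y z))\<^sup>2 = x\<^sup>2 + y\<^sup>2 + z\<^sup>2"
  by (simp add: norm_vec_def L2_set_def sum_3)

text \<open>At time \<epsilon> the kernel is the centred Gaussian with variance 2 \<epsilon> in each
  coordinate; the mass and the second moment then reduce to those of normal densities on the
  line.\<close>

lemma heat_kernel_vec3:
  assumes "0 < \<epsilon>"
  shows "heat_kernel \<epsilon> (vec3 x y z) = normal_density 0 (sqrt (2 * \<epsilon>)) x
     * (normal_density 0 (sqrt (2 * \<epsilon>)) y * normal_density 0 (sqrt (2 * \<epsilon>)) z)"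
proof -
  define a where "a = 4 * pi * \<epsilon>"
  have a: "0 < a" using assms by (simp add: a_def)
  have nd: "normal_density 0 (sqrt (2 * \<epsilon>)) u = exp (- u\<^sup>2 / (4 * \<epsilon>)) / sqrt a" for u
    using assms by (simp add: normal_density_def a_def mult.commute mult.left_commute)
  have "a powr (- 3 / 2) = a powr (- (1 / 2) * real 3)" by simp
  also have "\<dots> = (a powr (- (1 / 2))) powr real 3" by (rule powr_powr[symmetric])
  also have "\<dots> = (a powr (- (1 / 2))) ^ 3" using a by (intro powr_realpow) simp
  also have "a powr (- (1 / 2)) = 1 / sqrt a"
    using a unfolding powr_minus_divide by (subst powr_half_sqrt) auto
  finally have "heat_kernel \<epsilon> (vec3 x y z) = (1 / sqrt a) ^ 3 * exp (- (x\<^sup>2 + y\<^sup>2 + z\<^sup>2) / (4 * \<epsilon>))"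
    by (simp add: heat_kernel_def norm_vec3_sq a_def)
  also have "- (x\<^sup>2 + y\<^sup>2 + z\<^sup>2) / (4 * \<epsilon>) = - x\<^sup>2 / (4 * \<epsilon>) + (- y\<^sup>2 / (4 * \<epsilon>) + - z\<^sup>2 / (4 * \<epsilon>))"
    by (simp add: add_divide_distrib diff_divide_distrib)
  finally show ?thesis unfolding nd exp_add by (simp add: power3_eq_cube)
qed

lemma heat_kernel_nonneg [simp]: "0 \<le> heat_kernel \<epsilon> v"
  by (simp add: heat_kernel_def)

lemma heat_kernel_minus [simp]: "heat_kernel \<epsilon> (- v) = heat_kernel \<epsilon> v"
  by (simp add: heat_kernel_def)

lemma borel_heat_kernel [measurable]: "heat_kernel \<epsilon> \<in> borel_measurable borel"
  unfolding heat_kernel_def[abs_def] by measurable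

lemma nn_integral_normal:
  assumes "0 < \<sigma>"
  shows "(\<integral>\<^sup>+x. ennreal (normal_density 0 \<sigma> x) \<partial>lborel) = 1"
    "(\<integral>\<^sup>+x. ennreal (normal_density 0 \<sigma> x * x\<^sup>2) \<partial>lborel) = ennreal (\<sigma>\<^sup>2)"
proof -
  show "(\<integral>\<^sup>+x. ennreal (normal_density 0 \<sigma> x) \<partial>lborel) = 1"
    using assms by (subst nn_integral_eq_integral) auto
  have h: "has_bochner_integral lborel (\<lambda>x. normal_density 0 \<sigma> x * x\<^sup>2) (\<sigma>\<^sup>2)"
    using normal_moment_even[OF assms, of 0 1] by simp
  show "(\<integral>\<^sup>+x. ennreal (normal_density 0 \<sigma> x * x\<^sup>2) \<partial>lborel) = ennreal (\<sigma>\<^sup>2)"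
    using h by (subst nn_integral_eq_integral) (auto simp: has_bochner_integral_iff)
qed

lemma nn_integral_heat_kernel:
  assumes "0 < \<epsilon>"
  shows "(\<integral>\<^sup>+v. ennreal (heat_kernel \<epsilon> v) \<partial>lborel) = 1"
    "(\<integral>\<^sup>+v. ennreal (heat_kernel \<epsilon> v * (v $ 3)\<^sup>2) \<partial>lborel) = ennreal (2 * \<epsilon>)"
proof -
  have \<sigma>: "0 < sqrt (2 * \<epsilon>)" using assms by simp
  note n = nn_integral_normal[OF \<sigma>]
  show "(\<integral>\<^sup>+v. ennreal (heat_kernel \<epsilon> v) \<partial>lborel) = 1"
    by (subst nn_integral_lborel_vec3) (simp_all add: heat_kernel_vec3[OF assms] ennreal_mult nn_integral_cmult nn_integral_multc n)
  have "(\<integral>\<^sup>+v. ennreal (heat_kernel \<epsilon> v * (v $ 3)\<^sup>2) \<partial>lborel) = (\<integral>\<^sup>+x. \<integral>\<^sup>+y. \<integral>\<^sup>+z. ennreal (normal_density 0 (sqrt (2 * \<epsilon>)) x)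
     * (ennreal (normal_density 0 (sqrt (2 * \<epsilon>)) y) * ennreal (normal_density 0 (sqrt (2 * \<epsilon>)) z * z\<^sup>2)) \<partial>lborel \<partial>lborel \<partial>lborel)"
    by (subst nn_integral_lborel_vec3) (auto simp: heat_kernel_vec3[OF assms] ennreal_mult mult.assoc)
  also have "\<dots> = ennreal (2 * \<epsilon>)"
    using assms by (simp add: nn_integral_cmult nn_integral_multc n)
  finally show "(\<integral>\<^sup>+v. ennreal (heat_kernel \<epsilon> v * (v $ 3)\<^sup>2) \<partial>lborel) = ennreal (2 * \<epsilon>)" .
qed

lemma integral_heat_kernel:
  assumes "0 < \<epsilon>"
  shows "integrable lborel (heat_kernel \<epsilon>)" "(\<integral>v. heat_kernel \<epsilon> v \<partial>lborel) = 1"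
    "integrable lborel (\<lambda>v. heat_kernel \<epsilon> v * (v $ 3)\<^sup>2)" "(\<integral>v. heat_kernel \<epsilon> v * (v $ 3)\<^sup>2 \<partial>lborel) = 2 * \<epsilon>"
proof -
  have "has_bochner_integral lborel (heat_kernel \<epsilon>) 1"
    using nn_integral_heat_kernel(1)[OF assms] by (intro has_bochner_integral_nn_integral) auto
  then show "integrable lborel (heat_kernel \<epsilon>)" "(\<integral>v. heat_kernel \<epsilon> v \<partial>lborel) = 1"
    by (auto simp: has_bochner_integral_iff)
  have "has_bochner_integral lborel (\<lambda>v. heat_kernel \<epsilon> v * (v $ 3)\<^sup>2) (2 * \<epsilon>)"
    using nn_integral_heat_kernel(2)[OF assms] assms by (intro has_bochner_integral_nn_integral) auto
  then show "integrable lborel (\<lambda>v. heat_kernel \<epsilon> v * (v $ 3)\<^sup>2)" "(\<integral>v. heat_kernel \<epsilon> v * (v $ 3)\<^sup>2 \<partial>lborel) = 2 * \<epsilon>"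
    by (auto simp: has_bochner_integral_iff)
qed

text \<open>On the mode exp (2 \<pi> \<i> z) a shift by v in space acts as a shift in (x, y)
  combined with the factor \<open>cis (- 2 * pi * v $ 3)\<close>. The factor is put into the
  weight.\<close>

definition twisted_kernel :: "real \<Rightarrow> real^3 \<Rightarrow> complex" where
  "twisted_kernel \<epsilon> v = of_real (heat_kernel \<epsilon> v) * cis (- 2 * pi * v $ 3)"

lemma norm_twisted_kernel [simp]: "norm (twisted_kernel \<epsilon> v) = heat_kernel \<epsilon> v"
  by (simp add: twisted_kernel_def norm_mult)

lemma borel_cis [measurable]: "cis \<in> borel_measurable borel"
  by (intro borel_measurable_continuous_onI continuous_intros)

lemma integrable_twisted_kernel:
  assumes "0 < \<epsilon>"
  shows "integrable lborel (twisted_kernel \<epsilon>)"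
proof (rule Bochner_Integration.integrable_bound[OF integral_heat_kernel(1)[OF assms]])
  show "twisted_kernel \<epsilon> \<in> borel_measurable lborel"
    unfolding twisted_kernel_def[abs_def] by measurable
qed simp

lemma norm_cis_diff: "norm (cis \<theta> - 1) \<le> \<bar>\<theta>\<bar>"
proof -
  have "norm (cis \<theta> - 1)^2 = (cos \<theta> - 1)\<^sup>2 + (sin \<theta>)\<^sup>2"
    by (simp add: cmod_power2)
  also have "\<dots> = 2 - 2 * cos \<theta>"
    using sin_cos_squared_add[of \<theta>] by (simp add: power2_eq_square algebra_simps)
  also have "\<dots> = 4 * (sin (\<theta> / 2))\<^sup>2"
    using cos_double_sin[of "\<theta> / 2"] by simp
  also have "\<dots> \<le> 4 * (\<theta> / 2)\<^sup>2"
    using abs_sin_x_le_abs_x[of "\<theta> / 2"] by (intro mult_left_mono) (auto simp flip: abs_le_square_iff)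
  also have "\<dots> = \<bar>\<theta>\<bar>\<^sup>2" by (simp add: power2_eq_square)
  finally show ?thesis by (rule power2_le_imp_le) simp
qed

text \<open>A second-moment bound replaces the Fourier transform of the Gaussian: the defect is at
  most \<theta>, and \<theta> is at most 1/8 plus twice its square because the square of \<theta> -
  1/4 is nonnegative. The second moment 2 \<epsilon> makes the quadratic part at most 0.0256; this
  is where \<epsilon> \<le> 1/10000 enters.\<close>

lemma twisted_kernel_mass:
  assumes "0 < \<epsilon>" "\<epsilon> \<le> 1 / 10000"
  shows "norm ((\<integral>v. twisted_kernel \<epsilon> v \<partial>lborel) - 1) \<le> 1 / 4"
proof -
  note ik = integral_heat_kernel[OF assms(1)]
  have ic: "integrable lborel (\<lambda>v. complex_of_real (heat_kernel \<epsilon> v))" using ik(1) by simp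
  have "(\<integral>v. complex_of_real (heat_kernel \<epsilon> v) \<partial>lborel) = 1" using ik(2) by simp
  then have "(\<integral>v. twisted_kernel \<epsilon> v \<partial>lborel) - 1 = (\<integral>v. twisted_kernel \<epsilon> v - of_real (heat_kernel \<epsilon> v) \<partial>lborel)"
    using integrable_twisted_kernel[OF assms(1)] ic by simp
  also have "norm \<dots> \<le> (\<integral>v. heat_kernel \<epsilon> v * (1 / 8) + 8 * pi\<^sup>2 * (heat_kernel \<epsilon> v * (v $ 3)\<^sup>2) \<partial>lborel)"
  proof (rule order_trans[OF integral_norm_bound integral_mono])
    show "integrable lborel (\<lambda>v. norm (twisted_kernel \<epsilon> v - of_real (heat_kernel \<epsilon> v)))"
      using integrable_twisted_kernel[OF assms(1)] ic by auto
    show "integrable lborel (\<lambda>v. heat_kernel \<epsilon> v * (1 / 8) + 8 * pi\<^sup>2 * (heat_kernel \<epsilon> v * (v $ 3)\<^sup>2))"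
      using ik by auto
    fix v :: "real^3"
    define \<theta> where "\<theta> = 2 * pi * \<bar>v $ 3\<bar>"
    have "norm (twisted_kernel \<epsilon> v - of_real (heat_kernel \<epsilon> v)) = heat_kernel \<epsilon> v * norm (cis (- 2 * pi * v $ 3) - 1)"
      unfolding twisted_kernel_def by (metis abs_of_nonneg heat_kernel_nonneg mult.right_neutral norm_mult norm_of_real right_diff_distrib)
    also have "\<dots> \<le> heat_kernel \<epsilon> v * \<theta>"
      using norm_cis_diff[of "- 2 * pi * v $ 3"] by (intro mult_left_mono) (auto simp: \<theta>_def abs_mult)
    also have "\<dots> \<le> heat_kernel \<epsilon> v * (1 / 8 + 2 * \<theta>\<^sup>2)"
    proof (rule mult_left_mono)
      have "0 \<le> 2 * (\<theta> - 1 / 4)\<^sup>2" by simp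
      then show "\<theta> \<le> 1 / 8 + 2 * \<theta>\<^sup>2" by (simp add: power2_eq_square algebra_simps)
    qed simp
    also have "\<dots> = heat_kernel \<epsilon> v * (1 / 8) + 8 * pi\<^sup>2 * (heat_kernel \<epsilon> v * (v $ 3)\<^sup>2)"
      by (simp add: \<theta>_def power_mult_distrib algebra_simps)
    finally show "norm (twisted_kernel \<epsilon> v - of_real (heat_kernel \<epsilon> v)) \<le> heat_kernel \<epsilon> v * (1 / 8) + 8 * pi\<^sup>2 * (heat_kernel \<epsilon> v * (v $ 3)\<^sup>2)" .
  qed
  also have "\<dots> = 1 / 8 + 8 * pi\<^sup>2 * (2 * \<epsilon>)"
    using ik by simp
  also have "\<dots> \<le> 1 / 8 + 8 * 4\<^sup>2 * (2 * (1 / 10000))"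
    using pi_less_4 pi_gt_zero assms by (intro add_left_mono mult_mono power_mono) auto
  also have "\<dots> \<le> 1 / 4" by simp
  finally show ?thesis .
qed

section \<open>Operator norms and spectral radii\<close>

lemma submultiplicative_power:
  fixes a :: "nat \<Rightarrow> real"
  assumes nn: "\<And>n. 0 \<le> a n" and sub: "\<And>m n. a (m + n) \<le> a m * a n"
  shows "a (q * m + r) \<le> a m ^ q * a r"
proof (induction q)
  case (Suc q)
  have "a (Suc q * m + r) = a (m + (q * m + r))" by (simp add: algebra_simps)
  also have "\<dots> \<le> a m * a (q * m + r)" by (rule sub)
  also have "\<dots> \<le> a m * (a m ^ q * a r)" using Suc nn by (intro mult_left_mono) auto
  finally show ?case by (simp add: mult.assoc)
qed simp

text \<open>The limit is the infimum L. If \<mu> exceeds the root at some m, division of n by m with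
  remainder bounds a n by a constant times \<open>\<mu> ^ n\<close>, and the constant disappears
  under the n-th root. Roots are used instead of logarithms because a n may be 0.\<close>

lemma fekete_convergent:
  fixes a :: "nat \<Rightarrow> real"
  assumes nn: "\<And>n. 0 \<le> a n" and sub: "\<And>m n. a (m + n) \<le> a m * a n"
  shows "convergent (\<lambda>n. root n (a n))"
proof -
  \<comment> \<open>The index 0 is excluded: \<open>root 0\<close> is constantly 0 and would spoil
    the infimum.\<close>
  define L where "L = (INF n\<in>{1..}. root n (a n))"
  have bdd: "bdd_below ((\<lambda>n. root n (a n)) ` {1..})"
    using nn by (intro bdd_belowI2[of _ 0]) simp
  have L_le: "L \<le> root n (a n)" if "1 \<le> n" for n
    unfolding L_def using that by (intro cINF_lower bdd) auto
  have L0: "0 \<le> L" unfolding L_def using nn by (intro cINF_greatest) auto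
  have up: "\<forall>\<^sub>F n in sequentially. root n (a n) < L + e" if e: "0 < e" for e
  proof -
    have "L < L + e / 2" using e by simp
    then obtain m where m: "1 \<le> m" "root m (a m) < L + e / 2"
      unfolding L_def using cINF_less_iff[OF _ bdd, of "L + e / 2"] by (auto simp: L_def)
    define \<mu> where "\<mu> = L + e / 2"
    have \<mu>: "0 < \<mu>" using L0 e by (simp add: \<mu>_def)
    have am: "a m \<le> \<mu> ^ m"
    proof -
      have "root m (a m) ^ m \<le> \<mu> ^ m" using m nn by (intro power_mono) (auto simp: \<mu>_def)
      then show ?thesis using m nn by simp
    qed
    \<comment> \<open>The sum handles all remainders r < m at once. The summand 1 makes C positive,
      as needed for \<open>root n C\<close> to tend to 1.\<close>
    define C where "C = (\<Sum>r<m. a r / \<mu> ^ r) + 1"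
    have C: "0 < C" using \<mu> nn by (auto simp: C_def intro!: add_nonneg_pos sum_nonneg)
    have an: "a n \<le> C * \<mu> ^ n" for n
    proof -
      define q r where "q = n div m" and "r = n mod m"
      have n: "n = q * m + r" and r: "r < m" using m by (auto simp: q_def r_def)
      have "a n \<le> a m ^ q * a r" unfolding n by (rule submultiplicative_power[OF nn sub])
      also have "\<dots> \<le> (\<mu> ^ m) ^ q * a r" using am nn by (intro mult_right_mono power_mono) auto
      also have "\<dots> = (a r / \<mu> ^ r) * \<mu> ^ n"
        using \<mu> by (simp add: n power_add power_mult[symmetric] mult.commute)
      also have "\<dots> \<le> C * \<mu> ^ n"
      proof (rule mult_right_mono)
        have "a r / \<mu> ^ r \<le> (\<Sum>r<m. a r / \<mu> ^ r)"
          using r nn \<mu> by (intro member_le_sum) auto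
        then show "a r / \<mu> ^ r \<le> C" by (simp add: C_def)
      qed (use \<mu> in simp)
      finally show ?thesis .
    qed
    have "(\<lambda>n. root n C) \<longlonglongrightarrow> 1" using C by (rule LIMSEQ_root_const)
    then have "(\<lambda>n. root n C * \<mu>) \<longlonglongrightarrow> 1 * \<mu>" by (intro tendsto_intros)
    moreover have "1 * \<mu> < L + e" using e by (simp add: \<mu>_def)
    ultimately have "\<forall>\<^sub>F n in sequentially. root n C * \<mu> < L + e" by (rule order_tendstoD(2))
    moreover have "\<forall>\<^sub>F n in sequentially. root n (a n) \<le> root n C * \<mu>"
      using eventually_gt_at_top[of 0]
    proof eventually_elim
      case (elim n)
      have "root n (a n) \<le> root n (C * \<mu> ^ n)" using an elim by (intro real_root_le_mono) auto
      also have "\<dots> = root n C * \<mu>" using elim \<mu> by (simp add: real_root_mult real_root_power_cancel)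
      finally show ?case .
    qed
    ultimately show ?thesis by eventually_elim auto
  qed
  have "(\<lambda>n. root n (a n)) \<longlonglongrightarrow> L"
  proof (rule order_tendstoI)
    fix u assume u: "u < L"
    show "\<forall>\<^sub>F n in sequentially. u < root n (a n)"
      using eventually_ge_at_top[of 1]
    proof eventually_elim
      case (elim n)
      then show ?case using L_le[of n] u by simp
    qed
  next
    fix u assume "L < u"
    then show "\<forall>\<^sub>F n in sequentially. root n (a n) < u" using up[of "u - L"] by simp
  qed
  then show ?thesis by (auto simp: convergent_def)
qed

lemma lim_root_ge:
  fixes a :: "nat \<Rightarrow> real"
  assumes conv: "convergent (\<lambda>n. root n (a n))" and c: "0 < c" and r: "0 \<le> r" and ge: "\<And>n. c * r ^ n \<le> a n"
  shows "r \<le> lim (\<lambda>n. root n (a n))"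
proof -
  have "(\<lambda>n. root n c) \<longlonglongrightarrow> 1" using c by (rule LIMSEQ_root_const)
  then have "(\<lambda>n. root n c * r) \<longlonglongrightarrow> 1 * r" by (intro tendsto_intros)
  moreover have "(\<lambda>n. root n (a n)) \<longlonglongrightarrow> lim (\<lambda>n. root n (a n))" using conv by (rule convergent_LIMSEQ_iff[THEN iffD1])
  moreover have "\<forall>\<^sub>F n in sequentially. root n c * r \<le> root n (a n)"
    using eventually_gt_at_top[of 0]
  proof eventually_elim
    case (elim n)
    have "root n c * r = root n (c * r ^ n)" using elim r by (simp add: real_root_mult real_root_power_cancel)
    also have "\<dots> \<le> root n (a n)" using ge elim by (intro real_root_le_mono) auto
    finally show ?case .
  qed
  ultimately have "1 * r \<le> lim (\<lambda>n. root n (a n))"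
    by (intro tendsto_le[OF sequentially_bot]) auto
  then show ?thesis by simp
qed

text \<open>\<open>l2_op_norm\<close> is a real supremum over the unit ball. The constant C
  guarantees that this supremum is taken over a bounded set, and homogeneity carries it over to
  fields of any norm.\<close>

definition l2_bounded :: "((torus3 \<Rightarrow> complex^3) \<Rightarrow> (torus3 \<Rightarrow> complex^3)) \<Rightarrow> real \<Rightarrow> bool" where
  "l2_bounded A C \<longleftrightarrow> 0 \<le> C \<and> (\<forall>B\<in>l2_fields. A B \<in> l2_fields \<and> l2_norm (A B) \<le> C * l2_norm B)
     \<and> (\<forall>r. \<forall>B\<in>l2_fields. A (\<lambda>p. r *\<^sub>R B p) = (\<lambda>p. r *\<^sub>R A B p))"

lemma l2_fields_scaleR: "B \<in> l2_fields \<Longrightarrow> (\<lambda>p. r *\<^sub>R B p) \<in> l2_fields"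
  by (auto simp: l2_fields_def power_mult_distrib)

lemma l2_norm_scaleR: "l2_norm (\<lambda>p. r *\<^sub>R B p) = \<bar>r\<bar> * l2_norm B"
  by (simp add: l2_norm_def power_mult_distrib real_sqrt_mult)

lemma l2_norm_nonneg [simp]: "0 \<le> l2_norm B"
  by (simp add: l2_norm_def)

lemma l2_norm_zero [simp]: "l2_norm (\<lambda>p. 0) = 0"
  by (simp add: l2_norm_def)

lemma zero_l2_fields [simp]: "(\<lambda>p. 0) \<in> l2_fields"
  by (simp add: l2_fields_def)

lemma l2_bounded_compose:
  assumes "l2_bounded A C" "l2_bounded A' C'" shows "l2_bounded (A \<circ> A') (C * C')"
  unfolding l2_bounded_def
proof (intro conjI ballI allI)
  show "0 \<le> C * C'" using assms by (simp add: l2_bounded_def)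
  fix B assume B: "B \<in> l2_fields"
  then have A': "A' B \<in> l2_fields" "l2_norm (A' B) \<le> C' * l2_norm B" using assms by (auto simp: l2_bounded_def)
  show "(A \<circ> A') B \<in> l2_fields" using assms A' by (auto simp: l2_bounded_def)
  have "l2_norm (A (A' B)) \<le> C * l2_norm (A' B)" using assms A' by (auto simp: l2_bounded_def)
  also have "\<dots> \<le> C * (C' * l2_norm B)" using assms A' by (intro mult_left_mono) (auto simp: l2_bounded_def)
  finally show "l2_norm ((A \<circ> A') B) \<le> C * C' * l2_norm B" by simp
  show "(A \<circ> A') (\<lambda>p. r *\<^sub>R B p) = (\<lambda>p. r *\<^sub>R (A \<circ> A') B p)" for r
    using assms A' B by (simp add: l2_bounded_def)
qed

lemma l2_bounded_power:
  assumes "l2_bounded A C" shows "l2_bounded (A ^^ n) (C ^ n)"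
proof (induction n)
  case 0
  then show ?case by (simp add: l2_bounded_def)
next
  case (Suc n)
  then show ?case unfolding funpow.simps power_Suc by (rule l2_bounded_compose[OF assms])
qed

lemma l2_op_norm_bound:
  assumes A: "l2_bounded A C" and B: "B \<in> l2_fields"
  shows "l2_norm (A B) \<le> l2_op_norm A * l2_norm B"
proof (cases "l2_norm B = 0")
  \<comment> \<open>A field of seminorm 0 cannot be normalised, but the bound by C makes its image
    have seminorm 0 as well.\<close>
  case True
  have "l2_norm (A B) \<le> C * l2_norm B" using A B by (auto simp: l2_bounded_def)
  then show ?thesis using True by simp
next
  case False
  define b where "b = l2_norm B"
  have b: "0 < b" unfolding b_def using order_le_neq_trans[OF l2_norm_nonneg[of B]] False by metis
  define B' where "B' = (\<lambda>p. (1 / b) *\<^sub>R B p)"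
  have B': "B' \<in> l2_fields" unfolding B'_def by (rule l2_fields_scaleR[OF B])
  have n: "l2_norm B' = 1" using b unfolding B'_def l2_norm_scaleR by (simp add: b_def)
  have bdd: "bdd_above ((\<lambda>B. l2_norm (A B)) ` {B \<in> l2_fields. l2_norm B \<le> 1})"
  proof (rule bdd_aboveI2)
    fix B assume "B \<in> {B \<in> l2_fields. l2_norm B \<le> 1}"
    then have "l2_norm (A B) \<le> C * l2_norm B" "C * l2_norm B \<le> C * 1"
      using A mult_left_mono[of "l2_norm B" 1 C] by (auto simp: l2_bounded_def)
    then show "l2_norm (A B) \<le> C" by simp
  qed
  have "l2_norm (A B') \<le> l2_op_norm A"
    unfolding l2_op_norm_def by (rule cSUP_upper[OF _ bdd]) (use B' n in simp)
  moreover have "l2_norm (A B') = l2_norm (A B) / b"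
    using A B b unfolding B'_def by (simp add: l2_bounded_def l2_norm_scaleR)
  ultimately show ?thesis using b by (simp add: field_simps b_def)
qed

lemma l2_op_norm_least:
  assumes "\<And>B. B \<in> l2_fields \<Longrightarrow> l2_norm (A B) \<le> K * l2_norm B" "0 \<le> K"
  shows "l2_op_norm A \<le> K"
  unfolding l2_op_norm_def
proof (rule cSUP_least)
  have "(\<lambda>p. 0) \<in> {B \<in> l2_fields. l2_norm B \<le> 1}" by simp
  then show "{B \<in> l2_fields. l2_norm B \<le> 1} \<noteq> {}" by blast
  fix B assume "B \<in> {B \<in> l2_fields. l2_norm B \<le> 1}"
  then have "l2_norm (A B) \<le> K * l2_norm B" "K * l2_norm B \<le> K * 1" using assms mult_left_mono[of "l2_norm B" 1 K] by auto
  then show "l2_norm (A B) \<le> K" by simp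
qed

lemma l2_op_norm_nonneg:
  assumes "l2_bounded A C" shows "0 \<le> l2_op_norm A"
proof -
  have bdd: "bdd_above ((\<lambda>B. l2_norm (A B)) ` {B \<in> l2_fields. l2_norm B \<le> 1})"
  proof (rule bdd_aboveI2)
    fix B assume "B \<in> {B \<in> l2_fields. l2_norm B \<le> 1}"
    then have "l2_norm (A B) \<le> C * l2_norm B" "C * l2_norm B \<le> C * 1"
      using assms mult_left_mono[of "l2_norm B" 1 C] by (auto simp: l2_bounded_def)
    then show "l2_norm (A B) \<le> C" by simp
  qed
  have "l2_norm (A (\<lambda>p. 0)) \<le> l2_op_norm A"
    unfolding l2_op_norm_def by (rule cSUP_upper[OF _ bdd]) simp
  then show ?thesis using l2_norm_nonneg order_trans by blast
qed

lemma l2_op_norm_submultiplicative: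
  assumes A: "l2_bounded A C" and A': "l2_bounded A' C'"
  shows "l2_op_norm (A \<circ> A') \<le> l2_op_norm A * l2_op_norm A'"
proof (rule l2_op_norm_least)
  fix B assume B: "B \<in> l2_fields"
  then have AB: "A' B \<in> l2_fields" using A' by (auto simp: l2_bounded_def)
  have "l2_norm (A (A' B)) \<le> l2_op_norm A * l2_norm (A' B)" by (rule l2_op_norm_bound[OF A AB])
  also have "\<dots> \<le> l2_op_norm A * (l2_op_norm A' * l2_norm B)"
    by (intro mult_left_mono l2_op_norm_bound[OF A' B] l2_op_norm_nonneg[OF A])
  finally show "l2_norm ((A \<circ> A') B) \<le> l2_op_norm A * l2_op_norm A' * l2_norm B" by simp
qed (intro mult_nonneg_nonneg l2_op_norm_nonneg[OF A] l2_op_norm_nonneg[OF A'])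

lemma convergent_l2_op_norm:
  assumes "l2_bounded A C"
  shows "convergent (\<lambda>n. root n (l2_op_norm (A ^^ n)))"
proof (rule fekete_convergent)
  show "0 \<le> l2_op_norm (A ^^ n)" for n by (rule l2_op_norm_nonneg[OF l2_bounded_power[OF assms]])
  show "l2_op_norm (A ^^ (m + n)) \<le> l2_op_norm (A ^^ m) * l2_op_norm (A ^^ n)" for m n
    unfolding funpow_add by (rule l2_op_norm_submultiplicative[OF l2_bounded_power[OF assms] l2_bounded_power[OF assms]])
qed

section \<open>Boundedness of the operators\<close>

text \<open>The fractional part of a lifted coordinate, recovered from its cosine and the sign of
  its sine: \<open>arccos\<close> covers one half of the circle and the other half is obtained by
  reflection.\<close>

definition tfrac :: "3 \<Rightarrow> torus3 \<Rightarrow> real" where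
  "tfrac i p = (if 0 \<le> tsin i p then arccos (tcos i p) / (2 * pi) else 1 - arccos (tcos i p) / (2 * pi))"

lemma tfrac_proj: "tfrac i (proj v) = frac (v $ i)"
proof -
  define f where "f = frac (v $ i)"
  have f: "0 \<le> f" "f < 1" using frac_lt_1[of "v $ i"] by (auto simp: f_def)
  have s: "tsin i (proj v) = sin (2 * pi * f)" and c: "tcos i (proj v) = cos (2 * pi * f)"
    unfolding tsin.abs_eq tcos.abs_eq f_def by (rule sin_frac)+
  show ?thesis
  proof (cases "f \<le> 1 / 2")
    case True
    have "0 \<le> sin (2 * pi * f)" using f True by (intro sin_ge_zero) auto
    moreover have "arccos (cos (2 * pi * f)) = 2 * pi * f" using f True by (intro arccos_cos) auto
    ultimately show ?thesis by (simp add: tfrac_def s c f_def[symmetric])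
  next
    case False
    have "sin (2 * pi * f) < 0" using f False by (intro sin_lt_zero) auto
    moreover have "arccos (cos (2 * pi - 2 * pi * f)) = 2 * pi - 2 * pi * f" using f False by (intro arccos_cos) auto
    moreover have "cos (2 * pi - 2 * pi * f) = cos (2 * pi * f)" by simp
    ultimately show ?thesis by (simp add: tfrac_def s c f_def[symmetric] diff_divide_distrib)
  qed
qed

lemma borel_tfrac [measurable]: "tfrac i \<in> borel_measurable borel"
proof -
  have "- 1 \<le> tcos i p \<and> tcos i p \<le> 1" for p
    using proj_surj[of p] by (auto simp: tcos.abs_eq)
  then have "continuous_on UNIV (\<lambda>p. arccos (tcos i p))"
    by (intro continuous_on_arccos continuous_tcos) auto
  then have [measurable]: "(\<lambda>p. arccos (tcos i p)) \<in> borel_measurable borel"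
    by (rule borel_measurable_continuous_onI)
  show ?thesis unfolding tfrac_def[abs_def] by measurable
qed

text \<open>A right inverse of \<open>proj\<close> that is visibly Borel. The representatives
  supplied by the quotient construction are chosen arbitrarily and tell nothing about
  measurability.\<close>

definition torus_section :: "torus3 \<Rightarrow> real^3" where
  "torus_section p = vec3 (tfrac 1 p) (tfrac 2 p) (tfrac 3 p)"

lemma borel_torus_section [measurable]: "torus_section \<in> borel_measurable borel"
  unfolding torus_section_def[abs_def] by measurable

lemma proj_torus_section [simp]: "proj (torus_section p) = p"
proof -
  obtain v where v: "p = proj v" using proj_surj by blast
  have "frac x - x \<in> \<int>" for x :: real by (simp add: frac_def)
  then show ?thesis unfolding v by (simp add: proj_eq_iff forall_3 torus_section_def tfrac_proj)
qed

text \<open>Fubini for the heat flow requires joint measurability in the shift and the point. It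
  follows by lifting through the Borel section, adding in space and projecting back.\<close>

lemma borel_torus_shift [measurable]:
  assumes [measurable]: "f \<in> measurable M borel" "g \<in> borel_measurable M"
  shows "(\<lambda>x. torus_shift (g x) (f x)) \<in> measurable M borel"
proof -
  have "(\<lambda>x. proj (torus_section (f x) + g x)) \<in> measurable M borel" by measurable
  then show ?thesis
    using torus_shift.abs_eq by (metis (no_types, lifting) measurable_cong proj_torus_section)
qed

lemma prob_space_torus: "prob_space torus_measure"
proof
  have "emeasure torus_measure (space torus_measure) = (\<integral>\<^sup>+p. 1 \<partial>torus_measure)" by simp
  also have "\<dots> = 1" by (subst nn_integral_torus) (simp_all add: cube_sum_def)
  finally show "emeasure torus_measure (space torus_measure) = 1" .
qed

interpretation torus: prob_space torus_measure by (rule prob_space_torus)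

section \<open>Square-integrable fields\<close>

lemma borel_vec_nth [measurable]: "f \<in> borel_measurable M \<Longrightarrow> (\<lambda>x. (f x :: complex^3) $ i) \<in> borel_measurable M"
  by (rule borel_measurable_continuous_on[where f = "\<lambda>v. v $ i"]) (auto intro: continuous_intros)

lemma borel_vec_lambda:
  assumes "\<And>i. f i \<in> borel_measurable M"
  shows "(\<lambda>x. (\<chi> i. f i x) :: complex^3) \<in> borel_measurable M"
proof -
  have ax: "continuous_on UNIV (\<lambda>z::complex. axis i z :: complex^3)" for i
  proof -
    have "continuous_on UNIV (\<lambda>z::complex. if j = i then z else 0)" for j by (cases "j = i") auto
    then show ?thesis unfolding axis_def by (rule continuous_on_vec_lambda)
  qed
  have "(\<lambda>x. \<Sum>i\<in>UNIV. axis i (f i x) :: complex^3) \<in> borel_measurable M"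
    by (intro borel_measurable_sum borel_measurable_continuous_on[OF ax] assms)
  moreover have "(\<Sum>i\<in>UNIV. axis i (f i x)) = (\<chi> i. f i x)" for x
    by (simp add: vec_eq_iff axis_def)
  ultimately show ?thesis by simp
qed

lemma norm_vec_lambda_le:
  assumes "\<And>i. norm (v $ i :: complex) \<le> C" shows "norm (v :: complex^3) \<le> 3 * C"
proof -
  have "norm v \<le> (\<Sum>i\<in>UNIV. norm (v $ i))" unfolding norm_vec_def by (rule L2_set_le_sum) simp
  also have "\<dots> \<le> 3 * C" using assms[of 1] assms[of 2] assms[of 3] by (simp add: sum_3)
  finally show ?thesis .
qed

text \<open>Extended nonnegative values allow Tonelli and the invariance of the measure to be
  applied before square-integrability of the image is known; finiteness then comes out of the
  estimate.\<close>

definition sq_mass :: "(torus3 \<Rightarrow> complex^3) \<Rightarrow> ennreal" where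
  "sq_mass B = (\<integral>\<^sup>+p. ennreal ((norm (B p))\<^sup>2) \<partial>torus_measure)"

lemma measurable_torus_iff [simp]: "f \<in> borel_measurable torus_measure \<longleftrightarrow> f \<in> borel_measurable borel"
  by (simp cong: measurable_cong_sets)

lemma l2_fields_iff: "B \<in> l2_fields \<longleftrightarrow> B \<in> borel_measurable borel \<and> sq_mass B < \<infinity>"
  unfolding l2_fields_def sq_mass_def by (auto simp: integrable_iff_bounded)

lemma l2_norm_sq_mass:
  assumes "B \<in> l2_fields" shows "ennreal ((l2_norm B)\<^sup>2) = sq_mass B"
  using assms unfolding sq_mass_def l2_norm_def l2_fields_def
  by (subst nn_integral_eq_integral) auto

lemma l2_field_bound:
  assumes B: "B \<in> l2_fields" and m: "B' \<in> borel_measurable borel" and C: "0 \<le> C"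
    and le: "sq_mass B' \<le> ennreal (C\<^sup>2) * sq_mass B"
  shows "B' \<in> l2_fields" "l2_norm B' \<le> C * l2_norm B"
proof -
  have "ennreal (C\<^sup>2) * sq_mass B < \<infinity>" using B by (auto simp: l2_fields_iff ennreal_mult_less_top)
  then show B': "B' \<in> l2_fields" using m le by (auto simp: l2_fields_iff)
  have "ennreal ((l2_norm B')\<^sup>2) \<le> ennreal ((C * l2_norm B)\<^sup>2)"
    using le unfolding l2_norm_sq_mass[OF B', symmetric] l2_norm_sq_mass[OF B, symmetric]
    by (simp add: power_mult_distrib ennreal_mult)
  then have "(l2_norm B')\<^sup>2 \<le> (C * l2_norm B)\<^sup>2" by simp
  then show "l2_norm B' \<le> C * l2_norm B" by (rule power2_le_imp_le) (simp add: C)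
qed

section \<open>Boundedness of the push-forward\<close>

lemma borel_singular [measurable]: "Measurable.pred borel singular"
proof -
  have [measurable]: "shear1 1 \<in> borel_measurable borel" by (rule borel_shears) simp
  show ?thesis unfolding singular_def[abs_def] by measurable
qed

lemma borel_dynamo_jac: "(\<lambda>p. dynamo_jac p $ i $ j) \<in> borel_measurable borel"
proof -
  have [measurable]: "shear1 1 \<in> borel_measurable borel" by (rule borel_shears) simp
  have [measurable]: "(\<lambda>p. tslope 2 (shear1 1 p)) \<in> borel_measurable borel" "(\<lambda>p. tcos 2 (shear1 1 p)) \<in> borel_measurable borel"
    by measurable
  show ?thesis
    unfolding dynamo_jac_def using exhaust_3[of i] exhaust_3[of j] by (elim disjE) simp_all
qed

lemma borel_torus_jacobian: "(\<lambda>p. torus_jacobian dynamo_map p $ i $ j) \<in> borel_measurable borel"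
proof -
  have "(\<lambda>p. if singular p then (THE A. False) $ i $ j else dynamo_jac p $ i $ j) \<in> borel_measurable borel"
    using borel_dynamo_jac by (intro measurable_If) (auto simp: pred_def[symmetric])
  moreover have "(\<lambda>p. if singular p then (THE A. False) $ i $ j else dynamo_jac p $ i $ j) = (\<lambda>p. torus_jacobian dynamo_map p $ i $ j)"
    by (simp add: torus_jacobian_dynamo fun_eq_iff)
  ultimately show ?thesis by simp
qed

lemma dynamo_jac_bound: "\<bar>dynamo_jac p $ i $ j\<bar> \<le> 10 * stretch\<^sup>2"
proof -
  obtain x y z where p: "p = mk x y z" by (rule mk_cases)
  have sl: "\<bar>slope u\<bar> \<le> 1" for u by (simp add: slope_def)
  have r: "\<bar>pi / 2 * cos u\<bar> \<le> 2" for u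
  proof -
    have "\<bar>pi / 2 * cos u\<bar> \<le> 2 * 1"
      unfolding abs_mult using pi_less_4 pi_gt_zero by (intro mult_mono) auto
    then show ?thesis by simp
  qed
  define s1 where "s1 = slope x"
  define s2 where "s2 = slope (y + stretch * tent x)"
  define r1 where "r1 = pi / 2 * cos (2 * pi * x)"
  define r2 where "r2 = pi / 2 * cos (2 * pi * (y + stretch * tent x))"
  have b: "\<bar>s1\<bar> \<le> 1" "\<bar>s2\<bar> \<le> 1" "\<bar>r1\<bar> \<le> 2" "\<bar>r2\<bar> \<le> 2"
    unfolding s1_def s2_def r1_def r2_def by (rule sl r)+
  have J: "dynamo_jac p = jac_matrix s1 s2 r1 r2"
    unfolding p dynamo_jac_def shear1_mk s1_def s2_def r1_def r2_def by simp
  have st: "1 \<le> stretch" "stretch \<le> stretch\<^sup>2" "1 \<le> stretch\<^sup>2" by (simp_all add: stretch_def)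
  have m2: "\<bar>stretch * s\<bar> \<le> stretch" if "\<bar>s\<bar> \<le> 1" for s
    using that st mult_left_mono[of "\<bar>s\<bar>" 1 stretch] by (simp add: abs_mult)
  have m1: "\<bar>stretch * s2 * (stretch * s1)\<bar> \<le> stretch\<^sup>2"
    unfolding abs_mult[of "stretch * s2"] power2_eq_square using m2 b st by (intro mult_mono) auto
  have m3: "\<bar>r2 * (stretch * s1)\<bar> \<le> 2 * stretch"
    unfolding abs_mult[of r2] using m2 b st by (intro mult_mono) auto
  have "\<bar>1 + stretch * s2 * (stretch * s1)\<bar> \<le> 10 * stretch\<^sup>2" "\<bar>stretch * s2\<bar> \<le> 10 * stretch\<^sup>2" "\<bar>stretch * s1\<bar> \<le> 10 * stretch\<^sup>2"
    "\<bar>r2 * (stretch * s1) + r1\<bar> \<le> 10 * stretch\<^sup>2" "\<bar>r2\<bar> \<le> 10 * stretch\<^sup>2" "\<bar>0::real\<bar> \<le> 10 * stretch\<^sup>2" "\<bar>1::real\<bar> \<le> 10 * stretch\<^sup>2"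
    using m1 m3 m2[OF b(1)] m2[OF b(2)] b st by linarith+
  then show ?thesis unfolding J using exhaust_3[of i] exhaust_3[of j] by (elim disjE) simp_all
qed

lemma torus_jacobian_bound: obtains K where "0 \<le> K" "\<And>p i j. \<bar>torus_jacobian dynamo_map p $ i $ j\<bar> \<le> K"
proof
  \<comment> \<open>A bound for the entries of the unknown matrix that the Jacobian takes on the
    creases.\<close>
  define S where "S = (\<Sum>i\<in>UNIV. \<Sum>j\<in>UNIV. \<bar>(THE A::real^3^3. False) $ i $ j\<bar>)"
  have S: "\<bar>(THE A::real^3^3. False) $ i $ j\<bar> \<le> S" for i j
  proof -
    have "\<bar>(THE A::real^3^3. False) $ i $ j\<bar> \<le> (\<Sum>j\<in>UNIV. \<bar>(THE A::real^3^3. False) $ i $ j\<bar>)"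
      by (rule member_le_sum) auto
    also have "\<dots> \<le> S" unfolding S_def by (rule member_le_sum) (auto intro: sum_nonneg)
    finally show ?thesis .
  qed
  have S0: "0 \<le> S" unfolding S_def by (intro sum_nonneg) auto
  show "0 \<le> S + 10 * stretch\<^sup>2" using S0 by simp
  show "\<bar>torus_jacobian dynamo_map p $ i $ j\<bar> \<le> S + 10 * stretch\<^sup>2" for p i j
  proof (cases "singular p")
    case True
    then show ?thesis using S[of i j] by (simp add: torus_jacobian_dynamo add_increasing2)
  next
    case False
    then show ?thesis using S0 dynamo_jac_bound[of p i j] by (simp add: torus_jacobian_dynamo)
  qed
qed

lemma push_forward_dynamo:
  "push_forward dynamo_map B q = (\<chi> i. \<Sum>j\<in>UNIV. of_real (torus_jacobian dynamo_map (dynamo_inv q) $ i $ j) * B (dynamo_inv q) $ j)"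
  by (simp add: push_forward_def inv_dynamo)

lemma borel_push_forward:
  assumes B[measurable]: "B \<in> borel_measurable borel"
  shows "push_forward dynamo_map B \<in> borel_measurable borel"
proof -
  note [measurable] = borel_torus_jacobian
  have "(\<lambda>p. \<chi> i. \<Sum>j\<in>UNIV. of_real (torus_jacobian dynamo_map p $ i $ j) * B p $ j) \<in> borel_measurable borel"
    by (intro borel_vec_lambda) measurable
  then have "(\<lambda>q. (\<lambda>p. \<chi> i. \<Sum>j\<in>UNIV. of_real (torus_jacobian dynamo_map p $ i $ j) * B p $ j) (dynamo_inv q)) \<in> borel_measurable borel"
    by (rule measurable_compose[OF borel_dynamo(2)])
  then show ?thesis unfolding push_forward_dynamo[abs_def] .
qed

lemma norm_push_forward:
  obtains C where "0 \<le> C" "\<And>B q. norm (push_forward dynamo_map B q) \<le> C * norm (B (dynamo_inv q))"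
proof -
  obtain K where K: "0 \<le> K" "\<And>p i j. \<bar>torus_jacobian dynamo_map p $ i $ j\<bar> \<le> K"
    using torus_jacobian_bound by blast
  have "norm (push_forward dynamo_map B q) \<le> (9 * K) * norm (B (dynamo_inv q))" for B q
  proof -
    define b where "b = B (dynamo_inv q)"
    have t: "norm (of_real (torus_jacobian dynamo_map (dynamo_inv q) $ i $ j) * b $ j) \<le> K * norm b" for i j
      unfolding norm_mult norm_of_real using K Finite_Cartesian_Product.norm_nth_le[of b j] by (intro mult_mono) auto
    have "norm (push_forward dynamo_map B q $ i) \<le> 3 * (K * norm b)" for i
    proof -
      have "norm (push_forward dynamo_map B q $ i) \<le> (\<Sum>j\<in>(UNIV::3 set). K * norm b)"
        unfolding push_forward_dynamo b_def[symmetric] vec_lambda_beta by (rule sum_norm_le) (rule t)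
      then show ?thesis by simp
    qed
    then have "norm (push_forward dynamo_map B q) \<le> 3 * (3 * (K * norm b))" by (rule norm_vec_lambda_le)
    then show ?thesis by (simp add: b_def)
  qed
  then show ?thesis using that[of "9 * K"] K by simp
qed

lemma nn_integral_dynamo_inv:
  assumes "f \<in> borel_measurable borel"
  shows "(\<integral>\<^sup>+p. f (dynamo_inv p) \<partial>torus_measure) = (\<integral>\<^sup>+p. f p \<partial>torus_measure)"
  using nn_integral_dynamo[OF measurable_compose[OF borel_dynamo(2) assms]] by simp

lemma l2_bounded_push_forward: "\<exists>C. l2_bounded (push_forward dynamo_map) C"
proof -
  obtain C where C: "0 \<le> C" "\<And>B q. norm (push_forward dynamo_map B q) \<le> C * norm (B (dynamo_inv q))"
    using norm_push_forward by blast
  have "l2_bounded (push_forward dynamo_map) C"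
    unfolding l2_bounded_def
  proof (intro conjI ballI allI C(1))
    fix B assume B: "B \<in> l2_fields"
    then have [measurable]: "B \<in> borel_measurable borel" by (simp add: l2_fields_iff)
    have "sq_mass (push_forward dynamo_map B) \<le> (\<integral>\<^sup>+q. ennreal (C\<^sup>2) * ennreal ((norm (B (dynamo_inv q)))\<^sup>2) \<partial>torus_measure)"
      unfolding sq_mass_def
    proof (rule nn_integral_mono)
      fix q
      have "(norm (push_forward dynamo_map B q))\<^sup>2 \<le> (C * norm (B (dynamo_inv q)))\<^sup>2"
        using C(2) by (intro power_mono) auto
      then show "ennreal ((norm (push_forward dynamo_map B q))\<^sup>2) \<le> ennreal (C\<^sup>2) * ennreal ((norm (B (dynamo_inv q)))\<^sup>2)"
        by (simp add: power_mult_distrib flip: ennreal_mult)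
    qed
    also have "\<dots> = (\<integral>\<^sup>+q. ennreal (C\<^sup>2) * ennreal ((norm (B q))\<^sup>2) \<partial>torus_measure)"
      by (rule nn_integral_dynamo_inv) measurable
    also have "\<dots> = ennreal (C\<^sup>2) * sq_mass B"
      unfolding sq_mass_def by (rule nn_integral_cmult) simp
    finally show "push_forward dynamo_map B \<in> l2_fields" "l2_norm (push_forward dynamo_map B) \<le> C * l2_norm B"
      using l2_field_bound[OF B borel_push_forward C(1)] by auto
    show "push_forward dynamo_map (\<lambda>p. r *\<^sub>R B p) = (\<lambda>p. r *\<^sub>R push_forward dynamo_map B p)" for r
      by (auto simp: push_forward_dynamo fun_eq_iff vec_eq_iff scaleR_sum_right)
  qed
  then show ?thesis ..
qed

section \<open>Boundedness of the heat flow\<close>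

lemma borel_heat:
  assumes [measurable]: "B \<in> borel_measurable borel"
  shows "heat \<epsilon> B \<in> borel_measurable borel"
proof -
  have "(\<lambda>(p, y). heat_kernel \<epsilon> y *\<^sub>R B (torus_shift (- y) p)) \<in> borel_measurable (borel \<Otimes>\<^sub>M lborel)"
    by measurable
  then show ?thesis unfolding heat_def[abs_def] by (rule lborel.borel_measurable_lebesgue_integral)
qed

text \<open>Cauchy-Schwarz with the kernel split into two square roots, one factor having total mass
  1. Where the integrand is not integrable the value of \<open>heat\<close> is 0 by convention and
  the estimate is trivial.\<close>

lemma norm_heat_sq:
  assumes \<epsilon>: "0 < \<epsilon>" and [measurable]: "B \<in> borel_measurable borel"
  shows "ennreal ((norm (heat \<epsilon> B p))\<^sup>2) \<le> (\<integral>\<^sup>+y. ennreal (heat_kernel \<epsilon> y) * ennreal ((norm (B (torus_shift (- y) p)))\<^sup>2) \<partial>lborel)"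
proof -
  define f where "f = (\<lambda>y. ennreal (sqrt (heat_kernel \<epsilon> y)))"
  define g where "g = (\<lambda>y. ennreal (sqrt (heat_kernel \<epsilon> y) * norm (B (torus_shift (- y) p))))"
  have [measurable]: "f \<in> borel_measurable lborel" "g \<in> borel_measurable lborel"
    unfolding f_def g_def by measurable
  have "ennreal (norm (heat \<epsilon> B p)) \<le> (\<integral>\<^sup>+y. ennreal (norm (heat_kernel \<epsilon> y *\<^sub>R B (torus_shift (- y) p))) \<partial>lborel)"
  proof (cases "integrable lborel (\<lambda>y. heat_kernel \<epsilon> y *\<^sub>R B (torus_shift (- y) p))")
    case True
    then show ?thesis unfolding heat_def by (rule integral_norm_bound_ennreal)
  next
    case False
    then show ?thesis by (simp add: heat_def not_integrable_integral_eq)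
  qed
  also have "\<dots> = (\<integral>\<^sup>+y. f y * g y \<partial>lborel)"
    unfolding f_def g_def by (intro nn_integral_cong) (simp add: mult.assoc[symmetric] flip: ennreal_mult)
  finally have "ennreal (norm (heat \<epsilon> B p))^2 \<le> (\<integral>\<^sup>+y. f y * g y \<partial>lborel)^2"
    by (rule power_mono) simp
  also have "\<dots> \<le> (\<integral>\<^sup>+y. f y ^ 2 \<partial>lborel) * (\<integral>\<^sup>+y. g y ^ 2 \<partial>lborel)"
    by (rule Cauchy_Schwarz_nn_integral) measurable
  also have "(\<integral>\<^sup>+y. f y ^ 2 \<partial>lborel) = 1"
    using nn_integral_heat_kernel(1)[OF \<epsilon>] by (simp add: f_def ennreal_power)
  also have "(\<integral>\<^sup>+y. g y ^ 2 \<partial>lborel) = (\<integral>\<^sup>+y. ennreal (heat_kernel \<epsilon> y) * ennreal ((norm (B (torus_shift (- y) p)))\<^sup>2) \<partial>lborel)"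
    by (simp add: g_def ennreal_power power_mult_distrib ennreal_mult)
  finally show ?thesis by (simp add: ennreal_power)
qed

lemma l2_bounded_heat:
  assumes \<epsilon>: "0 < \<epsilon>" shows "l2_bounded (heat \<epsilon>) 1"
  unfolding l2_bounded_def
proof (intro conjI ballI allI)
  fix B assume B: "B \<in> l2_fields"
  then have [measurable]: "B \<in> borel_measurable borel" by (simp add: l2_fields_iff)
  interpret P: pair_sigma_finite "torus_measure" "lborel :: (real^3) measure" ..
  have "sq_mass (heat \<epsilon> B) \<le> (\<integral>\<^sup>+p. \<integral>\<^sup>+y. ennreal (heat_kernel \<epsilon> y) * ennreal ((norm (B (torus_shift (- y) p)))\<^sup>2) \<partial>lborel \<partial>torus_measure)"
    unfolding sq_mass_def by (intro nn_integral_mono norm_heat_sq[OF \<epsilon>]) measurable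
  also have "\<dots> = (\<integral>\<^sup>+y. \<integral>\<^sup>+p. ennreal (heat_kernel \<epsilon> y) * ennreal ((norm (B (torus_shift (- y) p)))\<^sup>2) \<partial>torus_measure \<partial>lborel)"
  proof (rule P.Fubini'[symmetric])
    have "(\<lambda>(p, y). ennreal (heat_kernel \<epsilon> y) * ennreal ((norm (B (torus_shift (- y) p)))\<^sup>2)) \<in> borel_measurable (borel \<Otimes>\<^sub>M borel)"
      by measurable
    then show "(\<lambda>(p, y). ennreal (heat_kernel \<epsilon> y) * ennreal ((norm (B (torus_shift (- y) p)))\<^sup>2)) \<in> borel_measurable (torus_measure \<Otimes>\<^sub>M lborel)"
      by (simp cong: measurable_cong_sets)
  qed
  also have "\<dots> = (\<integral>\<^sup>+y. ennreal (heat_kernel \<epsilon> y) * sq_mass B \<partial>lborel)"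
  proof (rule nn_integral_cong)
    fix y :: "real^3"
    have "(\<integral>\<^sup>+p. ennreal (heat_kernel \<epsilon> y) * ennreal ((norm (B (torus_shift (- y) p)))\<^sup>2) \<partial>torus_measure)
       = (\<integral>\<^sup>+p. ennreal (heat_kernel \<epsilon> y) * ennreal ((norm (B p))\<^sup>2) \<partial>torus_measure)"
      by (rule nn_integral_torus_shift) measurable
    also have "\<dots> = ennreal (heat_kernel \<epsilon> y) * sq_mass B"
      unfolding sq_mass_def by (rule nn_integral_cmult) simp
    finally show "(\<integral>\<^sup>+p. ennreal (heat_kernel \<epsilon> y) * ennreal ((norm (B (torus_shift (- y) p)))\<^sup>2) \<partial>torus_measure)
       = ennreal (heat_kernel \<epsilon> y) * sq_mass B" .
  qed
  also have "\<dots> = ennreal (1\<^sup>2) * sq_mass B"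
    using nn_integral_heat_kernel(1)[OF \<epsilon>] by (simp add: nn_integral_multc)
  finally show "heat \<epsilon> B \<in> l2_fields" "l2_norm (heat \<epsilon> B) \<le> 1 * l2_norm B"
    using l2_field_bound[OF B borel_heat, of B 1 \<epsilon>] by auto
  show "heat \<epsilon> (\<lambda>p. r *\<^sub>R B p) = (\<lambda>p. r *\<^sub>R heat \<epsilon> B p)" for r
  proof
    fix p
    show "heat \<epsilon> (\<lambda>p. r *\<^sub>R B p) p = r *\<^sub>R heat \<epsilon> B p"
      unfolding heat_def integral_scaleR_right[symmetric] scaleR_left_commute[of r] ..
  qed
qed simp

section \<open>Duality\<close>

text \<open>Duality is carried out on bounded fields: all pairings and kernel integrals converge,
  and the push-forward, the pull-back and the heat flow preserve the class. It contains both test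
  fields of the final argument.\<close>

definition bounded_field :: "(torus3 \<Rightarrow> complex^3) \<Rightarrow> bool" where
  "bounded_field B \<longleftrightarrow> B \<in> borel_measurable borel \<and> (\<exists>C. \<forall>p. norm (B p) \<le> C)"

lemma bounded_field_borel: "bounded_field B \<Longrightarrow> B \<in> borel_measurable borel"
  by (simp add: bounded_field_def)

definition dot_field :: "(torus3 \<Rightarrow> complex^3) \<Rightarrow> (torus3 \<Rightarrow> complex^3) \<Rightarrow> torus3 \<Rightarrow> complex" where
  "dot_field w B p = (\<Sum>i\<in>UNIV. w p $ i * B p $ i)"

text \<open>Bilinear, without complex conjugation: a 1-form is evaluated on a vector field. For this
  pairing pull-back is the transpose of push-forward.\<close>

definition pairing :: "(torus3 \<Rightarrow> complex^3) \<Rightarrow> (torus3 \<Rightarrow> complex^3) \<Rightarrow> complex" where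
  "pairing w B = (\<integral>p. dot_field w B p \<partial>torus_measure)"

text \<open>Built from \<open>dynamo_jac\<close>, which follows the explicit matrix on the creases
  too. It agrees with the Jacobian off a null set, which suffices under the integral, and lets the
  formulas for slices hold at every point.\<close>

definition pull_back :: "(torus3 \<Rightarrow> complex^3) \<Rightarrow> torus3 \<Rightarrow> complex^3" where
  "pull_back w p = (\<chi> j. \<Sum>i\<in>UNIV. of_real (dynamo_jac p $ i $ j) * w (dynamo_map p) $ i)"

lemma integral_torus_invariant:
  fixes f :: "torus3 \<Rightarrow> complex"
  assumes g: "g \<in> borel_measurable borel"
    and inv: "\<And>f. f \<in> borel_measurable borel \<Longrightarrow> (\<integral>\<^sup>+p. f (g p) \<partial>torus_measure) = (\<integral>\<^sup>+p. f p \<partial>torus_measure)"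
    and f: "f \<in> borel_measurable borel"
  shows "(\<integral>p. f (g p) \<partial>torus_measure) = (\<integral>p. f p \<partial>torus_measure)"
  using integral_distr[OF distr_torus(1)[OF g inv], of f] distr_torus(2)[OF g inv] f by simp

lemma borel_dot_field:
  assumes [measurable]: "w \<in> borel_measurable borel" "B \<in> borel_measurable borel"
  shows "dot_field w B \<in> borel_measurable borel"
  unfolding dot_field_def[abs_def] by measurable

lemma norm_dot_field:
  assumes "\<And>i. norm (w p $ i) \<le> C" shows "norm (dot_field w B p) \<le> 3 * (C * norm (B p))"
proof -
  have "0 \<le> C" using assms norm_ge_zero order_trans by blast
  then have "norm (w p $ i * B p $ i) \<le> C * norm (B p)" for i
    unfolding norm_mult using assms Finite_Cartesian_Product.norm_nth_le[of "B p" i] by (intro mult_mono) auto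
  then have "norm (dot_field w B p) \<le> (\<Sum>i\<in>(UNIV::3 set). C * norm (B p))"
    unfolding dot_field_def by (rule sum_norm_le)
  then show ?thesis by simp
qed

lemma bounded_field_nth:
  assumes "bounded_field w" obtains C where "0 \<le> C" "\<And>p i. norm (w p $ i) \<le> C" "\<And>p. norm (w p) \<le> C"
proof -
  obtain C where C: "\<And>p. norm (w p) \<le> C" using assms by (auto simp: bounded_field_def)
  have "0 \<le> C" using C[of undefined] norm_ge_zero order_trans by blast
  moreover have "norm (w p $ i) \<le> C" for p i
    using C[of p] Finite_Cartesian_Product.norm_nth_le[of "w p" i] by linarith
  ultimately show ?thesis using that C by blast
qed

lemma bounded_field_push_forward:
  assumes "bounded_field B" shows "bounded_field (push_forward dynamo_map B)"
proof -
  obtain C where C: "\<And>p. norm (B p) \<le> C" using bounded_field_nth[OF assms] by metis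
  obtain K where K: "0 \<le> K" "\<And>B q. norm (push_forward dynamo_map B q) \<le> K * norm (B (dynamo_inv q))"
    using norm_push_forward by blast
  have "norm (push_forward dynamo_map B q) \<le> K * C" for q
    using K(2)[of B q] mult_left_mono[OF C K(1), of "dynamo_inv q"] by linarith
  then show ?thesis using borel_push_forward assms unfolding bounded_field_def by blast
qed

lemma integrable_heat:
  assumes \<epsilon>: "0 < \<epsilon>" and B: "bounded_field B"
  shows "integrable lborel (\<lambda>y. heat_kernel \<epsilon> y *\<^sub>R B (torus_shift (- y) p))"
proof -
  obtain C where C: "0 \<le> C" "\<And>p. norm (B p) \<le> C" using bounded_field_nth[OF B] by metis
  note [measurable] = bounded_field_borel[OF B]
  show ?thesis
  proof (rule Bochner_Integration.integrable_bound)
    show "integrable lborel (\<lambda>y. C * heat_kernel \<epsilon> y)" using integral_heat_kernel(1)[OF \<epsilon>] by simp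
    show "AE y in lborel. norm (heat_kernel \<epsilon> y *\<^sub>R B (torus_shift (- y) p)) \<le> norm (C * heat_kernel \<epsilon> y)"
      using C by (auto simp: mult.commute[of C] intro!: AE_I2 mult_left_mono)
  qed measurable
qed

lemma bounded_field_heat:
  assumes \<epsilon>: "0 < \<epsilon>" and B: "bounded_field B" shows "bounded_field (heat \<epsilon> B)"
proof -
  obtain C where C: "0 \<le> C" "\<And>p. norm (B p) \<le> C" using bounded_field_nth[OF B] by metis
  have "norm (heat \<epsilon> B p) \<le> C" for p
  proof -
    have "norm (heat \<epsilon> B p) \<le> (\<integral>y. norm (heat_kernel \<epsilon> y *\<^sub>R B (torus_shift (- y) p)) \<partial>lborel)"
      unfolding heat_def by (rule integral_norm_bound)
    also have "\<dots> \<le> (\<integral>y. C * heat_kernel \<epsilon> y \<partial>lborel)"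
      using integrable_norm[OF integrable_heat[OF \<epsilon> B]] integral_heat_kernel(1)[OF \<epsilon>] C
      by (intro integral_mono) (auto simp: mult.commute[of C] intro!: mult_left_mono)
    also have "\<dots> = C" using integral_heat_kernel(2)[OF \<epsilon>] by simp
    finally show ?thesis .
  qed
  then show ?thesis using borel_heat[OF bounded_field_borel[OF B]] by (auto simp: bounded_field_def)
qed

lemma bounded_field_pull_back:
  assumes "bounded_field w" shows "bounded_field (pull_back w)"
proof -
  obtain C where C: "0 \<le> C" "\<And>p i. norm (w p $ i) \<le> C" using bounded_field_nth[OF assms] by metis
  note [measurable] = borel_dynamo_jac
  have [measurable]: "(\<lambda>p. w (dynamo_map p)) \<in> borel_measurable borel"
    by (rule measurable_compose[OF borel_dynamo(1) bounded_field_borel[OF assms]])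
  have "pull_back w \<in> borel_measurable borel"
    unfolding pull_back_def[abs_def] by (intro borel_vec_lambda) measurable
  moreover have "norm (pull_back w p) \<le> 3 * (3 * (10 * stretch\<^sup>2 * C))" for p
  proof (rule norm_vec_lambda_le)
    fix j
    have "norm (pull_back w p $ j) \<le> (\<Sum>i\<in>(UNIV::3 set). 10 * stretch\<^sup>2 * C)"
      unfolding pull_back_def vec_lambda_beta
    proof (rule sum_norm_le)
      fix i
      show "norm (of_real (dynamo_jac p $ i $ j) * w (dynamo_map p) $ i) \<le> 10 * stretch\<^sup>2 * C"
        unfolding norm_mult norm_of_real using dynamo_jac_bound C by (intro mult_mono) auto
    qed
    then show "norm (pull_back w p $ j) \<le> 3 * (10 * stretch\<^sup>2 * C)" by simp
  qed
  ultimately show ?thesis unfolding bounded_field_def by blast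
qed

text \<open>The zeros of sin (2 \<pi> x) are countable. The creases of the second shear are the
  preimage of such a null set under the first shear, which preserves the measure.\<close>

lemma AE_not_singular: "AE p in torus_measure. \<not> singular p"
proof -
  have null: "AE x in lborel. sin (2 * pi * x) \<noteq> (0::real)"
  proof -
    have "range (\<lambda>k::int. of_int k / 2) \<in> null_sets (lborel :: real measure)"
      by (rule countable_imp_null_set_lborel) simp
    then show ?thesis by (rule AE_I') (auto simp: sin_zero_half_int)
  qed
  have c: "cube_sum (\<lambda>x. indicator {0} (sin (2 * pi * x)) * k) = 0" for k
  proof -
    have "(\<integral>\<^sup>+x. indicator {0..<1} x * (indicator {0} (sin (2 * pi * x)) * k) \<partial>lborel) = nn_integral lborel (\<lambda>x::real. 0)"
      by (rule nn_integral_cong_AE) (use null in \<open>auto elim!: eventually_mono simp: indicator_def\<close>)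
    then show ?thesis by (simp add: cube_sum_def)
  qed
  have k: "cube_sum (\<lambda>z. k) = k" for k by (simp add: cube_sum_def nn_integral_multc)
  have 1: "(\<integral>\<^sup>+p. indicator {0} (tsin 1 p) \<partial>torus_measure) = 0"
    using c[of 1] by (subst nn_integral_torus) (auto simp: k)
  have 2: "(\<integral>\<^sup>+p. indicator {0} (tsin 2 p) \<partial>torus_measure) = 0"
    using c[of 1] by (subst nn_integral_torus) (auto simp: k)
  have 3: "(\<integral>\<^sup>+p. indicator {0} (tsin 2 (shear1 1 p)) \<partial>torus_measure) = 0"
    using nn_integral_shear1[of "\<lambda>p. indicator {0} (tsin 2 p)" 1] 2 by simp
  have [measurable]: "shear1 1 \<in> borel_measurable borel" by (rule borel_shears) simp
  have "AE p in torus_measure. indicator {0} (tsin 1 p) = (0::ennreal)"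
    using 1 by (subst (asm) nn_integral_0_iff_AE) auto
  moreover have "AE p in torus_measure. indicator {0} (tsin 2 (shear1 1 p)) = (0::ennreal)"
    using 3 by (subst (asm) nn_integral_0_iff_AE) auto
  ultimately show ?thesis
    by eventually_elim (auto simp: singular_def indicator_def split: if_splits)
qed

text \<open>Substituting the image point for the variable removes the inverse map from the
  push-forward; the Jacobian then moves to the other factor as its transpose.\<close>

lemma pairing_push_forward:
  assumes w: "bounded_field w" and B: "bounded_field B"
  shows "pairing w (push_forward dynamo_map B) = pairing (pull_back w) B"
proof -
  have m: "dot_field w (push_forward dynamo_map B) \<in> borel_measurable borel"
    by (intro borel_dot_field borel_push_forward bounded_field_borel w B)
  have "pairing w (push_forward dynamo_map B) = (\<integral>p. dot_field w (push_forward dynamo_map B) (dynamo_map p) \<partial>torus_measure)"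
    unfolding pairing_def by (rule integral_torus_invariant[OF borel_dynamo(1) nn_integral_dynamo m, symmetric])
  also have "\<dots> = (\<integral>p. dot_field (pull_back w) B p \<partial>torus_measure)"
  proof (rule integral_cong_AE)
    show "(\<lambda>p. dot_field w (push_forward dynamo_map B) (dynamo_map p)) \<in> borel_measurable torus_measure"
      using measurable_compose[OF borel_dynamo(1) m] by simp
    show "dot_field (pull_back w) B \<in> borel_measurable torus_measure"
      using borel_dot_field[OF bounded_field_borel[OF bounded_field_pull_back[OF w]] bounded_field_borel[OF B]] by simp
    show "AE p in torus_measure. dot_field w (push_forward dynamo_map B) (dynamo_map p) = dot_field (pull_back w) B p"
      using AE_not_singular
    proof eventually_elim
      case (elim p)
      then show ?case
        by (simp add: dot_field_def push_forward_dynamo pull_back_def torus_jacobian_dynamo sum_3 algebra_simps)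
    qed
  qed
  finally show ?thesis by (simp add: pairing_def)
qed

lemma integrable_kernel_product:
  fixes F :: "torus3 \<times> (real^3) \<Rightarrow> complex"
  assumes \<epsilon>: "0 < \<epsilon>" and F: "F \<in> borel_measurable (torus_measure \<Otimes>\<^sub>M lborel)"
    and C: "0 \<le> C" "\<And>p y. norm (F (p, y)) \<le> C * heat_kernel \<epsilon> y"
  shows "integrable (torus_measure \<Otimes>\<^sub>M lborel) F"
proof (rule integrableI_bounded[OF F])
  have "(\<integral>\<^sup>+z. norm (F z) \<partial>(torus_measure \<Otimes>\<^sub>M lborel)) = (\<integral>\<^sup>+p. \<integral>\<^sup>+y. norm (F (p, y)) \<partial>lborel \<partial>torus_measure)"
    by (rule lborel.nn_integral_fst[symmetric]) (rule measurable_compose[OF F], measurable)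
  also have "\<dots> \<le> (\<integral>\<^sup>+p. \<integral>\<^sup>+y. ennreal C * ennreal (heat_kernel \<epsilon> y) \<partial>lborel \<partial>torus_measure)"
    using C by (intro nn_integral_mono) (simp flip: ennreal_mult)
  also have "\<dots> = ennreal C * emeasure torus_measure (space torus_measure)"
    using nn_integral_heat_kernel(1)[OF \<epsilon>] by (simp add: nn_integral_cmult)
  also have "\<dots> < \<infinity>" by (simp only: torus.emeasure_space_1) simp
  finally show "(\<integral>\<^sup>+z. norm (F z) \<partial>(torus_measure \<Otimes>\<^sub>M lborel)) < \<infinity>" .
qed

lemma torus_shift_add: "torus_shift v (torus_shift w p) = torus_shift (w + v) p"
proof -
  obtain x where "p = proj x" using proj_surj by blast
  then show ?thesis by (simp add: torus_shift.abs_eq add.assoc)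
qed

lemma torus_shift_0: "torus_shift 0 p = p"
proof -
  obtain x where "p = proj x" using proj_surj by blast
  then show ?thesis by (simp add: torus_shift.abs_eq)
qed

lemma pairing_heat_iterated:
  assumes \<epsilon>: "0 < \<epsilon>" and w: "bounded_field w" and B: "bounded_field B"
  shows "pairing w (heat \<epsilon> B) = (\<integral>y. heat_kernel \<epsilon> y *\<^sub>R (\<integral>p. (\<Sum>i\<in>UNIV. w p $ i * B (torus_shift (- y) p) $ i) \<partial>torus_measure) \<partial>lborel)"
proof -
  obtain Cw where Cw: "0 \<le> Cw" "\<And>p i. norm (w p $ i) \<le> Cw" using bounded_field_nth[OF w] by metis
  obtain CB where CB: "0 \<le> CB" "\<And>p. norm (B p) \<le> CB" using bounded_field_nth[OF B] by metis
  note [measurable] = bounded_field_borel[OF w] bounded_field_borel[OF B]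
  define F where "F = (\<lambda>(p, y). heat_kernel \<epsilon> y *\<^sub>R (\<Sum>i\<in>UNIV. w p $ i * B (torus_shift (- y) p) $ i))"
  interpret P: pair_sigma_finite torus_measure "lborel :: (real^3) measure" ..
  have Fm: "F \<in> borel_measurable (torus_measure \<Otimes>\<^sub>M lborel)"
  proof -
    have "F \<in> borel_measurable (borel \<Otimes>\<^sub>M borel)" unfolding F_def by measurable
    then show ?thesis by (simp cong: measurable_cong_sets)
  qed
  have Fi: "integrable (torus_measure \<Otimes>\<^sub>M lborel) F"
  proof (rule integrable_kernel_product[OF \<epsilon> Fm])
    show "0 \<le> 3 * (Cw * CB)" using Cw CB by simp
    fix p y
    have "norm (\<Sum>i\<in>UNIV. w p $ i * B (torus_shift (- y) p) $ i) \<le> 3 * (Cw * norm (B (torus_shift (- y) p)))"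
      using norm_dot_field[of w p Cw "\<lambda>q. B (torus_shift (- y) q)"] Cw by (simp add: dot_field_def)
    also have "\<dots> \<le> 3 * (Cw * CB)" using Cw CB by (intro mult_left_mono) auto
    finally show "norm (F (p, y)) \<le> 3 * (Cw * CB) * heat_kernel \<epsilon> y"
      unfolding F_def by (simp add: mult.commute[of _ "heat_kernel \<epsilon> y"] mult_left_mono)
  qed
  have "dot_field w (heat \<epsilon> B) p = (\<integral>y. F (p, y) \<partial>lborel)" for p
  proof -
    note ih = integrable_heat[OF \<epsilon> B, of p]
    have nth: "heat \<epsilon> B p $ i = (\<integral>y. (heat_kernel \<epsilon> y *\<^sub>R B (torus_shift (- y) p)) $ i \<partial>lborel)" for i
      unfolding heat_def by (rule integral_bounded_linear[OF bounded_linear_vec_nth ih, symmetric])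
    have ii: "integrable lborel (\<lambda>y. (heat_kernel \<epsilon> y *\<^sub>R B (torus_shift (- y) p)) $ i)" for i
      by (rule integrable_bounded_linear[OF bounded_linear_vec_nth ih])
    have "dot_field w (heat \<epsilon> B) p = (\<integral>y. (\<Sum>i\<in>UNIV. w p $ i * (heat_kernel \<epsilon> y *\<^sub>R B (torus_shift (- y) p)) $ i) \<partial>lborel)"
    proof -
      have "(\<integral>y. (\<Sum>i\<in>UNIV. w p $ i * (heat_kernel \<epsilon> y *\<^sub>R B (torus_shift (- y) p)) $ i) \<partial>lborel)
          = (\<Sum>i\<in>UNIV. (\<integral>y. w p $ i * (heat_kernel \<epsilon> y *\<^sub>R B (torus_shift (- y) p)) $ i \<partial>lborel))"
        by (rule Bochner_Integration.integral_sum) (intro integrable_mult_right ii)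
      also have "\<dots> = (\<Sum>i\<in>UNIV. w p $ i * (\<integral>y. (heat_kernel \<epsilon> y *\<^sub>R B (torus_shift (- y) p)) $ i \<partial>lborel))"
        by (rule sum.cong[OF refl], rule Bochner_Integration.integral_mult_right, rule ii)
      finally show ?thesis unfolding dot_field_def nth by (rule sym)
    qed
    then show ?thesis by (simp add: F_def scaleR_sum_right)
  qed
  then have "pairing w (heat \<epsilon> B) = (\<integral>p. (\<integral>y. F (p, y) \<partial>lborel) \<partial>torus_measure)"
    by (simp add: pairing_def)
  also have "\<dots> = (\<integral>y. (\<integral>p. F (p, y) \<partial>torus_measure) \<partial>lborel)"
    using P.Fubini_integral[of "\<lambda>p y. F (p, y)"] Fi by simp
  finally show ?thesis by (simp add: F_def)
qed

text \<open>The heat flow is self-adjoint: translation invariance moves the shift from B to w with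
  the opposite sign, and the kernel is even.\<close>

lemma pairing_heat:
  assumes \<epsilon>: "0 < \<epsilon>" and w: "bounded_field w" and B: "bounded_field B"
  shows "pairing w (heat \<epsilon> B) = pairing (heat \<epsilon> w) B"
proof -
  note [measurable] = bounded_field_borel[OF w] bounded_field_borel[OF B]
  define G where "G = (\<lambda>y. \<integral>p. (\<Sum>i\<in>UNIV. B p $ i * w (torus_shift (- y) p) $ i) \<partial>torus_measure)"
  have sw: "(\<integral>p. (\<Sum>i\<in>UNIV. w p $ i * B (torus_shift (- y) p) $ i) \<partial>torus_measure) = G (- y)" for y
  proof -
    have "(\<lambda>p. torus_shift y p) \<in> borel_measurable borel" by measurable
    moreover have "(\<lambda>p. \<Sum>i\<in>UNIV. w p $ i * B (torus_shift (- y) p) $ i) \<in> borel_measurable borel" by measurable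
    ultimately have "(\<integral>p. (\<Sum>i\<in>UNIV. w (torus_shift y p) $ i * B (torus_shift (- y) (torus_shift y p)) $ i) \<partial>torus_measure)
        = (\<integral>p. (\<Sum>i\<in>UNIV. w p $ i * B (torus_shift (- y) p) $ i) \<partial>torus_measure)"
      by (intro integral_torus_invariant[where g = "torus_shift y" and f = "\<lambda>p. \<Sum>i\<in>UNIV. w p $ i * B (torus_shift (- y) p) $ i"] nn_integral_torus_shift)
    then show ?thesis by (simp add: G_def torus_shift_add torus_shift_0 mult.commute)
  qed
  have "pairing w (heat \<epsilon> B) = (\<integral>y. heat_kernel \<epsilon> y *\<^sub>R G (- y) \<partial>lborel)"
    unfolding pairing_heat_iterated[OF \<epsilon> w B] sw ..
  also have "\<dots> = (\<integral>y. heat_kernel \<epsilon> y *\<^sub>R G y \<partial>lborel)"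
  proof -
    have "(\<lambda>(y, p). \<Sum>i\<in>UNIV. B p $ i * w (torus_shift (- y) p) $ i) \<in> borel_measurable (borel \<Otimes>\<^sub>M borel)"
      by measurable
    then have "(\<lambda>(y, p). \<Sum>i\<in>UNIV. B p $ i * w (torus_shift (- y) p) $ i) \<in> borel_measurable (borel \<Otimes>\<^sub>M torus_measure)"
      by (simp cong: measurable_cong_sets)
    then have [measurable]: "G \<in> borel_measurable borel"
      unfolding G_def by (rule torus.borel_measurable_lebesgue_integral)
    have "(lborel :: (real^3) measure) = distr lborel borel uminus"
      using lborel_affine[of "-1" "0 :: real^3"] by (simp add: density_1)
    then have "(\<integral>y. heat_kernel \<epsilon> y *\<^sub>R G y \<partial>lborel) = (\<integral>y. heat_kernel \<epsilon> y *\<^sub>R G y \<partial>distr lborel borel uminus)"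
      by simp
    also have "\<dots> = (\<integral>y. heat_kernel \<epsilon> y *\<^sub>R G (- y) \<partial>lborel)"
      by (subst integral_distr) auto
    finally show ?thesis by (rule sym)
  qed
  also have "\<dots> = pairing B (heat \<epsilon> w)"
    unfolding pairing_heat_iterated[OF \<epsilon> B w] G_def ..
  also have "\<dots> = pairing (heat \<epsilon> w) B"
    by (simp add: pairing_def dot_field_def mult.commute)
  finally show ?thesis .
qed

text \<open>Taking transposes reverses the order, so on the dual side the heat flow acts before the
  pull-back. The factors are moved across one at a time, starting with the outermost, hence the
  induction runs over all w.\<close>

lemma pairing_iterate:
  assumes \<epsilon>: "0 < \<epsilon>" and B: "bounded_field B" and w: "bounded_field w"
  shows "pairing w (((heat \<epsilon> \<circ> push_forward dynamo_map) ^^ n) B) = pairing (((pull_back \<circ> heat \<epsilon>) ^^ n) w) B"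
    "bounded_field (((heat \<epsilon> \<circ> push_forward dynamo_map) ^^ n) B)"
proof -
  show K: "bounded_field (((heat \<epsilon> \<circ> push_forward dynamo_map) ^^ n) B)" for n
    by (induction n) (auto intro: B bounded_field_heat[OF \<epsilon>] bounded_field_push_forward)
  show "pairing w (((heat \<epsilon> \<circ> push_forward dynamo_map) ^^ n) B) = pairing (((pull_back \<circ> heat \<epsilon>) ^^ n) w) B"
    using w
  proof (induction n arbitrary: w)
    case (Suc n)
    define X where "X = ((heat \<epsilon> \<circ> push_forward dynamo_map) ^^ n) B"
    have X: "bounded_field X" unfolding X_def by (rule K)
    have h: "bounded_field (heat \<epsilon> w)" by (rule bounded_field_heat[OF \<epsilon> Suc.prems])
    have "pairing w (((heat \<epsilon> \<circ> push_forward dynamo_map) ^^ Suc n) B) = pairing w (heat \<epsilon> (push_forward dynamo_map X))"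
      by (simp add: X_def)
    also have "\<dots> = pairing (heat \<epsilon> w) (push_forward dynamo_map X)"
      by (rule pairing_heat[OF \<epsilon> Suc.prems bounded_field_push_forward[OF X]])
    also have "\<dots> = pairing (pull_back (heat \<epsilon> w)) X"
      by (rule pairing_push_forward[OF h X])
    also have "\<dots> = pairing (((pull_back \<circ> heat \<epsilon>) ^^ n) (pull_back (heat \<epsilon> w))) B"
      unfolding X_def by (rule Suc.IH[OF bounded_field_pull_back[OF h]])
    also have "((pull_back \<circ> heat \<epsilon>) ^^ n) (pull_back (heat \<epsilon> w)) = ((pull_back \<circ> heat \<epsilon>) ^^ Suc n) w"
      by (simp only: funpow_Suc_right o_apply)
    finally show ?case .
  qed simp
qed

section \<open>Pairings bounded by the L2 norm\<close>

lemma bounded_field_l2: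
  assumes B: "bounded_field B" shows "B \<in> l2_fields"
proof -
  obtain C where C: "0 \<le> C" "\<And>p. norm (B p) \<le> C" using bounded_field_nth[OF B] by metis
  have "sq_mass B \<le> (\<integral>\<^sup>+p. ennreal (C\<^sup>2) \<partial>torus_measure)"
    unfolding sq_mass_def using C by (intro nn_integral_mono ennreal_leI power_mono) auto
  also have "\<dots> < \<infinity>" using torus.emeasure_space_1 by (simp del: torus.emeasure_space_1)
  finally show ?thesis using bounded_field_borel[OF B] by (simp add: l2_fields_iff)
qed

text \<open>On a probability space the L1 norm is at most the L2 norm; the 3 is the number of
  components.\<close>

lemma norm_pairing:
  assumes w: "\<And>p i. norm (w p $ i) \<le> 1" and wm: "w \<in> borel_measurable borel" and B: "B \<in> l2_fields"
  shows "norm (pairing w B) \<le> 3 * l2_norm B"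
proof -
  have [measurable]: "B \<in> borel_measurable borel" using B by (simp add: l2_fields_iff)
  have "(\<integral>\<^sup>+p. ennreal (norm (B p)) * 1 \<partial>torus_measure)^2 \<le> (\<integral>\<^sup>+p. ennreal (norm (B p))^2 \<partial>torus_measure) * (\<integral>\<^sup>+p. 1^2 \<partial>torus_measure)"
    by (rule Cauchy_Schwarz_nn_integral) auto
  also have "\<dots> = sq_mass B"
    using torus.emeasure_space_1 by (simp add: sq_mass_def ennreal_power)
  also have "\<dots> = ennreal (l2_norm B)^2" using l2_norm_sq_mass[OF B] by (simp add: ennreal_power)
  finally have "(\<integral>\<^sup>+p. ennreal (norm (B p)) \<partial>torus_measure)^2 \<le> ennreal (l2_norm B)^2" by simp
  then have l1: "(\<integral>\<^sup>+p. ennreal (norm (B p)) \<partial>torus_measure) \<le> ennreal (l2_norm B)"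
  proof (cases "\<integral>\<^sup>+p. ennreal (norm (B p)) \<partial>torus_measure" rule: ennreal_cases)
    case (real r)
    then show ?thesis using \<open>_ \<le> ennreal (l2_norm B)^2\<close> power2_le_imp_le[of r "l2_norm B"]
      by (simp add: ennreal_power)
  next
    case top
    then show ?thesis using \<open>_ \<le> ennreal (l2_norm B)^2\<close> by (simp add: ennreal_power top_unique)
  qed
  have "ennreal (norm (pairing w B)) \<le> (\<integral>\<^sup>+p. ennreal (norm (dot_field w B p)) \<partial>torus_measure)"
  proof (cases "integrable torus_measure (dot_field w B)")
    case True
    then show ?thesis unfolding pairing_def by (rule integral_norm_bound_ennreal)
  next
    case False
    then show ?thesis by (simp add: pairing_def not_integrable_integral_eq)
  qed
  also have "\<dots> \<le> (\<integral>\<^sup>+p. 3 * ennreal (norm (B p)) \<partial>torus_measure)"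
  proof (rule nn_integral_mono)
    fix p
    have "norm (dot_field w B p) \<le> 3 * norm (B p)" using norm_dot_field[of w p 1 B] w by simp
    then have "ennreal (norm (dot_field w B p)) \<le> ennreal (3 * norm (B p))" by (rule ennreal_leI)
    then show "ennreal (norm (dot_field w B p)) \<le> 3 * ennreal (norm (B p))" by (simp add: ennreal_mult)
  qed
  also have "\<dots> = 3 * (\<integral>\<^sup>+p. ennreal (norm (B p)) \<partial>torus_measure)"
    by (rule nn_integral_cmult) simp
  also have "\<dots> \<le> 3 * ennreal (l2_norm B)" using l1 by (rule mult_left_mono) simp
  also have "\<dots> = ennreal (3 * l2_norm B)" by (simp add: ennreal_mult)
  finally show ?thesis by (subst (asm) ennreal_le_iff) auto
qed

section \<open>Growth\<close>

definition slice :: "3 \<Rightarrow> (torus3 \<Rightarrow> complex^3) \<Rightarrow> real \<Rightarrow> real \<Rightarrow> complex" where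
  "slice i w x y = w (mk x y 0) $ i"

text \<open>The 1-forms with a single mode in z and no dz part. The absence of dz is stable under
  pull-back because the first two rows of the Jacobian are 0 in the third column.\<close>

definition twisted :: "(torus3 \<Rightarrow> complex^3) \<Rightarrow> bool" where
  "twisted w \<longleftrightarrow> bounded_field w \<and> (\<forall>p. w p $ 3 = 0)
     \<and> (\<forall>x y z i. w (mk x y z) $ i = cis (2 * pi * z) * slice i w x y)"

lemma phase_rho: "phase x = cis (2 * pi * rho x)"
  by (simp add: phase_def rho_def)

text \<open>Pull-back reverses composition, so the inner step belongs to \<open>shear2\<close> and
  the outer one to \<open>shear1\<close>. Each step exchanges the two coordinates, and after both
  they are back in place.\<close>

lemma twisted_pull_back:
  assumes w: "twisted w"
  shows "twisted (pull_back w)" "slice 1 (pull_back w) = step1 (step1 (slice 1 w) (slice 2 w)) (step2 (slice 1 w))"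
    "slice 2 (pull_back w) = step2 (step1 (slice 1 w) (slice 2 w))"
proof -
  have bw: "bounded_field w" and w3: "\<And>p. w p $ 3 = 0"
    and tw: "\<And>x y z i. w (mk x y z) $ i = cis (2 * pi * z) * slice i w x y"
    using w by (auto simp: twisted_def)
  have s3: "slice 3 w x y = 0" for x y by (simp add: slice_def w3)
  have T: "dynamo_map (mk x y z) = mk (x + stretch * tent (y + stretch * tent x)) (y + stretch * tent x) (z + rho x + rho (y + stretch * tent x))" for x y z
    by (simp add: dynamo_map_def shear1_mk shear2_mk)
  have pb: "pull_back w (mk x y z) $ j = cis (2 * pi * z) * (phase x * phase (y + stretch * tent x) *
      (of_real (dynamo_jac (mk x y 0) $ 1 $ j) * slice 1 w (x + stretch * tent (y + stretch * tent x)) (y + stretch * tent x)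
      + of_real (dynamo_jac (mk x y 0) $ 2 $ j) * slice 2 w (x + stretch * tent (y + stretch * tent x)) (y + stretch * tent x)))" for x y z j
  proof -
    have "dynamo_jac (mk x y z) = dynamo_jac (mk x y 0)" by (simp add: dynamo_jac_def shear1_mk)
    moreover have "cis (2 * pi * (z + rho x + rho (y + stretch * tent x))) = cis (2 * pi * z) * (phase x * phase (y + stretch * tent x))"
      by (simp add: phase_rho cis_mult distrib_left add.assoc)
    ultimately show ?thesis
      by (simp add: pull_back_def sum_3 T tw s3 algebra_simps)
  qed
  have sl: "slice j (pull_back w) x y = phase x * phase (y + stretch * tent x) *
      (of_real (dynamo_jac (mk x y 0) $ 1 $ j) * slice 1 w (x + stretch * tent (y + stretch * tent x)) (y + stretch * tent x)
      + of_real (dynamo_jac (mk x y 0) $ 2 $ j) * slice 2 w (x + stretch * tent (y + stretch * tent x)) (y + stretch * tent x))" for x y j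
    using pb[of x y 0 j] by (simp add: slice_def)
  show "twisted (pull_back w)"
    unfolding twisted_def
  proof (intro conjI allI)
    show "bounded_field (pull_back w)" by (rule bounded_field_pull_back[OF bw])
    fix p
    obtain x y z where p: "p = mk x y z" by (rule mk_cases)
    show "pull_back w p $ 3 = 0"
      unfolding p pb by (simp add: dynamo_jac_def)
  next
    fix x y z i
    show "pull_back w (mk x y z) $ i = cis (2 * pi * z) * slice i (pull_back w) x y"
      unfolding pb sl ..
  qed
  have J: "dynamo_jac (mk x y 0) $ 1 $ 1 = 1 + stretch * slope (y + stretch * tent x) * (stretch * slope x)"
    "dynamo_jac (mk x y 0) $ 2 $ 1 = stretch * slope x"
    "dynamo_jac (mk x y 0) $ 1 $ 2 = stretch * slope (y + stretch * tent x)"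
    "dynamo_jac (mk x y 0) $ 2 $ 2 = 1" for x y
    by (simp_all add: dynamo_jac_def shear1_mk)
  show "slice 1 (pull_back w) = step1 (step1 (slice 1 w) (slice 2 w)) (step2 (slice 1 w))"
    unfolding fun_eq_iff sl J step1_def step2_def by (simp add: algebra_simps)
  show "slice 2 (pull_back w) = step2 (step1 (slice 1 w) (slice 2 w))"
    unfolding fun_eq_iff sl J step1_def step2_def by (simp add: algebra_simps)
qed

text \<open>The mode in z comes out of the convolution as a factor, so what the heat flow does to
  the coefficients is an average over planar translations, and \<open>good_average\<close>
  applies.\<close>

lemma twisted_heat:
  assumes \<epsilon>: "0 < \<epsilon>" and w: "twisted w"
  shows "twisted (heat \<epsilon> w)" "slice i (heat \<epsilon> w) = average lborel (twisted_kernel \<epsilon>) (\<lambda>v. v $ 1) (\<lambda>v. v $ 2) (slice i w)"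
proof -
  have bw: "bounded_field w" and w3: "\<And>p. w p $ 3 = 0"
    and tw: "\<And>x y z i. w (mk x y z) $ i = cis (2 * pi * z) * slice i w x y"
    using w by (auto simp: twisted_def)
  have nth: "heat \<epsilon> w p $ i = (\<integral>v. (heat_kernel \<epsilon> v *\<^sub>R w (torus_shift (- v) p)) $ i \<partial>lborel)" for p i
    unfolding heat_def by (rule integral_bounded_linear[OF bounded_linear_vec_nth integrable_heat[OF \<epsilon> bw], symmetric])
  have hm: "heat \<epsilon> w (mk x y z) $ i = cis (2 * pi * z) * average lborel (twisted_kernel \<epsilon>) (\<lambda>v. v $ 1) (\<lambda>v. v $ 2) (slice i w) x y" for x y z i
  proof -
    have "(heat_kernel \<epsilon> v *\<^sub>R w (torus_shift (- v) (mk x y z))) $ i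
        = cis (2 * pi * z) * (twisted_kernel \<epsilon> v * slice i w (x - v $ 1) (y - v $ 2))" for v
    proof -
      have "cis (2 * pi * (z - v $ 3)) = cis (2 * pi * z) * cis (- 2 * pi * v $ 3)"
        by (simp add: cis_mult algebra_simps)
      then show ?thesis
        unfolding vector_scaleR_component torus_shift_mk tw by (simp add: twisted_kernel_def scaleR_conv_of_real)
    qed
    then show ?thesis unfolding nth average_def by simp
  qed
  then show sl: "slice i (heat \<epsilon> w) = average lborel (twisted_kernel \<epsilon>) (\<lambda>v. v $ 1) (\<lambda>v. v $ 2) (slice i w)" for i
    by (simp add: slice_def fun_eq_iff)
  show "twisted (heat \<epsilon> w)"
    unfolding twisted_def
  proof (intro conjI allI)
    show "bounded_field (heat \<epsilon> w)" by (rule bounded_field_heat[OF \<epsilon> bw])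
    show "heat \<epsilon> w p $ 3 = 0" for p unfolding nth by (simp add: w3)
  qed (simp add: hm sl)
qed

text \<open>One average and two shears form a period of the dual iteration. The averaging may halve
  \<open>Phi\<close>, each shear at least doubles it, and the total is a factor 2; the true gain of
  a shear is far larger, but any fixed factor above 1 per period suffices.\<close>

lemma heat_step_good:
  assumes \<epsilon>: "0 < \<epsilon>" "\<epsilon> \<le> 1 / 10000" and w: "twisted w" and g: "good (slice 1 w) (slice 2 w) 450 (1 / 1000)"
  defines "w' \<equiv> pull_back (heat \<epsilon> w)"
  shows "twisted w'" "good (slice 1 w') (slice 2 w') 450 (1 / 1000)"
    "2 * norm (Phi (slice 1 w)) \<le> norm (Phi (slice 1 w'))"
proof -
  let ?a = "\<lambda>i. average lborel (twisted_kernel \<epsilon>) (\<lambda>v. v $ 1) (\<lambda>v. v $ 2) (slice i w)"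
  note th = twisted_heat[OF \<epsilon>(1) w]
  note tp = twisted_pull_back[OF th(1), folded w'_def, unfolded th(2)]
  show "twisted w'" by (rule tp(1))
  have k: "(\<integral>v. norm (twisted_kernel \<epsilon> v) \<partial>lborel) \<le> 1" using integral_heat_kernel(2)[OF \<epsilon>(1)] by simp
  have X: "(\<lambda>v::real^3. v $ j) \<in> borel_measurable lborel" for j by measurable
  note ga = lborel.good_average[OF integrable_twisted_kernel[OF \<epsilon>(1)] X X g k twisted_kernel_mass[OF \<epsilon>]]
  note s1 = good_step[OF ga(1)]
  \<comment> \<open>The output of the first shear is better than required and is weakened to the
    constants that a step expects.\<close>
  note s2 = good_step[OF good_mono[OF s1(1), of 900 "1 / 100"], simplified]
  show "good (slice 1 w') (slice 2 w') 450 (1 / 1000)" unfolding tp by (rule s2(1))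
  have st: "8 \<le> stretch" by (simp add: stretch_def)
  have m: "2 * u \<le> stretch / 4 * u" if "0 \<le> u" for u :: real
    using st that by (intro mult_right_mono) auto
  have "2 * norm (Phi (slice 1 w)) = 2 * (2 * (1 / 2 * norm (Phi (slice 1 w))))" by simp
  also have "\<dots> \<le> 2 * (2 * norm (Phi (?a 1)))" using ga(2) by (intro mult_left_mono) auto
  also have "\<dots> \<le> 2 * norm (Phi (step1 (?a 1) (?a 2)))"
    using order_trans[OF m[OF norm_ge_zero] s1(2)] by (intro mult_left_mono) auto
  also have "\<dots> \<le> norm (Phi (slice 1 w'))"
    unfolding tp by (rule order_trans[OF m[OF norm_ge_zero] good_step(2)[OF good_mono[OF s1(1)]]]) auto
  finally show "2 * norm (Phi (slice 1 w)) \<le> norm (Phi (slice 1 w'))" .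
qed

lemma borel_shift_x: "(\<lambda>p. torus_shift (vec3 s 0 0) p) \<in> borel_measurable borel"
  by measurable

text \<open>Averaging over translations in the first coordinate turns the integral over the torus into an
  average of line integrals.\<close>

lemma integral_slice_near_Phi:
  assumes f: "f \<in> borel_measurable borel" and fs: "\<And>x y z. f (mk x y z) = p x y" and g: "good p q A D"
  shows "norm ((\<integral>P. f P \<partial>torus_measure) - Phi p) \<le> D * norm (Phi p)"
proof -
  have pp: "planar p" "planar q" using good_planar[OF g] by auto
  obtain C where C: "\<And>x y. norm (p x y) \<le> C" using pp by (auto simp: planar_def)
  have fC: "norm (f P) \<le> C" for P by (cases P rule: mk_cases) (simp add: fs C)
  note [measurable] = f
  interpret P: pair_sigma_finite torus_measure "lborel :: real measure" ..
  define h where "h = (\<lambda>z. f (torus_shift (vec3 (snd z) 0 0) (fst z)))"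
  have "h \<in> borel_measurable (borel \<Otimes>\<^sub>M borel)" unfolding h_def by measurable
  then have hm: "h \<in> borel_measurable (torus_measure \<Otimes>\<^sub>M lborel)" by (simp cong: measurable_cong_sets)
  have hC: "norm (h z) \<le> C" for z by (simp add: h_def fC)
  define F where "F = (\<lambda>(P, s). indicat_real {0..1} s *\<^sub>R (1 * h (P, s)))"
  have Fi: "integrable (torus_measure \<Otimes>\<^sub>M lborel) F"
    using sigma_finite_measure.integrable_strip[OF torus.sigma_finite_measure_axioms _ hm hC, of "\<lambda>_. 1" 0 1] by (simp add: F_def case_prod_beta')
  define I where "I = (\<integral>P. f P \<partial>torus_measure)"
  define J where "J = (\<lambda>P. \<integral>s. F (P, s) \<partial>lborel)"
  have Ji: "integrable torus_measure J"
    using P.integrable_fst[of "\<lambda>P s. F (P, s)"] Fi by (simp add: J_def)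
  \<comment> \<open>Translation invariance makes the torus integral of f the same for every shift s,
    and the shifts range over an interval of length 1.\<close>
  have "(\<integral>P. F (P, s) \<partial>torus_measure) = indicat_real {0..1} s *\<^sub>R I" for s
    using integral_torus_invariant[OF borel_shift_x nn_integral_torus_shift f]
    by (simp add: F_def h_def I_def)
  then have "(\<integral>s. (\<integral>P. F (P, s) \<partial>torus_measure) \<partial>lborel) = I"
    by simp
  then have IJ: "I = (\<integral>P. J P \<partial>torus_measure)"
    using P.Fubini_integral[of "\<lambda>P s. F (P, s)"] Fi by (simp add: J_def)
  have JP: "norm (J P - Phi p) \<le> D * norm (Phi p)" for P
  proof -
    obtain x y z where P: "P = mk x y z" by (rule mk_cases)
    have bp: "bmeas (\<lambda>u. p u y)" by (intro bmeas_planar pp) auto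
    have "J P = (\<integral>s. indicat_real {0..1} s *\<^sub>R p (x + 1 * s) y \<partial>lborel)"
      by (simp add: J_def F_def h_def P torus_shift_mk fs)
    also have "\<dots> = integral {0..1} (\<lambda>s. p (x + 1 * s) y)"
      using set_borel_integral_eq_integral(2)[OF bmeas_set_integrable[OF bmeas_affine[OF bp, of x 1], of 0 1]]
      unfolding set_lebesgue_integral_def .
    also have "\<dots> = integral {x..x + 1} (\<lambda>u. p u y)"
      using integral_affine[OF bp, of 0 1 1 x] by (simp add: sint_def)
    also have "\<dots> = integral {x..x + 1} (line p q y 0)" by (simp add: line_def[abs_def])
    finally show ?thesis using good_unit[OF g, of 0 x y] by simp
  qed
  have D0: "0 \<le> D * norm (Phi p)" using JP[of undefined] norm_ge_zero order_trans by blast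
  have "I - Phi p = (\<integral>P. J P - Phi p \<partial>torus_measure)"
    using Ji torus.prob_space by (simp add: IJ)
  also have "norm \<dots> \<le> (\<integral>P. norm (J P - Phi p) \<partial>torus_measure)" by (rule integral_norm_bound)
  also have "\<dots> \<le> (\<integral>P. D * norm (Phi p) \<partial>torus_measure)"
    using Ji JP by (intro integral_mono) auto
  also have "\<dots> = D * norm (Phi p)" using torus.prob_space by simp
  finally show ?thesis by (simp add: I_def)
qed

definition z_mode :: "torus3 \<Rightarrow> complex" where
  "z_mode p = Complex (tcos 3 p) (tsin 3 p)"

lemma z_mode_mk [simp]: "z_mode (mk x y z) = cis (2 * pi * z)"
  by (simp add: z_mode_def mk_def tcos.abs_eq tsin.abs_eq complex_eq_iff)

lemma norm_z_mode [simp]: "norm (z_mode p) = 1"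
  by (cases p rule: mk_cases) simp

lemma borel_z_mode [measurable]: "z_mode \<in> borel_measurable borel"
proof -
  have "(\<lambda>p. of_real (tcos 3 p) + \<i> * of_real (tsin 3 p)) \<in> borel_measurable borel" by measurable
  then show ?thesis by (simp add: z_mode_def[abs_def] Complex_eq)
qed

text \<open>Serves on both sides of the pairing: as the 1-form c dx and as the vector field c times
  the first unit vector.\<close>

definition seed :: "(torus3 \<Rightarrow> complex) \<Rightarrow> torus3 \<Rightarrow> complex^3" where
  "seed c p = (\<chi> i. if i = 1 then c p else 0)"

lemma seed_field:
  assumes c: "c \<in> borel_measurable borel" "\<And>p. norm (c p) = 1"
  shows "bounded_field (seed c)" "norm (seed c p $ i) \<le> 1"
proof -
  show n: "norm (seed c p $ i) \<le> 1" for p i using c by (simp add: seed_def)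
  have "seed c \<in> borel_measurable borel"
    unfolding seed_def[abs_def]
  proof (rule borel_vec_lambda)
    show "(\<lambda>p. if i = 1 then c p else 0) \<in> borel_measurable borel" for i :: 3
      using c by (cases "i = 1") simp_all
  qed
  then show "bounded_field (seed c)" using norm_vec_lambda_le[OF n] unfolding bounded_field_def by blast
qed

lemma twisted_seed: "twisted (seed z_mode)" "slice 1 (seed z_mode) = (\<lambda>x y. 1)" "slice 2 (seed z_mode) = (\<lambda>x y. 0)"
  using seed_field(1)[of z_mode] by (auto simp: twisted_def slice_def seed_def fun_eq_iff)

text \<open>For dx the integral along a segment is its horizontal extent, at most its own square
  root for extents up to 1. It does not depend on the height, so displaced segments give equal
  values.\<close>

lemma good_seed: "good (\<lambda>x y. 1) (\<lambda>x y. 0) 450 (1 / 1000)"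
  unfolding good_def
proof (intro conjI allI impI)
  show "planar (\<lambda>x y. 1)" "planar (\<lambda>x y. 0)" by (auto simp: planar_def)
  have P: "Phi (\<lambda>x y. 1) = 1" by (simp add: Phi_def)
  then show "Phi (\<lambda>x y. 1) \<noteq> 0" by simp
  have l: "line (\<lambda>x y. 1) (\<lambda>x y. 0) a e = (\<lambda>s. 1)" for a e by (simp add: line_def fun_eq_iff)
  fix a e \<alpha> \<beta> :: real assume ab: "\<alpha> \<le> \<beta>" "\<beta> \<le> \<alpha> + 1"
  define u where "u = sqrt (\<beta> - \<alpha>)"
  have u: "0 \<le> u" "u \<le> 1" "\<beta> - \<alpha> = u * u" using ab by (auto simp: u_def)
  have "u * u \<le> 450 * u" using u mult_right_mono[of u 450 u] by simp
  then show "norm (integral {\<alpha>..\<beta>} (line (\<lambda>x y. 1) (\<lambda>x y. 0) a e)) \<le> 450 * sqrt (\<beta> - \<alpha>) * norm (Phi (\<lambda>x y. 1))"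
    unfolding l P u_def[symmetric] using ab u by (simp del: of_real_diff flip: of_real_diff)
next
  fix a1 e1 a2 e2 \<alpha> \<beta> \<delta> :: real assume "0 \<le> \<delta>"
  then show "norm (integral {\<alpha>..\<beta>} (line (\<lambda>x y. 1) (\<lambda>x y. 0) a1 e1) - integral {\<alpha>..\<beta>} (line (\<lambda>x y. 1) (\<lambda>x y. 0) a2 e2))
      \<le> 1 / 1000 * sqrt \<delta> * norm (Phi (\<lambda>x y. 1))"
    by (simp add: line_def[abs_def])
qed

text \<open>A single matrix element bounds the norm from below. On the dual side it is the torus
  mean of the first coefficient, which stays within 1/1000 of \<open>Phi\<close>; that gives the
  1/2, and \<open>norm_pairing\<close> contributes the 1/3. The constants do not depend on
  \<epsilon>.\<close>

lemma dynamo_growth: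
  assumes \<epsilon>: "0 < \<epsilon>" "\<epsilon> \<le> 1 / 10000"
  shows "1 / 6 * 2 ^ n \<le> l2_op_norm ((heat \<epsilon> \<circ> push_forward dynamo_map) ^^ n)"
proof -
  define w where "w = (\<lambda>n. ((pull_back \<circ> heat \<epsilon>) ^^ n) (seed z_mode))"
  have w: "twisted (w n) \<and> good (slice 1 (w n)) (slice 2 (w n)) 450 (1 / 1000) \<and> 2 ^ n \<le> norm (Phi (slice 1 (w n)))" for n
  proof (induction n)
    case 0
    have "Phi (\<lambda>x y. 1) = 1" by (simp add: Phi_def)
    then show ?case unfolding w_def using twisted_seed good_seed by simp
  next
    case (Suc n)
    have S: "w (Suc n) = pull_back (heat \<epsilon> (w n))" by (simp add: w_def)
    note hs = heat_step_good[OF \<epsilon>, of "w n", folded S]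
    show ?case using hs Suc.IH by auto
  qed
  \<comment> \<open>The conjugate mode cancels exp (2 \<pi> \<i> z) in the bilinear pairing and
    leaves the first coefficient alone.\<close>
  define B where "B = seed (\<lambda>p. cnj (z_mode p))"
  have cm: "(\<lambda>p. cnj (z_mode p)) \<in> borel_measurable borel"
    by (rule borel_measurable_continuous_on[where f = cnj]) (auto intro: continuous_intros)
  have B: "bounded_field B" "\<And>p i. norm (B p $ i) \<le> 1"
    unfolding B_def by (rule seed_field[OF cm]; simp)+
  have sd: "bounded_field (seed z_mode)" "\<And>p i. norm (seed z_mode p $ i) \<le> 1"
    by (rule seed_field; simp)+
  define K where "K = (heat \<epsilon> \<circ> push_forward dynamo_map) ^^ n"
  obtain C where "l2_bounded (push_forward dynamo_map) C" using l2_bounded_push_forward by blast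
  then have KB: "l2_bounded K ((1 * C) ^ n)"
    unfolding K_def by (intro l2_bounded_power l2_bounded_compose l2_bounded_heat \<epsilon>)
  have wn: "bounded_field (w n)" using w[of n] by (simp add: twisted_def)
  have dw: "dot_field (w n) B (mk x y z) = slice 1 (w n) x y" for x y z
  proof -
    have "w n (mk x y z) $ 1 = cis (2 * pi * z) * slice 1 (w n) x y" using w[of n] by (simp add: twisted_def)
    moreover have "cis (2 * pi * z) * cnj (cis (2 * pi * z)) = 1" by (simp add: cis_cnj cis_mult)
    ultimately show ?thesis by (simp add: dot_field_def sum_3 B_def seed_def mult.commute mult.left_commute)
  qed
  have near: "norm (pairing (w n) B - Phi (slice 1 (w n))) \<le> 1 / 1000 * norm (Phi (slice 1 (w n)))"
    unfolding pairing_def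
    using w[of n] by (intro integral_slice_near_Phi[where f = "dot_field (w n) B" and p = "slice 1 (w n)", OF _ dw] borel_dot_field bounded_field_borel wn B) auto
  have "norm (Phi (slice 1 (w n))) - norm (pairing (w n) B) \<le> norm (pairing (w n) B - Phi (slice 1 (w n)))"
    by (metis norm_minus_commute norm_triangle_ineq2)
  moreover have "2 ^ n \<le> norm (Phi (slice 1 (w n)))" using w[of n] by blast
  ultimately have "1 / 2 * 2 ^ n \<le> norm (pairing (w n) B)"
    using near norm_ge_zero[of "Phi (slice 1 (w n))"] by (simp del: norm_ge_zero)
  also have "pairing (w n) B = pairing (seed z_mode) (K B)"
    unfolding K_def w_def by (rule pairing_iterate(1)[OF \<epsilon>(1) B(1) sd(1), symmetric])
  also have "norm \<dots> \<le> 3 * l2_norm (K B)"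
    using pairing_iterate(2)[OF \<epsilon>(1) B(1) sd(1), of n] unfolding K_def
    by (intro norm_pairing sd bounded_field_borel bounded_field_l2)
  also have "\<dots> \<le> 3 * (l2_op_norm K * l2_norm B)"
    using l2_op_norm_bound[OF KB bounded_field_l2[OF B(1)]] by simp
  also have "\<dots> \<le> 3 * (l2_op_norm K * 1)"
  proof -
    have nB: "norm (B p) = 1" for p
      by (simp add: B_def seed_def norm_vec_def L2_set_def sum_3)
    have "l2_norm B = 1" using torus.prob_space by (simp add: l2_norm_def nB)
    then show ?thesis by simp
  qed
  finally show ?thesis by (simp add: K_def)
qed

theorem theorem1p1:
  shows "\<exists>T :: torus3 \<Rightarrow> torus3.
    (\<exists>C. C-lipschitz_on UNIV T) \<and> bij T \<and> torus_measure_preserving T \<and> isotopic_to_id T \<and>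
    (\<forall>\<epsilon>>0. convergent (\<lambda>n. root n (l2_op_norm ((heat \<epsilon> \<circ> push_forward T) ^^ n)))) \<and>
    Liminf (at_right 0)
      (\<lambda>\<epsilon>. ereal (lim (\<lambda>n. root n (l2_op_norm ((heat \<epsilon> \<circ> push_forward T) ^^ n))))) > 1"
proof (intro exI[of _ dynamo_map] conjI allI impI)
  show "\<exists>C. C-lipschitz_on UNIV dynamo_map" by (rule lipschitz_dynamo)
  show "bij dynamo_map" by (rule bij_dynamo)
  show "torus_measure_preserving dynamo_map" by (rule measure_preserving_dynamo)
  show "isotopic_to_id dynamo_map" by (rule isotopic_dynamo)
  obtain C where C: "l2_bounded (push_forward dynamo_map) C" using l2_bounded_push_forward by blast
  show conv: "convergent (\<lambda>n. root n (l2_op_norm ((heat \<epsilon> \<circ> push_forward dynamo_map) ^^ n)))" if "\<epsilon> > 0" for \<epsilon>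
    by (rule convergent_l2_op_norm[OF l2_bounded_compose[OF l2_bounded_heat[OF that] C]])
  \<comment> \<open>For each small \<epsilon> the constant 1/6 disappears under the n-th root, so
    the spectral radius is at least 2, uniformly near 0.\<close>
  have "\<forall>\<^sub>F \<epsilon> in at_right 0. ereal 2 \<le> ereal (lim (\<lambda>n. root n (l2_op_norm ((heat \<epsilon> \<circ> push_forward dynamo_map) ^^ n))))"
    unfolding eventually_at_right[OF zero_less_one]
  proof (intro exI[of _ "1 / 10000"] conjI allI impI)
    fix \<epsilon> :: real assume "0 < \<epsilon>" "\<epsilon> < 1 / 10000"
    then show "ereal 2 \<le> ereal (lim (\<lambda>n. root n (l2_op_norm ((heat \<epsilon> \<circ> push_forward dynamo_map) ^^ n))))"
      using lim_root_ge[OF conv _ _ dynamo_growth, of \<epsilon>] by simp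
  qed simp
  then have "ereal 2 \<le> Liminf (at_right 0) (\<lambda>\<epsilon>. ereal (lim (\<lambda>n. root n (l2_op_norm ((heat \<epsilon> \<circ> push_forward dynamo_map) ^^ n)))))"
    by (rule Liminf_bounded)
  moreover have "1 < ereal 2" by simp
  ultimately show "1 < Liminf (at_right 0) (\<lambda>\<epsilon>. ereal (lim (\<lambda>n. root n (l2_op_norm ((heat \<epsilon> \<circ> push_forward dynamo_map) ^^ n)))))"
    by (rule less_le_trans[rotated])
qed

end
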